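(* Suppose $M$ is an $\omega$-model of $\mathsf{ZF}$ and $g$ is Kumabe-Slaman generic over $M$. Then for every real $x\in M$, $\omega_1^{x\oplus g}=\omega_1^x$.
   Context: $\omega_1^x$ is the least ordinal with no presentation computable from $x$. A condition for Kumabe-Slaman forcing is a pair $p=(g_p,X_p)$ with $g_p\colon 2^{\le n}\to\{0,1,\bot\}$ for some $n$ (a partial labelling of a finite initial segment of $2^{<\mathbb{N}}$, $\bot$ meaning "explicitly unlabelled") and $X_p$ a finite subset of $2^{\mathbb{N}}$. $q\le p$ iff $g_p\subseteq g_q$, $X_p\subseteq X_q$, and for every $x\in X_p$ and every initial segment $\sigma$ of $x$ with $g_p(\sigma)$ undefined, $g_q(\sigma)$ is either undefined or $\bot$. Kumabe-Slaman forcing over $M$ is this poset as interpreted in $M$. For a filter $G$ generic over $M$ (meeting every dense set of this poset lying in $M$), the associated partial labelling is $g=\bigcup_{p\in G}g_p$ (a partial function $2^{<\mathbb{N}}\to\{0,1,\bot\}$, viewed as a real); such $g$ is called Kumabe-Slaman generic over $M$. An $\omega$-model is one whose natural numbers are the true natural numbers. *)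

theory Defs
  imports "HOL-Library.Nat_Bijection"
begin

unbundle cardinal_syntax

section \<open>Relative computability\<close>

type_synonym cantor = "nat \<Rightarrow> bool"

datatype prog =
    PZero
  | PSucc
  | PProj nat
  | POracle
  | PComp prog "prog list"
  | PRec prog prog
  | PMin prog

text \<open>\<open>computes x p ns v\<close>: the partial recursive program \<open>p\<close> with oracle \<open>x\<close> halts on the
  arguments \<open>ns\<close> with value \<open>v\<close>.\<close>

inductive computes :: "cantor \<Rightarrow> prog \<Rightarrow> nat list \<Rightarrow> nat \<Rightarrow> bool" for x :: cantor where
  "computes x PZero ns 0"
| "computes x PSucc (n # ns) (Suc n)"
| "i < length ns \<Longrightarrow> computes x (PProj i) ns (ns ! i)"
| "computes x POracle (n # ns) (of_bool (x n))"
| "list_all2 (\<lambda>q v. computes x q ns v) qs vs \<Longrightarrow> computes x p vs w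
     \<Longrightarrow> computes x (PComp p qs) ns w"
| "computes x p ns v \<Longrightarrow> computes x (PRec p q) (0 # ns) v"
| "computes x (PRec p q) (n # ns) v \<Longrightarrow> computes x q (n # v # ns) w
     \<Longrightarrow> computes x (PRec p q) (Suc n # ns) w"
| "(\<forall>m<n. \<exists>v. 0 < v \<and> computes x p (m # ns) v) \<Longrightarrow> computes x p (n # ns) 0
     \<Longrightarrow> computes x (PMin p) ns n"

definition computable_rel :: "cantor \<Rightarrow> nat rel \<Rightarrow> bool" where
  "computable_rel x r \<longleftrightarrow> (\<exists>p. \<forall>m n. computes x p [m, n] (of_bool ((m, n) \<in> r)))"

definition join :: "cantor \<Rightarrow> cantor \<Rightarrow> cantor"  (infixl "\<squnion>\<^sub>T" 65) where
  "x \<squnion>\<^sub>T y = (\<lambda>n. if even n then x (n div 2) else y (n div 2))"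


section \<open>Ordinals and the relativized Church-Kleene ordinal\<close>

text \<open>Ordinals are isomorphism classes of well-orders of sets of reals.  These include all
  countable ordinals and some uncountable ones, so that the minimum defining \<open>\<omega>\<^sub>1\<^sup>x\<close> exists
  (lemma \<open>ex_not_presentable\<close>).\<close>

quotient_type ordinal = "nat set rel" / partial: "\<lambda>r s. r =o s"
proof (rule part_equivpI)
  show "\<exists>r :: nat set rel. r =o r"
    using card_of_Well_order ordIso_reflexive by blast
  show "symp (\<lambda>r s :: nat set rel. r =o s)"
    by (auto intro: sympI ordIso_symmetric)
  show "transp (\<lambda>r s :: nat set rel. r =o s)"
    by (auto intro: transpI ordIso_transitive)
qed

lemma ordIso_refl_iff: "r =o r \<longleftrightarrow> Well_order r"
  using ordIso_reflexive by (auto simp: ordIso_def)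

instantiation ordinal :: wellorder
begin

lift_definition less_eq_ordinal :: "ordinal \<Rightarrow> ordinal \<Rightarrow> bool" is "\<lambda>r s. r \<le>o s"
  by (meson ordIso_ordLeq_trans ordIso_symmetric ordLeq_ordIso_trans)

lift_definition less_ordinal :: "ordinal \<Rightarrow> ordinal \<Rightarrow> bool" is "\<lambda>r s. r <o s"
  by (meson ordIso_ordLess_trans ordIso_symmetric ordLess_ordIso_trans)

instance
proof
  fix a b c :: ordinal
  show "(a < b) = (a \<le> b \<and> \<not> b \<le> a)"
    by transfer (use not_ordLeq_iff_ordLess ordLess_imp_ordLeq ordIso_refl_iff in blast)
  show "a \<le> a"
    by transfer (rule ordIso_imp_ordLeq)
  show "a \<le> b \<Longrightarrow> b \<le> c \<Longrightarrow> a \<le> c"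
    by transfer (rule ordLeq_transitive)
  show "a \<le> b \<Longrightarrow> b \<le> a \<Longrightarrow> a = b"
    by transfer (simp add: ordIso_iff_ordLeq)
  show "a \<le> b \<or> b \<le> a"
    by transfer (use ordLeq_total ordIso_refl_iff in blast)
next
  fix P :: "ordinal \<Rightarrow> bool" and a :: ordinal
  assume step: "\<And>y. (\<And>z. z < y \<Longrightarrow> P z) \<Longrightarrow> P y"
  have "P (abs_ordinal r)" if "r =o r" for r
    using that
  proof (induction r rule: wf_induct_rule[OF wf_ordLess])
    case (1 r)
    show ?case
    proof (rule step)
      fix z assume z: "z < abs_ordinal r"
      define s where "s = rep_ordinal z"
      have s: "s =o s" "z = abs_ordinal s"
        unfolding s_def using Quotient_rep_reflp[OF Quotient_ordinal]
          Quotient_abs_rep[OF Quotient_ordinal] by simp_all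
      with z 1 have "s <o r"
        by (simp add: less_ordinal.abs_eq)
      with 1 s show "P z" by blast
    qed
  qed
  from this[of "rep_ordinal a"] show "P a"
    using Quotient_rep_reflp[OF Quotient_ordinal, of a]
      Quotient_abs_rep[OF Quotient_ordinal, of a] by simp
qed

end

lift_definition has_type :: "nat rel \<Rightarrow> ordinal \<Rightarrow> bool" is "\<lambda>r s. r =o s"
  by (meson ordIso_symmetric ordIso_transitive)

text \<open>A presentation is a well-order of a set of natural numbers, given by its reflexive order
  relation; \<open>n\<close> is in its field iff \<open>(n, n)\<close> is in the relation.\<close>

definition presentable :: "cantor \<Rightarrow> ordinal \<Rightarrow> bool" where
  "presentable x \<alpha> \<longleftrightarrow> (\<exists>r. Well_order r \<and> computable_rel x r \<and> has_type r \<alpha>)"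

definition omega1 :: "cantor \<Rightarrow> ordinal" where
  "omega1 x = (LEAST \<alpha>. \<not> presentable x \<alpha>)"

lemma ex_not_presentable: "\<exists>\<alpha>. \<not> presentable x \<alpha>"
proof
  let ?c = "|UNIV :: nat set set|"
  show "\<not> presentable x (abs_ordinal ?c)"
  proof
    assume "presentable x (abs_ordinal ?c)"
    then obtain r :: "nat rel" where "has_type r (abs_ordinal ?c)"
      unfolding presentable_def by blast
    then have "r =o ?c"
      using has_type.abs_eq[OF ordIso_reflexive[OF card_of_Well_order]] by blast
    then obtain f where "bij_betw f (Field r) (UNIV :: nat set set)"
      unfolding ordIso_def iso_def by (auto simp: Field_card_of)
    then have "f ` Field r = UNIV"
      by (simp add: bij_betw_def)
    then have "surj f" by blast
    then show False
      using Cantors_theorem[of "UNIV :: nat set"] by auto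
  qed
qed


section \<open>Models of set theory\<close>

text \<open>A structure is a set \<open>M\<close> with a binary relation \<open>E\<close> interpreting membership; \<open>E\<close> need
  not be well-founded.  Variables of formulas are named by natural numbers.\<close>

datatype fm =
    FMem nat nat
  | FEq nat nat
  | FNeg fm
  | FConj fm fm
  | FAll nat fm

context
  fixes M :: "'a set" and E :: "'a \<Rightarrow> 'a \<Rightarrow> bool"
begin

primrec sat :: "fm \<Rightarrow> (nat \<Rightarrow> 'a) \<Rightarrow> bool" where
  "sat (FMem i j) e \<longleftrightarrow> E (e i) (e j)"
| "sat (FEq i j) e \<longleftrightarrow> e i = e j"
| "sat (FNeg \<phi>) e \<longleftrightarrow> \<not> sat \<phi> e"
| "sat (FConj \<phi> \<psi>) e \<longleftrightarrow> sat \<phi> e \<and> sat \<psi> e"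
| "sat (FAll i \<phi>) e \<longleftrightarrow> (\<forall>a\<in>M. sat \<phi> (e(i := a)))"

text \<open>The following predicates are relativized to the structure, i.e. \<open>foo_in a b\<close> says
  that the structure satisfies the set-theoretic formula \<open>foo\<close> of \<open>a\<close>, \<open>b\<close>.\<close>

definition subset_in :: "'a \<Rightarrow> 'a \<Rightarrow> bool" where
  "subset_in a b \<longleftrightarrow> a \<in> M \<and> b \<in> M \<and> (\<forall>z\<in>M. E z a \<longrightarrow> E z b)"

definition empty_in :: "'a \<Rightarrow> bool" where
  "empty_in a \<longleftrightarrow> a \<in> M \<and> (\<forall>z\<in>M. \<not> E z a)"

definition succ_in :: "'a \<Rightarrow> 'a \<Rightarrow> bool" where
  "succ_in a b \<longleftrightarrow> a \<in> M \<and> b \<in> M \<and> (\<forall>z\<in>M. E z b \<longleftrightarrow> E z a \<or> z = a)"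

definition inductive_in :: "'a \<Rightarrow> bool" where
  "inductive_in i \<longleftrightarrow> i \<in> M \<and> (\<exists>a\<in>M. empty_in a \<and> E a i) \<and>
     (\<forall>a\<in>M. E a i \<longrightarrow> (\<exists>b\<in>M. succ_in a b \<and> E b i))"

definition omega_in :: "'a \<Rightarrow> bool" where
  "omega_in w \<longleftrightarrow> inductive_in w \<and> (\<forall>i\<in>M. inductive_in i \<longrightarrow> subset_in w i)"

definition upair_in :: "'a \<Rightarrow> 'a \<Rightarrow> 'a \<Rightarrow> bool" where
  "upair_in a b c \<longleftrightarrow> a \<in> M \<and> b \<in> M \<and> c \<in> M \<and> (\<forall>z\<in>M. E z c \<longleftrightarrow> z = a \<or> z = b)"

definition opair_in :: "'a \<Rightarrow> 'a \<Rightarrow> 'a \<Rightarrow> bool" where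
  "opair_in a b p \<longleftrightarrow> (\<exists>u\<in>M. \<exists>v\<in>M. upair_in a a u \<and> upair_in a b v \<and> upair_in u v p)"

definition app_in :: "'a \<Rightarrow> 'a \<Rightarrow> 'a \<Rightarrow> bool" where
  "app_in f a b \<longleftrightarrow> f \<in> M \<and> (\<exists>p\<in>M. opair_in a b p \<and> E p f)"

definition function_in :: "'a \<Rightarrow> 'a \<Rightarrow> 'a \<Rightarrow> bool" where
  "function_in f a b \<longleftrightarrow> f \<in> M \<and> a \<in> M \<and> b \<in> M \<and>
     (\<forall>p\<in>M. E p f \<longrightarrow> (\<exists>u\<in>M. \<exists>v\<in>M. E u a \<and> E v b \<and> opair_in u v p)) \<and>
     (\<forall>u\<in>M. E u a \<longrightarrow> (\<exists>!v. v \<in> M \<and> app_in f u v))"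

definition bijection_in :: "'a \<Rightarrow> 'a \<Rightarrow> 'a \<Rightarrow> bool" where
  "bijection_in f a b \<longleftrightarrow> function_in f a b \<and>
     (\<forall>v\<in>M. E v b \<longrightarrow> (\<exists>!u. u \<in> M \<and> app_in f u v))"

definition finite_in :: "'a \<Rightarrow> bool" where
  "finite_in a \<longleftrightarrow>
     (\<exists>w\<in>M. \<exists>n\<in>M. \<exists>f\<in>M. omega_in w \<and> E n w \<and> bijection_in f n a)"

definition ZF_model :: bool where
  "ZF_model \<longleftrightarrow>
    \<comment> \<open>extensionality\<close>
    (\<forall>a\<in>M. \<forall>b\<in>M. (\<forall>z\<in>M. E z a \<longleftrightarrow> E z b) \<longrightarrow> a = b) \<and>
    \<comment> \<open>foundation\<close>
    (\<forall>a\<in>M. (\<exists>z\<in>M. E z a) \<longrightarrow> (\<exists>z\<in>M. E z a \<and> (\<forall>y\<in>M. \<not> (E y z \<and> E y a)))) \<and>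
    \<comment> \<open>pairing\<close>
    (\<forall>a\<in>M. \<forall>b\<in>M. \<exists>c\<in>M. upair_in a b c) \<and>
    \<comment> \<open>union\<close>
    (\<forall>a\<in>M. \<exists>u\<in>M. \<forall>z\<in>M. E z u \<longleftrightarrow> (\<exists>y\<in>M. E z y \<and> E y a)) \<and>
    \<comment> \<open>power set\<close>
    (\<forall>a\<in>M. \<exists>b\<in>M. \<forall>z\<in>M. E z b \<longleftrightarrow> subset_in z a) \<and>
    \<comment> \<open>infinity\<close>
    (\<exists>i\<in>M. inductive_in i) \<and>
    \<comment> \<open>separation\<close>
    (\<forall>\<phi> e. range e \<subseteq> M \<longrightarrow>
      (\<forall>a\<in>M. \<exists>b\<in>M. \<forall>z\<in>M. E z b \<longleftrightarrow> E z a \<and> sat \<phi> (e(0 := z)))) \<and>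
    \<comment> \<open>replacement\<close>
    (\<forall>\<phi> e. range e \<subseteq> M \<longrightarrow>
      (\<forall>a\<in>M.
        (\<forall>u\<in>M. E u a \<longrightarrow> (\<forall>v\<in>M. \<forall>v'\<in>M.
          sat \<phi> (e(0 := u, 1 := v)) \<and> sat \<phi> (e(0 := u, 1 := v')) \<longrightarrow> v = v')) \<longrightarrow>
        (\<exists>b\<in>M. \<forall>v\<in>M. E v b \<longleftrightarrow> (\<exists>u\<in>M. E u a \<and> sat \<phi> (e(0 := u, 1 := v))))))"

text \<open>\<open>numeral_in n a\<close>: \<open>a\<close> is the von Neumann numeral of the true natural number \<open>n\<close>.\<close>

primrec numeral_in :: "nat \<Rightarrow> 'a \<Rightarrow> bool" where
  "numeral_in 0 a \<longleftrightarrow> empty_in a"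
| "numeral_in (Suc n) a \<longleftrightarrow> (\<exists>b\<in>M. numeral_in n b \<and> succ_in b a)"

definition omega_model :: bool where
  "omega_model \<longleftrightarrow> (\<forall>w\<in>M. omega_in w \<longrightarrow> (\<forall>a\<in>M. E a w \<longrightarrow> (\<exists>n. numeral_in n a)))"

definition real_in :: "'a \<Rightarrow> bool" where
  "real_in a \<longleftrightarrow> (\<exists>w\<in>M. \<exists>t\<in>M. omega_in w \<and> numeral_in 2 t \<and> function_in a w t)"

text \<open>\<open>string_of_length_in k s\<close>: \<open>s\<close> is an element of \<open>2\<^sup>k\<close>.\<close>

definition string_of_length_in :: "'a \<Rightarrow> 'a \<Rightarrow> bool" where
  "string_of_length_in k s \<longleftrightarrow>
     (\<exists>w\<in>M. \<exists>t\<in>M. omega_in w \<and> E k w \<and> numeral_in 2 t \<and> function_in s k t)"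

text \<open>\<open>d\<close> is \<open>2\<^sup>\<le>\<^sup>n\<close>.\<close>

definition strings_upto_in :: "'a \<Rightarrow> 'a \<Rightarrow> bool" where
  "strings_upto_in n d \<longleftrightarrow> n \<in> M \<and> d \<in> M \<and>
     (\<forall>s\<in>M. E s d \<longleftrightarrow> (\<exists>k\<in>M. (E k n \<or> k = n) \<and> string_of_length_in k s))"

definition initial_segment_in :: "'a \<Rightarrow> 'a \<Rightarrow> bool" where
  "initial_segment_in s a \<longleftrightarrow> (\<exists>k\<in>M. string_of_length_in k s) \<and> subset_in s a"


section \<open>Kumabe-Slaman forcing\<close>

text \<open>The labels \<open>0\<close>, \<open>1\<close>, \<open>\<bottom>\<close> are the numerals \<open>0\<close>, \<open>1\<close>, \<open>2\<close>, so the set of labels is the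
  numeral \<open>3\<close>.\<close>

definition KS_pair :: "'a \<Rightarrow> 'a \<Rightarrow> 'a \<Rightarrow> bool" where
  "KS_pair p g X \<longleftrightarrow> p \<in> M \<and> g \<in> M \<and> X \<in> M \<and> opair_in g X p \<and>
     (\<exists>w\<in>M. \<exists>n\<in>M. \<exists>d\<in>M. \<exists>l\<in>M. omega_in w \<and> E n w \<and> strings_upto_in n d \<and>
        numeral_in 3 l \<and> function_in g d l) \<and>
     finite_in X \<and> (\<forall>a\<in>M. E a X \<longrightarrow> real_in a)"

definition KS_cond :: "'a \<Rightarrow> bool" where
  "KS_cond p \<longleftrightarrow> (\<exists>g X. KS_pair p g X)"

definition KS_le :: "'a \<Rightarrow> 'a \<Rightarrow> bool" where
  "KS_le q p \<longleftrightarrow> (\<exists>gq Xq gp Xp. KS_pair q gq Xq \<and> KS_pair p gp Xp \<and>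
     subset_in gp gq \<and> subset_in Xp Xq \<and>
     (\<forall>a\<in>M. E a Xp \<longrightarrow>
       (\<forall>s\<in>M. initial_segment_in s a \<and> \<not> (\<exists>l\<in>M. app_in gp s l) \<longrightarrow>
         (\<forall>l\<in>M. app_in gq s l \<longrightarrow> numeral_in 2 l))))"

definition KS_filter :: "'a set \<Rightarrow> bool" where
  "KS_filter G \<longleftrightarrow> G \<noteq> {} \<and> (\<forall>p\<in>G. KS_cond p) \<and>
     (\<forall>p\<in>G. \<forall>q. KS_le p q \<longrightarrow> q \<in> G) \<and>
     (\<forall>p\<in>G. \<forall>q\<in>G. \<exists>r\<in>G. KS_le r p \<and> KS_le r q)"

definition KS_dense_in :: "'a \<Rightarrow> bool" where
  "KS_dense_in D \<longleftrightarrow> D \<in> M \<and> (\<forall>p\<in>M. E p D \<longrightarrow> KS_cond p) \<and>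
     (\<forall>p\<in>M. KS_cond p \<longrightarrow> (\<exists>q\<in>M. E q D \<and> KS_le q p))"

definition KS_generic_filter :: "'a set \<Rightarrow> bool" where
  "KS_generic_filter G \<longleftrightarrow> KS_filter G \<and> (\<forall>D\<in>M. KS_dense_in D \<longrightarrow> (\<exists>p\<in>G. E p D))"

end


section \<open>Passing from elements of an \<open>\<omega>\<close>-model to true reals and strings\<close>

datatype label = L0 | L1 | LBot

primrec label_code :: "label \<Rightarrow> nat" where
  "label_code L0 = 0"
| "label_code L1 = 1"
| "label_code LBot = 2"

context
  fixes M :: "'a set" and E :: "'a \<Rightarrow> 'a \<Rightarrow> bool"
begin

definition codes_real :: "'a \<Rightarrow> cantor \<Rightarrow> bool" where
  "codes_real a x \<longleftrightarrow> real_in M E a \<and>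
     (\<forall>n. \<exists>i\<in>M. \<exists>b\<in>M. numeral_in M E n i \<and> numeral_in M E (of_bool (x n)) b \<and>
        app_in M E a i b)"

definition contains_real :: "cantor \<Rightarrow> bool" where
  "contains_real x \<longleftrightarrow> (\<exists>a\<in>M. codes_real a x)"

definition codes_string :: "'a \<Rightarrow> bool list \<Rightarrow> bool" where
  "codes_string s \<sigma> \<longleftrightarrow>
     (\<exists>k\<in>M. numeral_in M E (length \<sigma>) k \<and> string_of_length_in M E k s) \<and>
     (\<forall>n<length \<sigma>. \<exists>i\<in>M. \<exists>b\<in>M. numeral_in M E n i \<and> numeral_in M E (of_bool (\<sigma> ! n)) b \<and>
        app_in M E s i b)"

text \<open>A partial labelling of \<open>2\<^sup><\<^sup>\<nat>\<close> is given by its graph; this is the graph of \<open>g\<^sub>p\<close>.\<close>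

definition KS_labelling :: "'a \<Rightarrow> (bool list \<times> label) set" where
  "KS_labelling p = {(\<sigma>, l). \<exists>g\<in>M. \<exists>X\<in>M. \<exists>s\<in>M. \<exists>c\<in>M. KS_pair M E p g X \<and>
     codes_string s \<sigma> \<and> numeral_in M E (label_code l) c \<and> app_in M E g s c}"

definition KS_generic :: "(bool list \<times> label) set \<Rightarrow> bool" where
  "KS_generic g \<longleftrightarrow> (\<exists>G. KS_generic_filter M E G \<and> g = (\<Union>p\<in>G. KS_labelling p))"

end

definition labelling_real :: "(bool list \<times> label) set \<Rightarrow> cantor" where
  "labelling_real g = (\<lambda>n. \<exists>(\<sigma>, l) \<in> g.
     n = prod_encode (list_encode (map of_bool \<sigma>), label_code l))"

end

theory Submission
  imports Defs
begin

text \<open>Let \<open>r\<close> be a well-order computed by a program from \<open>x\<close> and the generic labelling.  Because a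
  condition is only strengthened by adding reals, the existence of reals \<open>X\<close> such that \<open>(h, X)\<close>
  forces an element into the well-founded part depends by compactness only on finite data, so the
  pairs (finite labelling, element) that can be forced into the well-founded part form the least
  fixed point of a monotone operator that is arithmetical in \<open>x\<close>.  The defences of the
  opponent in the associated game form an \<open>x\<close>-computable tree.  If \<open>r\<close> is well-founded, then by
  genericity some finite part of the generic puts the whole order into the fixed point of the
  model, the corresponding tree has no branch in the model, and its Kleene-Brouwer order is an
  \<open>x\<close>-computable linear order \<open>K\<close>, well-founded in the sense of the model, along which the fixed
  point is reached.  Induction along \<open>r\<close> and genericity show that \<open>r\<close> maps strictly increasingly
  into a truly well-founded initial segment of \<open>K\<close>; for the limit case one uses that the
  ill-founded part of \<open>K\<close> has no least element.  So \<open>r\<close> has an \<open>x\<close>-computable copy.\<close>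

text \<open>Forcing an element into the well-founded part quantifies over reals of \<open>M\<close>,
  so it is not visibly bounded by anything computable from \<open>x\<close>. Compactness removes the
  reals: whether \<open>h'\<close> extends \<open>h\<close> relative to \<open>k\<close> reals
  depends on boundedly many of their bits, so a defence against all \<open>k\<close>-tuples is a
  finite set of labellings that answers all finite bit patterns, and a bad tuple exists as soon as
  there are bad patterns at every level. A position keeps only the number \<open>k\<close> of added
  reals, and the rules of the game become computable. The other obstacle is that \<open>M\<close>
  may be ill-founded, so its belief that \<open>K\<close> is a well-order cannot be trusted, and its
  ordinals need not be ordinals. Stages of the fixed point are therefore indexed by the elements of
  \<open>K\<close> themselves, through a predicate that satisfies the recursion even on an
  ill-founded order. True well-foundedness of \<open>r\<close> drives two inductions: one puts the
  formal top into the fixed point, the other shows that suitably minimal forced indices lie in the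
  true well-founded part of \<open>K\<close>.\<close>

inductive_cases computes_PZeroE: "computes x PZero ns v"
inductive_cases computes_PSuccE: "computes x PSucc ns v"
inductive_cases computes_PProjE: "computes x (PProj i) ns v"
inductive_cases computes_POracleE: "computes x POracle ns v"
inductive_cases computes_PCompE: "computes x (PComp p qs) ns v"
inductive_cases computes_PRecE: "computes x (PRec p q) ns v"
inductive_cases computes_PMinE: "computes x (PMin p) ns v"

lemma computes_det: "computes x p ns v \<Longrightarrow> computes x p ns w \<Longrightarrow> v = w"
proof (induction arbitrary: w rule: computes.induct)
  case (5 ns qs vs p v)
  from "5.prems" obtain ws where ws: "list_all2 (\<lambda>q v. computes x q ns v) qs ws" "computes x p ws w"
    by (rule computes_PCompE)
  have "vs = ws"
    using 5(1) ws(1)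
    by (intro list_all2_all_nthI[where P = "(=)", unfolded list.rel_eq])
      (auto simp: list_all2_conv_all_nth)
  then show ?case using 5 ws by simp
next
  case (8 n p ns)
  from "8.prems" have w: "\<forall>m<w. \<exists>v>0. computes x p (m # ns) v" "computes x p (w # ns) 0"
    by (auto elim: computes_PMinE)
  show ?case
  proof (cases n w rule: linorder_cases)
    case less
    then show ?thesis using w 8 by (metis less_irrefl)
  next
    case greater
    then show ?thesis using w 8 by (metis less_irrefl)
  qed
next
  case (6 p ns v q)
  from "6.prems" show ?case by (rule computes_PRecE) (auto intro: "6.IH")
next
  case (7 p q n ns v u)
  from "7.prems" show ?case by (rule computes_PRecE) (auto dest: "7.IH")
qed (auto elim: computes_PZeroE computes_PSuccE computes_PProjE computes_POracleE)

section \<open>Recursion theory: closure properties of computable functions, numerical codes\<close>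

section \<open>Computable functions of a number environment\<close>

text \<open>Functions of an infinite environment of numbers that are computable and depend on finitely
  many entries.  Bound variables are handled by shifting the environment.\<close>

definition cf :: "cantor \<Rightarrow> ((nat \<Rightarrow> nat) \<Rightarrow> nat) \<Rightarrow> bool" where
  "cf x f \<longleftrightarrow> (\<exists>n0. \<forall>n\<ge>n0. \<exists>p. \<forall>e. computes x p (map e [0..<n]) (f e))"

abbreviation cb :: "cantor \<Rightarrow> ((nat \<Rightarrow> nat) \<Rightarrow> bool) \<Rightarrow> bool" where
  "cb x P \<equiv> cf x (\<lambda>e. of_bool (P e))"

abbreviation (input) sh :: "(nat \<Rightarrow> 'b) \<Rightarrow> nat \<Rightarrow> 'b" where
  "sh e \<equiv> (\<lambda>j. e (Suc j))"

lemma cf_var: "cf x (\<lambda>e. e i)"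
  unfolding cf_def
proof (intro exI[of _ "Suc i"] allI impI exI[of _ "PProj i"])
  fix n e assume "Suc i \<le> n"
  then show "computes x (PProj i) (map e [0..<n]) (e i)"
    using computes.intros(3)[of i "map e [0..<n]" x] by simp
qed

lemma cf_zero: "cf x (\<lambda>e. 0)"
  unfolding cf_def by (auto intro: computes.intros)

text \<open>Substitution is why \<open>cf\<close> asks for a program at every large arity: the inner
  functions have different thresholds, yet they must all run on one and the same argument
  list.\<close>

lemma cf_subst:
  assumes f: "cf x f" and t: "\<And>i. cf x (t i)"
  shows "cf x (\<lambda>e. f (\<lambda>i. t i e))"
proof -
  obtain n p where p: "\<And>e. computes x p (map e [0..<n]) (f e)"
    using f unfolding cf_def by blast
  obtain m where m: "\<And>i k. k \<ge> m i \<Longrightarrow> \<exists>q. \<forall>e. computes x q (map e [0..<k]) (t i e)"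
    using t unfolding cf_def by metis
  show ?thesis
    unfolding cf_def
  \<comment> \<open>Only the \<open>n\<close> entries passed to the program of \<open>f\<close>
    matter; the sum of their thresholds is a common bound.\<close>
  proof (intro exI[of _ "\<Sum>i<n. m i"] allI impI)
    fix k assume k: "(\<Sum>i<n. m i) \<le> k"
    have "\<exists>q. \<forall>e. computes x q (map e [0..<k]) (t i e)" if "i < n" for i
    proof (rule m)
      show "m i \<le> k" using k that member_le_sum[of i "{..<n}" m] by simp
    qed
    then obtain q where q: "\<And>i e. i < n \<Longrightarrow> computes x (q i) (map e [0..<k]) (t i e)" by metis
    have "computes x (PComp p (map q [0..<n])) (map e [0..<k]) (f (\<lambda>i. t i e))" for e
    proof (rule computes.intros(5))
      show "list_all2 (\<lambda>q v. computes x q (map e [0..<k]) v) (map q [0..<n])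
          (map (\<lambda>i. t i e) [0..<n])"
        using q by (simp add: list_all2_conv_all_nth)
    qed (rule p) 
    then show "\<exists>p. \<forall>e. computes x p (map e [0..<k]) (f (\<lambda>i. t i e))" by blast
  qed
qed


text \<open>\<open>PRec\<close> puts the counter and the previous value in front of the other
  arguments, whence the doubly shifted environment in the assumption on \<open>g\<close>.\<close>

lemma cf_rec:
  assumes f: "cf x f" and g: "cf x (\<lambda>e. g (e 0) (e 1) (\<lambda>j. e (Suc (Suc j))))" and k: "cf x k"
  shows "cf x (\<lambda>e. rec_nat (f e) (\<lambda>i v. g i v e) (k e))"
proof -
  obtain nf where nf: "\<And>n. n \<ge> nf \<Longrightarrow> \<exists>p. \<forall>e. computes x p (map e [0..<n]) (f e)"
    using f unfolding cf_def by blast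
  obtain ng where ng: "\<And>n. n \<ge> ng \<Longrightarrow>
      \<exists>p. \<forall>e. computes x p (map e [0..<n]) (g (e 0) (e 1) (\<lambda>j. e (Suc (Suc j))))"
    using g unfolding cf_def by blast
  obtain nk where nk: "\<And>n. n \<ge> nk \<Longrightarrow> \<exists>p. \<forall>e. computes x p (map e [0..<n]) (k e)"
    using k unfolding cf_def by blast
  show ?thesis
    unfolding cf_def
  proof (intro exI[of _ "nf + ng + nk"] allI impI)
    fix n assume n: "nf + ng + nk \<le> n"
    obtain pf where pf: "\<And>e. computes x pf (map e [0..<n]) (f e)"
      using nf[of n] n by auto
    obtain pg where pg: "\<And>e. computes x pg (map e [0..<Suc (Suc n)])
        (g (e 0) (e 1) (\<lambda>j. e (Suc (Suc j))))"
      using ng[of "Suc (Suc n)"] n by auto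
    obtain pk where pk: "\<And>e. computes x pk (map e [0..<n]) (k e)"
      using nk[of n] n by auto
    have rec: "computes x (PRec pf pg) (i # map e [0..<n]) (rec_nat (f e) (\<lambda>i v. g i v e) i)" for e i
    proof (induction i)
      case 0
      show ?case using pf by (auto intro: computes.intros)
    next
      case (Suc i)
      let ?v = "rec_nat (f e) (\<lambda>i v. g i v e) i"
      \<comment> \<open>The environment extended by counter and previous value, cut at
        \<open>n + 2\<close>, is exactly the argument list that \<open>PRec\<close> hands to its
        step program.\<close>
      have *: "map (case_nat i (case_nat ?v e)) [0..<Suc (Suc n)] = i # ?v # map e [0..<n]"
        by (rule nth_equalityI) (auto simp: nth_Cons split: nat.splits simp del: upt_Suc)
      show ?case
        using computes.intros(7)[OF Suc.IH] pg[of "case_nat i (case_nat ?v e)"]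
        unfolding * by simp
    qed
    have "computes x (PComp (PRec pf pg) (pk # map PProj [0..<n])) (map e [0..<n])
        (rec_nat (f e) (\<lambda>i v. g i v e) (k e))" for e
    proof (rule computes.intros(5)[OF _ rec])
      show "list_all2 (\<lambda>q v. computes x q (map e [0..<n]) v) (pk # map PProj [0..<n])
          (k e # map e [0..<n])"
        using pk computes.intros(3)[of _ "map e [0..<n]" x]
        by (auto simp: list_all2_conv_all_nth nth_Cons split: nat.splits)
    qed
    then show "\<exists>p. \<forall>e. computes x p (map e [0..<n])
        (rec_nat (f e) (\<lambda>i v. g i v e) (k e))" by blast
  qed
qed

lemma cf_shift: "cf x f \<Longrightarrow> cf x (\<lambda>e. f (sh e))"
  by (rule cf_subst) (auto intro: cf_var)

lemma cf_app1:
  assumes "cf x (\<lambda>e. F (e 0))" "cf x f"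
  shows "cf x (\<lambda>e. F (f e))"
  using cf_subst[OF assms(1), of "\<lambda>i. f"] assms(2) by simp

lemma cf_app2:
  assumes "cf x (\<lambda>e. F (e 0) (e 1))" "cf x f" "cf x g"
  shows "cf x (\<lambda>e. F (f e) (g e))"
  using cf_subst[OF assms(1), of "\<lambda>i. if i = 0 then f else g"] assms(2-) by simp

lemma cf_app3:
  assumes "cf x (\<lambda>e. F (e 0) (e 1) (e 2))" "cf x f" "cf x g" "cf x h"
  shows "cf x (\<lambda>e. F (f e) (g e) (h e))"
  using cf_subst[OF assms(1), of "\<lambda>i. if i = 0 then f else if i = 1 then g else h"] assms(2-) by simp

lemma cf_app4:
  assumes "cf x (\<lambda>e. F (e 0) (e 1) (e 2) (e 3))" "cf x f" "cf x g" "cf x h" "cf x k"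
  shows "cf x (\<lambda>e. F (f e) (g e) (h e) (k e))"
  using cf_subst[OF assms(1), of "\<lambda>i. if i = 0 then f else if i = 1 then g else if i = 2 then h else k"]
    assms(2-) by simp

lemma cf_Suc: "cf x f \<Longrightarrow> cf x (\<lambda>e. Suc (f e))"
proof (rule cf_app1[of x Suc])
  show "cf x (\<lambda>e. Suc (e 0))"
    unfolding cf_def
  proof (intro exI[of _ 1] allI impI exI[of _ PSucc])
    fix n and e :: "nat \<Rightarrow> nat" assume "1 \<le> (n::nat)"
    then have "map e [0..<n] = e 0 # map e [1..<n]" by (simp add: upt_conv_Cons)
    then show "computes x PSucc (map e [0..<n]) (Suc (e 0))" by (simp add: computes.intros)
  qed
qed

lemma cf_oracle: "cf x f \<Longrightarrow> cb x (\<lambda>e. x (f e))"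
proof (rule cf_app1[of x "\<lambda>n. of_bool (x n)"])
  show "cb x (\<lambda>e. x (e 0))"
    unfolding cf_def
  proof (intro exI[of _ 1] allI impI exI[of _ POracle])
    fix n and e :: "nat \<Rightarrow> nat" assume "1 \<le> (n::nat)"
    then have "map e [0..<n] = e 0 # map e [1..<n]" by (simp add: upt_conv_Cons)
    then show "computes x POracle (map e [0..<n]) (of_bool (x (e 0)))" by (simp add: computes.intros)
  qed
qed

lemma cf_const: "cf x (\<lambda>e. n)"
  by (induction n) (auto intro: cf_zero cf_Suc)

text \<open>Inserts a dummy variable for the previous value, so that a body with one bound variable
  can serve as the step of a recursion.\<close>

lemma cf_shift_skip:
  assumes "cf x (\<lambda>e. P (e 0) (sh e))"
  shows "cf x (\<lambda>e. P (e 0) (\<lambda>j. e (Suc (Suc j))))"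
proof -
  have "cf x (\<lambda>e. case i of 0 \<Rightarrow> e 0 | Suc j \<Rightarrow> e (Suc (Suc j)))" for i
    by (cases i) (auto intro: cf_var)
  from cf_subst[OF assms, of "\<lambda>i e. case i of 0 \<Rightarrow> e 0 | Suc j \<Rightarrow> e (Suc (Suc j))", OF this]
  show ?thesis by simp
qed

lemma cf_case:
  assumes "cf x f" "cf x (\<lambda>e. g (e 0) (sh e))" "cf x k"
  shows "cf x (\<lambda>e. case k e of 0 \<Rightarrow> f e | Suc i \<Rightarrow> g i e)"
proof -
  have "cf x (\<lambda>e. rec_nat (f e) (\<lambda>i v. g i e) (k e))"
  proof (rule cf_rec[OF assms(1) _ assms(3)])
    show "cf x (\<lambda>e. g (e 0) (\<lambda>j. e (Suc (Suc j))))"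
      using assms(2) by (rule cf_shift_skip)
  qed
  moreover have "rec_nat a (\<lambda>i v. b i) n = (case n of 0 \<Rightarrow> a | Suc i \<Rightarrow> b i)" for a :: nat and b n
    by (cases n) auto
  ultimately show ?thesis by simp
qed

lemma cf_If:
  assumes "cb x P" "cf x f" "cf x g"
  shows "cf x (\<lambda>e. if P e then f e else g e)"
proof -
  have "cf x (\<lambda>e. case of_bool (P e) of 0 \<Rightarrow> g e | Suc i \<Rightarrow> f e)"
    by (intro cf_case assms cf_shift)
  also have "(\<lambda>e. case of_bool (P e) of 0 \<Rightarrow> g e | Suc i \<Rightarrow> f e) = (\<lambda>e. if P e then f e else g e)"
    by auto
  finally show ?thesis .
qed

lemma cf_add: "cf x f \<Longrightarrow> cf x g \<Longrightarrow> cf x (\<lambda>e. f e + g e)"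
proof (rule cf_app2[of x "(+)"])
  have "cf x (\<lambda>e. rec_nat (e 0) (\<lambda>i v. Suc v) (e 1))"
    by (intro cf_rec cf_Suc cf_var)
  moreover have "rec_nat a (\<lambda>i v. Suc v) n = a + n" for a n by (induction n) auto
  ultimately show "cf x (\<lambda>e. e 0 + e 1)" by simp
qed

lemma cf_mult: "cf x f \<Longrightarrow> cf x g \<Longrightarrow> cf x (\<lambda>e. f e * g e)"
proof (rule cf_app2[of x "(*)"])
  have "cf x (\<lambda>e. rec_nat 0 (\<lambda>i v. v + e 0) (e 1))"
    by (intro cf_rec cf_add cf_zero cf_var)
  moreover have "rec_nat 0 (\<lambda>i v. v + a) n = a * n" for a n :: nat by (induction n) auto
  ultimately show "cf x (\<lambda>e. e 0 * e 1)" by simp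
qed

lemma cf_pred: "cf x f \<Longrightarrow> cf x (\<lambda>e. f e - 1)"
proof (rule cf_app1[of x "\<lambda>n. n - 1"])
  have "cf x (\<lambda>e. case e 0 of 0 \<Rightarrow> 0 | Suc i \<Rightarrow> i)"
    by (intro cf_case cf_zero cf_var)
  moreover have "(case n of 0 \<Rightarrow> 0 | Suc i \<Rightarrow> i) = n - 1" for n by (cases n) auto
  ultimately show "cf x (\<lambda>e. e 0 - 1)" by simp
qed

lemma cf_minus: "cf x f \<Longrightarrow> cf x g \<Longrightarrow> cf x (\<lambda>e. f e - g e)"
proof (rule cf_app2[of x "(-)"])
  have "cf x (\<lambda>e. rec_nat (e 0) (\<lambda>i v. v - 1) (e 1))"
    by (intro cf_rec cf_pred cf_var)
  moreover have "rec_nat a (\<lambda>i v. v - 1) n = a - n" for a n :: nat by (induction n) auto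
  ultimately show "cf x (\<lambda>e. e 0 - e 1)" by simp
qed

lemma cf_power2: "cf x f \<Longrightarrow> cf x (\<lambda>e. 2 ^ f e)"
proof (rule cf_app1[of x "\<lambda>n. 2 ^ n"])
  have "cf x (\<lambda>e. rec_nat 1 (\<lambda>i v. v + v) (e 0))"
    by (intro cf_rec cf_add cf_const cf_var)
  moreover have "rec_nat 1 (\<lambda>i v. v + v) n = (2 ^ n :: nat)" for n by (induction n) auto
  ultimately show "cf x (\<lambda>e. 2 ^ (e 0))" by simp
qed

lemma cb_cong: "cb x P \<Longrightarrow> (\<And>e. P e \<longleftrightarrow> Q e) \<Longrightarrow> cb x Q"
  by (simp add: fun_eq_iff)

lemma cb_not: "cb x P \<Longrightarrow> cb x (\<lambda>e. \<not> P e)"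
proof -
  assume "cb x P"
  then have "cf x (\<lambda>e. if P e then 0 else 1)" by (intro cf_If cf_const)
  also have "(\<lambda>e. if P e then 0 else 1 :: nat) = (\<lambda>e. of_bool (\<not> P e))" by auto
  finally show ?thesis .
qed

lemma cb_conj: "cb x P \<Longrightarrow> cb x Q \<Longrightarrow> cb x (\<lambda>e. P e \<and> Q e)"
proof -
  assume "cb x P" "cb x Q"
  then have "cf x (\<lambda>e. of_bool (P e) * of_bool (Q e))" by (rule cf_mult)
  also have "(\<lambda>e. of_bool (P e) * of_bool (Q e) :: nat) = (\<lambda>e. of_bool (P e \<and> Q e))" by auto
  finally show ?thesis .
qed

lemma cb_disj: "cb x P \<Longrightarrow> cb x Q \<Longrightarrow> cb x (\<lambda>e. P e \<or> Q e)"
  by (rule cb_cong[OF cb_not[OF cb_conj[OF cb_not cb_not, of x P Q]]]) auto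

lemma cb_imp: "cb x P \<Longrightarrow> cb x Q \<Longrightarrow> cb x (\<lambda>e. P e \<longrightarrow> Q e)"
  by (rule cb_cong[OF cb_disj[OF cb_not, of x P Q]]) auto

lemma cb_const: "cb x (\<lambda>e. b)"
  by (cases b) (auto intro: cf_const)

lemma cb_less: "cf x f \<Longrightarrow> cf x g \<Longrightarrow> cb x (\<lambda>e. f e < g e)"
proof -
  assume "cf x f" "cf x g"
  then have "cf x (\<lambda>e. case g e - f e of 0 \<Rightarrow> 0 | Suc i \<Rightarrow> 1)"
    by (intro cf_case cf_const cf_minus)
  also have "(\<lambda>e. case g e - f e of 0 \<Rightarrow> 0 :: nat | Suc i \<Rightarrow> 1) = (\<lambda>e. of_bool (f e < g e))"
    by (auto split: nat.splits)
  finally show ?thesis .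
qed

lemma cb_le: "cf x f \<Longrightarrow> cf x g \<Longrightarrow> cb x (\<lambda>e. f e \<le> g e)"
  by (rule cb_cong[OF cb_not[OF cb_less, of x g f]]) auto

lemma cb_eq: "cf x f \<Longrightarrow> cf x g \<Longrightarrow> cb x (\<lambda>e. f e = g e)"
  by (rule cb_cong[OF cb_conj[OF cb_le cb_le, of x f g g f]]) auto

lemma cb_all:
  assumes "cb x (\<lambda>e. P (e 0) (sh e))" "cf x f"
  shows "cb x (\<lambda>e. \<forall>i<f e. P i e)"
proof -
  have "cf x (\<lambda>e. rec_nat 1 (\<lambda>i v. v * of_bool (P i e)) (f e))"
  proof (rule cf_rec[OF cf_const _ assms(2)], rule cf_mult[OF cf_var])
    show "cb x (\<lambda>e. P (e 0) (\<lambda>j. e (Suc (Suc j))))"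
      using assms(1) by (rule cf_shift_skip)
  qed
  moreover have "rec_nat 1 (\<lambda>i v. v * of_bool (Q i)) n = (of_bool (\<forall>i<n. Q i) :: nat)" for n and Q :: "nat \<Rightarrow> bool"
    by (induction n) (auto simp: less_Suc_eq)
  ultimately show ?thesis by simp
qed

lemma cb_ex:
  assumes "cb x (\<lambda>e. P (e 0) (sh e))" "cf x f"
  shows "cb x (\<lambda>e. \<exists>i<f e. P i e)"
  by (rule cb_cong[OF cb_not[OF cb_all[of x "\<lambda>i e. \<not> P i e" f, OF cb_not[OF assms(1)] assms(2)]]]) auto

text \<open>Bounded search done by primitive recursion. It yields the inverses of the coding
  functions without \<open>PMin\<close>, so that no totality argument is required.\<close>

lemma cf_search:
  assumes R: "cb x (\<lambda>e. R (e 0) (sh e))" and b: "cf x b"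
    and f: "\<And>e. R (f e) e" "\<And>e. f e \<le> b e" "\<And>e y. R y e \<Longrightarrow> y = f e"
  shows "cf x f"
proof -
  have "cf x (\<lambda>e. rec_nat 0 (\<lambda>i v. if R i e then i else v) (Suc (b e)))"
  proof (rule cf_rec[OF cf_const _ cf_Suc[OF b]], rule cf_If[OF _ cf_var cf_var])
    show "cb x (\<lambda>e. R (e 0) (\<lambda>j. e (Suc (Suc j))))"
      using R by (rule cf_shift_skip)
  qed
  \<comment> \<open>The recursion keeps the last hit, and uniqueness of hits makes that the wanted
    value.\<close>
  moreover have "rec_nat 0 (\<lambda>i v. if R i e then i else v) n = (if f e < n then f e else 0)" for n e
  proof (induction n)
    case (Suc n)
    then show ?case using f(1)[of e] f(3)[of n e] by (cases "R n e") (auto simp: less_Suc_eq)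
  qed simp
  then have "rec_nat 0 (\<lambda>i v. if R i e then i else v) (Suc (b e)) = f e" for e
    using f(2)[of e] by (simp only: less_Suc_eq_le if_True)
  ultimately show ?thesis by (simp only: )
qed

subsection \<open>Pairing, lists and finite sets\<close>

abbreviation pr :: "nat \<Rightarrow> nat \<Rightarrow> nat" where "pr a b \<equiv> prod_encode (a, b)"
abbreviation fs :: "nat \<Rightarrow> nat" where "fs c \<equiv> fst (prod_decode c)"
abbreviation sn :: "nat \<Rightarrow> nat" where "sn c \<equiv> snd (prod_decode c)"

lemma pr_fs_sn: "pr (fs c) (sn c) = c"
  by simp

lemma fs_le: "fs c \<le> c" and sn_le: "sn c \<le> c"
  using le_prod_encode_1[of "fs c" "sn c"] le_prod_encode_2[of "sn c" "fs c"] by simp_all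

lemma pr_mono: "a \<le> c \<Longrightarrow> b \<le> d \<Longrightarrow> pr a b \<le> pr c d"
proof -
  assume "a \<le> c" "b \<le> d"
  moreover have "mono triangle"
    by (rule mono_iff_le_Suc[THEN iffD2]) simp
  ultimately show ?thesis
    unfolding prod_encode_def by (simp add: add_mono monoD)
qed

lemma pr_less: "a < c \<Longrightarrow> b \<le> d \<Longrightarrow> pr a b < pr c d"
  using pr_mono[of a c b d] prod_encode_eq[of "(a, b)" "(c, d)"] by (auto simp: order.order_iff_strict)

lemma cf_pr: "cf x f \<Longrightarrow> cf x g \<Longrightarrow> cf x (\<lambda>e. pr (f e) (g e))"
proof (rule cf_app2[of x pr])
  have "cf x (\<lambda>e. rec_nat 0 (\<lambda>i v. v + Suc i) (e 0 + e 1) + e 0)"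
    by (intro cf_rec cf_add cf_Suc cf_zero cf_var)
  moreover have "rec_nat 0 (\<lambda>i v. v + Suc i) n = triangle n" for n by (induction n) auto
  ultimately show "cf x (\<lambda>e. pr (e 0) (e 1))" by (simp add: prod_encode_def)
qed

lemma cf_fs: "cf x f \<Longrightarrow> cf x (\<lambda>e. fs (f e))"
proof (rule cf_app1[of x fs])
  show "cf x (\<lambda>e. fs (e 0))"
  proof (rule cf_search[where R = "\<lambda>y e. \<exists>i<Suc (e 0). pr y i = e 0" and b = "\<lambda>e. e 0"])
    show "\<exists>i<Suc (e 0). pr (fs (e 0)) i = e 0" for e
      by (rule exI[of _ "sn (e 0)"]) (simp add: sn_le less_Suc_eq_le)
    show "y = fs (e 0)" if "\<exists>i<Suc (e 0). pr y i = e 0" for e y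
      using that fst_conv prod_encode_inverse by metis
    show "cb x (\<lambda>e. \<exists>i<Suc (sh e 0). pr (e 0) i = sh e 0)"
      by (intro cb_ex cb_eq cf_pr cf_var cf_Suc)
  qed (simp_all add: fs_le cf_var)
qed

lemma cf_sn: "cf x f \<Longrightarrow> cf x (\<lambda>e. sn (f e))"
proof (rule cf_app1[of x sn])
  show "cf x (\<lambda>e. sn (e 0))"
  proof (rule cf_search[where R = "\<lambda>y e. \<exists>i<Suc (e 0). pr i y = e 0" and b = "\<lambda>e. e 0"])
    show "\<exists>i<Suc (e 0). pr i (sn (e 0)) = e 0" for e
      by (rule exI[of _ "fs (e 0)"]) (simp add: fs_le less_Suc_eq_le)
    show "y = sn (e 0)" if "\<exists>i<Suc (e 0). pr i y = e 0" for e y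
      using that by (metis snd_conv prod_encode_inverse)
    show "cb x (\<lambda>e. \<exists>i<Suc (sh e 0). pr i (e 0) = sh e 0)"
      by (intro cb_ex cb_eq cf_pr cf_var cf_Suc)
  qed (simp_all add: sn_le cf_var)
qed

lemma cf_half: "cf x f \<Longrightarrow> cf x (\<lambda>e. f e div 2)"
proof (rule cf_app1[of x "\<lambda>n. n div 2"])
  show "cf x (\<lambda>e. e 0 div 2)"
  proof (rule cf_search[where R = "\<lambda>y e. y + y = e 0 \<or> Suc (y + y) = e 0" and b = "\<lambda>e. e 0"])
    show "e 0 div 2 + e 0 div 2 = e 0 \<or> Suc (e 0 div 2 + e 0 div 2) = e 0" for e :: "nat \<Rightarrow> nat"
      by presburger
    show "cb x (\<lambda>e. e 0 + e 0 = sh e 0 \<or> Suc (e 0 + e 0) = sh e 0)"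
      by (intro cb_disj cb_eq cf_add cf_var cf_Suc)
  qed (auto intro: cf_var)
qed

lemma cb_odd: "cf x f \<Longrightarrow> cb x (\<lambda>e. odd (f e))"
proof -
  assume f: "cf x f"
  have "odd n \<longleftrightarrow> Suc (n div 2 + n div 2) = n" for n :: nat by presburger
  then show ?thesis by (simp only:) (intro cb_eq cf_add cf_half f cf_Suc)
qed

lemma cb_mem: "cf x f \<Longrightarrow> cf x g \<Longrightarrow> cb x (\<lambda>e. f e \<in> set_decode (g e))"
proof (rule cf_app2[of x "\<lambda>i t. of_bool (i \<in> set_decode t)"])
  have "cb x (\<lambda>e. odd (rec_nat (e 1) (\<lambda>i v. v div 2) (e 0)))"
    by (intro cb_odd cf_rec cf_half cf_var)
  moreover have "rec_nat t (\<lambda>i v. v div 2) n = t div 2 ^ n" for n t :: nat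
    by (induction n) (auto simp: mult.commute simp flip: div_mult2_eq)
  ultimately show "cb x (\<lambda>e. e 0 \<in> set_decode (e 1))" by (simp add: set_decode_def)
qed

lemma mem_set_decode_less: "i \<in> set_decode t \<Longrightarrow> i < t"
proof -
  assume "i \<in> set_decode t"
  then have "t div 2 ^ i \<noteq> 0" by (auto simp: set_decode_def intro: ccontr)
  then have "2 ^ i \<le> t" by (simp add: div_eq_0_iff not_less)
  then show "i < t" using less_exp[of i] by linarith
qed

lemma set_encode_less_power2: "A \<subseteq> {..<b} \<Longrightarrow> set_encode A < 2 ^ b"
proof -
  assume A: "A \<subseteq> {..<b}"
  have "set_encode A \<le> sum ((^) 2) {..<b}"
    unfolding set_encode_def by (rule sum_mono2) (use A in auto)
  also have "\<dots> = 2 ^ b - 1"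
    using sum_power2[of b] by (simp add: atLeast0LessThan)
  finally have "set_encode A \<le> 2 ^ b - 1" .
  moreover have "(0::nat) < 2 ^ b" by simp
  ultimately show ?thesis by linarith
qed

text \<open>A nonempty list is coded by the successor of a pair, and \<open>prod_decode 0\<close> is
  \<open>(0, 0)\<close>; hence the tail of the empty list is again the empty list, and iteration
  past the end is harmless.\<close>

definition tlc :: "nat \<Rightarrow> nat" where "tlc c = sn (c - 1)"
definition lenc :: "nat \<Rightarrow> nat" where "lenc c = length (list_decode c)"
definition nthc :: "nat \<Rightarrow> nat \<Rightarrow> nat" where "nthc c i = fs ((tlc ^^ i) c - 1)"

lemma list_decode_tlc: "list_decode (tlc c) = tl (list_decode c)"
proof (cases c)
  case 0
  have "prod_decode 0 = (0, 0)" by (simp add: prod_decode_def prod_decode_aux.simps)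
  then show ?thesis by (simp add: 0 tlc_def)
next
  case (Suc n)
  then show ?thesis by (simp add: tlc_def split: prod.split)
qed

lemma list_decode_tlc_iter: "list_decode ((tlc ^^ i) c) = drop i (list_decode c)"
  by (induction i) (auto simp: list_decode_tlc drop_Suc tl_drop)

lemma list_decode_hd: "c > 0 \<Longrightarrow> hd (list_decode c) = fs (c - 1)"
  by (cases c) (auto split: prod.split)

lemma list_decode_eq_Nil: "list_decode c = [] \<longleftrightarrow> c = 0"
  by (cases c) (auto split: prod.split)

lemma nthc_eq: "i < lenc c \<Longrightarrow> nthc c i = list_decode c ! i"
proof -
  assume i: "i < lenc c"
  then have "list_decode ((tlc ^^ i) c) \<noteq> []" by (simp add: list_decode_tlc_iter lenc_def)
  then have "(tlc ^^ i) c > 0" unfolding list_decode_eq_Nil by simp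
  then show ?thesis
    using list_decode_hd[of "(tlc ^^ i) c"] i
    by (simp add: nthc_def list_decode_tlc_iter lenc_def hd_drop_conv_nth)
qed

lemma length_le_list_encode: "length xs \<le> list_encode xs"
proof (induction xs)
  case (Cons a xs)
  then show ?case using le_prod_encode_2[of "list_encode xs" a] by simp
qed simp

lemma lenc_le: "lenc c \<le> c"
  using length_le_list_encode[of "list_decode c"] by (simp add: lenc_def)

lemma cf_tlc_iter: "cf x f \<Longrightarrow> cf x g \<Longrightarrow> cf x (\<lambda>e. (tlc ^^ f e) (g e))"
proof (rule cf_app2[of x "\<lambda>i c. (tlc ^^ i) c"])
  have "cf x (\<lambda>e. rec_nat (e 1) (\<lambda>i v. sn (v - 1)) (e 0))"
    by (intro cf_rec cf_sn cf_pred cf_var)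
  moreover have "rec_nat t (\<lambda>i v. sn (v - 1)) n = (tlc ^^ n) t" for n t :: nat
    by (induction n) (auto simp: tlc_def)
  ultimately show "cf x (\<lambda>e. (tlc ^^ (e 0)) (e 1))" by simp
qed

lemma cf_nthc: "cf x f \<Longrightarrow> cf x g \<Longrightarrow> cf x (\<lambda>e. nthc (f e) (g e))"
  unfolding nthc_def by (intro cf_fs cf_pred cf_tlc_iter)

lemma less_lenc_iff: "i < lenc c \<longleftrightarrow> (tlc ^^ i) c \<noteq> 0"
  using list_decode_eq_Nil[of "(tlc ^^ i) c"] by (auto simp: list_decode_tlc_iter lenc_def)

lemma cf_lenc: "cf x f \<Longrightarrow> cf x (\<lambda>e. lenc (f e))"
proof (rule cf_app1[of x lenc])
  show "cf x (\<lambda>e. lenc (e 0))"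
  proof (rule cf_search[where R = "\<lambda>y e. (tlc ^^ y) (e 0) = 0 \<and> (\<forall>i<y. (tlc ^^ i) (e 0) \<noteq> 0)"
        and b = "\<lambda>e. e 0"])
    show "cb x (\<lambda>e. (tlc ^^ e 0) (sh e 0) = 0 \<and> (\<forall>i<e 0. (tlc ^^ i) (sh e 0) \<noteq> 0))"
      by (intro cb_conj cb_all cb_not cb_eq cf_tlc_iter cf_var cf_zero)
    show "(tlc ^^ lenc (e 0)) (e 0) = 0 \<and> (\<forall>i<lenc (e 0). (tlc ^^ i) (e 0) \<noteq> 0)" for e
      using less_lenc_iff[of _ "e 0"] by auto
    show "y = lenc (e 0)" if "(tlc ^^ y) (e 0) = 0 \<and> (\<forall>i<y. (tlc ^^ i) (e 0) \<noteq> 0)" for y e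
    proof (rule ccontr)
      assume "y \<noteq> lenc (e 0)"
      then consider "y < lenc (e 0)" | "lenc (e 0) < y" by linarith
      then show False
        using that less_lenc_iff[of y "e 0"] less_lenc_iff[of "lenc (e 0)" "e 0"] by cases auto
    qed
  qed (auto intro: cf_var lenc_le)
qed

lemmas cf_intros = cf_var cf_const cf_Suc cf_add cf_mult cf_minus cf_power2 cf_If cf_pr cf_fs cf_sn
  cf_half cf_nthc cf_lenc
lemmas cb_intros = cb_const cb_conj cb_not cb_disj cb_imp cb_less cb_le cb_eq cb_all cb_ex cb_odd cb_mem

lemma computable_relI: "cb x (\<lambda>e. (e 0, e 1) \<in> r) \<Longrightarrow> computable_rel x r"
proof -
  assume "cb x (\<lambda>e. (e 0, e 1) \<in> r)"
  from cf_app2[of x "\<lambda>a b. of_bool ((a, b) \<in> r)" "\<lambda>e. e 0" "\<lambda>e. e 1", OF this cf_var cf_var]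
  obtain n0 where "\<And>n. n \<ge> n0 \<Longrightarrow> \<exists>p. \<forall>e. computes x p (map e [0..<n]) (of_bool ((e 0, e 1) \<in> r))"
    unfolding cf_def by blast
  then obtain p where p: "\<And>e. computes x p (map e [0..<n0 + 2]) (of_bool ((e 0, e 1) \<in> r))"
    by (meson le_add1)
  \<comment> \<open>A program obtained from \<open>cf\<close> expects a fixed, possibly larger
    number of arguments; the missing ones are supplied as zeros, on which the value does not
    depend.\<close>
  let ?q = "PComp p (PProj 0 # PProj 1 # replicate n0 PZero)"
  have "computes x ?q [a, b] (of_bool ((a, b) \<in> r))" for a b
  proof (rule computes.intros(5))
    let ?e = "case_nat a (case_nat b (\<lambda>_. 0))"
    have "map ?e [0..<n0 + 2] = a # b # replicate n0 0"
      by (rule nth_equalityI) (auto simp: nth_Cons split: nat.splits simp del: upt_Suc)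
    with p[of ?e] show "computes x p (a # b # replicate n0 0) (of_bool ((a, b) \<in> r))" by simp
    show "list_all2 (\<lambda>q v. computes x q [a, b] v) (PProj 0 # PProj 1 # replicate n0 PZero)
        (a # b # replicate n0 0)"
    proof -
      have "list_all2 (\<lambda>q v. computes x q [a, b] v) (replicate n0 PZero) (replicate n0 0)"
        by (simp add: list_all2_conv_all_nth computes.intros)
      then show ?thesis
        using computes.intros(3)[of 0 "[a, b]" x] computes.intros(3)[of 1 "[a, b]" x] by simp
    qed
  qed
  then show ?thesis unfolding computable_rel_def by blast
qed

lemma computable_relD: "computable_rel x r \<Longrightarrow> cb x (\<lambda>e. (e 0, e 1) \<in> r)"
proof -
  assume "computable_rel x r"
  then obtain p where p: "\<And>m n. computes x p [m, n] (of_bool ((m, n) \<in> r))"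
    unfolding computable_rel_def by blast
  show ?thesis
    unfolding cf_def
  proof (intro exI[of _ 2] allI impI exI[of _ "PComp p [PProj 0, PProj 1]"])
    fix n and e :: "nat \<Rightarrow> nat" assume n: "2 \<le> (n::nat)"
    show "computes x (PComp p [PProj 0, PProj 1]) (map e [0..<n]) (of_bool ((e 0, e 1) \<in> r))"
      using computes.intros(3)[of 0 "map e [0..<n]" x] computes.intros(3)[of 1 "map e [0..<n]" x] n p
      by (intro computes.intros(5)[of _ _ _ "[e 0, e 1]"]) auto
  qed
qed

section \<open>Finite labellings as numbers, and computation from a finite part of the
  generic\<close>

section \<open>Coding of conditions\<close>

definition scode :: "bool list \<Rightarrow> nat" where "scode \<sigma> = list_encode (map of_bool \<sigma>)"

text \<open>The height is stored beside the graph because it doubles as the stage up to which the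
  labelling answers oracle questions and searches are run.\<close>

definition hcode :: "nat \<Rightarrow> (bool list \<Rightarrow> label) \<Rightarrow> nat" where
  "hcode n f = pr n (set_encode {pr (scode \<sigma>) (label_code (f \<sigma>)) | \<sigma>. length \<sigma> \<le> n})"

definition valid :: "nat \<Rightarrow> bool" where "valid h \<longleftrightarrow> (\<exists>n f. h = hcode n f)"

abbreviation (input) hn :: "nat \<Rightarrow> nat" where "hn h \<equiv> fs h"
abbreviation (input) hs :: "nat \<Rightarrow> nat set" where "hs h \<equiv> set_decode (sn h)"

definition pref :: "nat \<Rightarrow> cantor \<Rightarrow> bool" where
  "pref c y \<longleftrightarrow> (\<forall>j<lenc c. nthc c j = of_bool (y j))"

text \<open>The order of the forcing on the labelling parts, \<open>2\<close> being the code of the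
  label bottom. Only the reals of the weaker condition constrain the extension, so a single set
  \<open>X\<close> occurs.\<close>

definition le :: "cantor set \<Rightarrow> nat \<Rightarrow> nat \<Rightarrow> bool" where
  "le X h' h \<longleftrightarrow> hn h \<le> hn h' \<and> hs h \<subseteq> hs h' \<and>
     (\<forall>q\<in>hs h' - hs h. sn q = 2 \<or> (\<forall>y\<in>X. \<not> pref (fs q) y))"

text \<open>A tuple of reals is packed into the columns of a single real, so that one real variable
  suffices when conditions are quantified.\<close>

definition sec :: "cantor \<Rightarrow> nat \<Rightarrow> cantor" where "sec z i = (\<lambda>j. z (pr i j))"
definition secs :: "nat \<Rightarrow> cantor \<Rightarrow> cantor set" where "secs k z = sec z ` {..<k}"
abbreviation (input) bt :: "nat \<Rightarrow> cantor" where "bt t \<equiv> (\<lambda>i. i \<in> set_decode t)"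

lemma le_refl: "le X h h"
  by (simp add: le_def)

lemma le_trans: "le X h' h \<Longrightarrow> le X' h'' h' \<Longrightarrow> X \<subseteq> X' \<Longrightarrow> le X h'' h"
  unfolding le_def by (intro conjI) (linarith, blast, blast)

text \<open>A string labelled by \<open>h'\<close> is no longer than its code, hence of length at
  most \<open>h'\<close>; comparing it with column \<open>i < k\<close> reads bits
  \<open>pr i j\<close> with \<open>j < h'\<close>, all below \<open>pr k h'\<close>.\<close>

lemma le_use:
  assumes "\<And>i. i < pr k h' \<Longrightarrow> z i = z' i"
  shows "le (secs k z) h' h \<longleftrightarrow> le (secs k z') h' h"
proof -
  have "pref (fs q) (sec z i) \<longleftrightarrow> pref (fs q) (sec z' i)" if "q \<in> hs h'" "i < k" for q i
  proof -
    have "lenc (fs q) \<le> h'"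
      using lenc_le[of "fs q"] fs_le[of q] mem_set_decode_less[OF that(1)] sn_le[of h'] by linarith
    then have "z (pr i j) = z' (pr i j)" if "j < lenc (fs q)" for j
      using that \<open>i < k\<close> by (intro assms pr_less) auto
    then show ?thesis unfolding pref_def sec_def by auto
  qed
  then show ?thesis unfolding le_def secs_def by auto
qed

lemma list_decode_scode: "list_decode (scode \<sigma>) = map of_bool \<sigma>"
  by (simp add: scode_def)

lemma lenc_scode[simp]: "lenc (scode \<sigma>) = length \<sigma>"
  by (simp add: lenc_def list_decode_scode)

lemma nthc_scode: "j < length \<sigma> \<Longrightarrow> nthc (scode \<sigma>) j = of_bool (\<sigma> ! j)"
  using nthc_eq[of j "scode \<sigma>"] by (simp add: list_decode_scode)

lemma of_bool_inj_nat[simp]: "(of_bool a :: nat) = of_bool b \<longleftrightarrow> a = b"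
  by (cases a; cases b) auto

lemma scode_inj[simp]: "scode \<sigma> = scode \<tau> \<longleftrightarrow> \<sigma> = \<tau>"
proof -
  have "inj (of_bool :: bool \<Rightarrow> nat)" by (rule injI) simp
  then show ?thesis
    unfolding scode_def by (auto simp: list_encode_eq inj_map_eq_map)
qed

lemma pref_scode: "pref (scode \<sigma>) y \<longleftrightarrow> (\<forall>j<length \<sigma>. \<sigma> ! j = y j)"
  unfolding pref_def by (auto simp: nthc_scode)

lemma label_code_inj[simp]: "label_code a = label_code b \<longleftrightarrow> a = b"
  by (cases a; cases b) auto

lemma label_code_less: "label_code a < 3"
  by (cases a) auto

lemma ex_label_code: "l < 3 \<Longrightarrow> \<exists>a. label_code a = l"
proof -
  assume "l < 3"
  then consider "l = label_code L0" | "l = label_code L1" | "l = label_code LBot" by fastforce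
  then show ?thesis by cases blast+
qed

lemma finite_hset: "finite {pr (scode \<sigma>) (label_code (f \<sigma>)) | \<sigma>. length \<sigma> \<le> n}"
proof -
  have "finite {\<sigma> :: bool list. length \<sigma> \<le> n}"
    using finite_lists_length_le[of "UNIV :: bool set" n] by simp
  then show ?thesis by simp
qed

lemma hn_hcode[simp]: "hn (hcode n f) = n"
  by (simp add: hcode_def)

lemma hs_hcode: "hs (hcode n f) = {pr (scode \<sigma>) (label_code (f \<sigma>)) | \<sigma>. length \<sigma> \<le> n}"
  unfolding hcode_def using finite_hset by (simp add: set_encode_inverse)

text \<open>Every quantifier is bounded by the code, which makes validity decidable. The third and
  fourth clauses start with the empty string and close the domain under prepending a bit, as list
  codes grow at the front; induction on the string then gives totality.\<close>

lemma valid_iff: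
  "valid h \<longleftrightarrow>
    (\<forall>q<sn h. q \<in> set_decode (sn h) \<longrightarrow> sn q < 3 \<and> lenc (fs q) \<le> fs h \<and>
       (\<forall>j<lenc (fs q). nthc (fs q) j < 2)) \<and>
    (\<forall>q<sn h. \<forall>q'<sn h. q \<in> set_decode (sn h) \<and> q' \<in> set_decode (sn h) \<and> fs q = fs q' \<longrightarrow> q = q') \<and>
    (\<exists>l<3. pr 0 l \<in> set_decode (sn h)) \<and>
    (\<forall>q<sn h. q \<in> set_decode (sn h) \<and> lenc (fs q) < fs h \<longrightarrow>
       (\<forall>b<2. \<exists>l<3. pr (Suc (pr b (fs q))) l \<in> set_decode (sn h)))"
  (is "_ \<longleftrightarrow> ?A \<and> ?B \<and> ?C \<and> ?D")
proof
  assume "valid h"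
  then obtain n f where h: "h = hcode n f" unfolding valid_def by blast
  have S: "set_decode (sn h) = {pr (scode \<sigma>) (label_code (f \<sigma>)) | \<sigma>. length \<sigma> \<le> n}"
    using hs_hcode h by simp
  have n: "fs h = n" using h by simp
  have A: ?A unfolding S n by (auto simp: label_code_less nthc_scode)
  have B: ?B unfolding S by auto
  have C: ?C
  proof (intro exI conjI)
    show "label_code (f []) < 3" by (rule label_code_less)
    show "pr 0 (label_code (f [])) \<in> set_decode (sn h)"
      unfolding S by (rule CollectI, rule exI[of _ "[]"]) (simp add: scode_def)
  qed
  have D: ?D
  proof (intro allI impI)
    fix q b :: nat assume q: "q \<in> set_decode (sn h) \<and> lenc (fs q) < fs h" and b: "b < 2"
    then obtain \<sigma> where \<sigma>: "q = pr (scode \<sigma>) (label_code (f \<sigma>))" "length \<sigma> < n"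
      unfolding S n by auto
    have sc: "Suc (pr b (fs q)) = scode ((b = 1) # \<sigma>)"
      using b by (auto simp: \<sigma> scode_def less_2_cases_iff)
    show "\<exists>l<3. pr (Suc (pr b (fs q))) l \<in> set_decode (sn h)"
    proof (intro exI conjI)
      show "label_code (f ((b = 1) # \<sigma>)) < 3" by (rule label_code_less)
      show "pr (Suc (pr b (fs q))) (label_code (f ((b = 1) # \<sigma>))) \<in> set_decode (sn h)"
        unfolding S sc using \<sigma>(2) by (intro CollectI exI[of _ "(b = 1) # \<sigma>"]) simp
    qed
  qed
  show "?A \<and> ?B \<and> ?C \<and> ?D" using A B C D by blast
next
  assume ABCD: "?A \<and> ?B \<and> ?C \<and> ?D"
  have A: "sn q < 3 \<and> lenc (fs q) \<le> fs h \<and> (\<forall>j<lenc (fs q). nthc (fs q) j < 2)" if "q \<in> hs h" for q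
    using ABCD mem_set_decode_less[OF that] that by simp
  have B: "q = q'" if "q \<in> hs h" "q' \<in> hs h" "fs q = fs q'" for q q'
    using ABCD mem_set_decode_less[OF that(1)] mem_set_decode_less[OF that(2)] that by simp
  have C: ?C using ABCD by simp
  have D: "\<exists>l<3. pr (Suc (pr b (fs q))) l \<in> hs h" if "q \<in> hs h" "lenc (fs q) < fs h" "b < 2" for q b
    using ABCD mem_set_decode_less[OF that(1)] that by simp
  have ex: "\<exists>l<3. pr (scode \<sigma>) l \<in> hs h" if "length \<sigma> \<le> fs h" for \<sigma>
    using that
  proof (induction \<sigma>)
    case Nil
    then show ?case using C by (simp add: scode_def)
  next
    case (Cons b \<sigma>)
    then obtain l where "pr (scode \<sigma>) l \<in> hs h" by auto
    moreover have "Suc (pr (of_bool b) (scode \<sigma>)) = scode (b # \<sigma>)" by (simp add: scode_def)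
    ultimately show ?case using D[of "pr (scode \<sigma>) l" "of_bool b"] Cons.prems by simp
  qed
  define f where "f \<sigma> = (SOME a. pr (scode \<sigma>) (label_code a) \<in> hs h)" for \<sigma>
  have f: "pr (scode \<sigma>) (label_code (f \<sigma>)) \<in> hs h" if len: "length \<sigma> \<le> fs h" for \<sigma>
  proof -
    obtain l where l: "l < 3" "pr (scode \<sigma>) l \<in> hs h" using ex[OF len] by blast
    obtain a where "label_code a = l" using ex_label_code[OF l(1)] by blast
    then have "pr (scode \<sigma>) (label_code a) \<in> hs h" using l by simp
    then show ?thesis unfolding f_def by (rule someI)
  qed
  have "hs h = {pr (scode \<sigma>) (label_code (f \<sigma>)) | \<sigma>. length \<sigma> \<le> fs h}"
  proof (intro equalityI subsetI)
    fix q assume q: "q \<in> hs h"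
    define \<sigma> where "\<sigma> = map (\<lambda>b. b = 1) (list_decode (fs q))"
    have "map of_bool \<sigma> = list_decode (fs q)"
    proof (rule nth_equalityI)
      fix i assume "i < length (map of_bool \<sigma> :: nat list)"
      then have i: "i < lenc (fs q)" by (simp add: \<sigma>_def lenc_def)
      then have "nthc (fs q) i < 2" using A[OF q] by blast
      then show "(map of_bool \<sigma> :: nat list) ! i = list_decode (fs q) ! i"
        using i nthc_eq[OF i] by (auto simp: \<sigma>_def lenc_def less_2_cases_iff)
    qed (simp add: \<sigma>_def)
    then have s: "scode \<sigma> = fs q" unfolding scode_def by simp
    then have l: "length \<sigma> \<le> fs h" using A[OF q] lenc_scode[of \<sigma>] by simp
    have "q = pr (scode \<sigma>) (label_code (f \<sigma>))"
      by (rule B[OF q f[OF l]]) (simp add: s)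
    then show "q \<in> {pr (scode \<sigma>) (label_code (f \<sigma>)) | \<sigma>. length \<sigma> \<le> fs h}" using l by blast
  qed (auto intro: f)
  then have "hcode (fs h) f = pr (fs h) (set_encode (hs h))" by (simp add: hcode_def)
  then have "h = hcode (fs h) f" by simp
  then show "valid h" unfolding valid_def by blast
qed

lemma cb_valid: "cf x f \<Longrightarrow> cb x (\<lambda>e. valid (f e))"
proof (rule cf_app1[of x "\<lambda>h. of_bool (valid h)"])
  show "cb x (\<lambda>e. valid (e 0))"
    unfolding valid_iff by (intro cb_intros cf_intros)
qed

lemma le_secs_iff:
  "le (secs k z) h' h \<longleftrightarrow> fs h \<le> fs h' \<and>
     (\<forall>q<sn h. q \<in> set_decode (sn h) \<longrightarrow> q \<in> set_decode (sn h')) \<and>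
     (\<forall>q<sn h'. q \<in> set_decode (sn h') \<and> q \<notin> set_decode (sn h) \<longrightarrow> sn q = 2 \<or>
        (\<forall>i<k. \<exists>j<lenc (fs q). nthc (fs q) j \<noteq> of_bool (z (pr i j))))"
proof -
  have 1: "hs h \<subseteq> hs h' \<longleftrightarrow> (\<forall>q<sn h. q \<in> set_decode (sn h) \<longrightarrow> q \<in> set_decode (sn h'))"
    by (auto dest: mem_set_decode_less)
  have 2: "(\<forall>q\<in>hs h' - hs h. P q) \<longleftrightarrow>
      (\<forall>q<sn h'. q \<in> set_decode (sn h') \<and> q \<notin> set_decode (sn h) \<longrightarrow> P q)" for P
    by (auto dest: mem_set_decode_less)
  have 3: "(\<forall>y\<in>secs k z. \<not> pref c y) \<longleftrightarrow> (\<forall>i<k. \<exists>j<lenc c. nthc c j \<noteq> of_bool (z (pr i j)))" for c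
    unfolding secs_def pref_def sec_def
    by (simp only: ball_simps(9) not_all not_imp) (simp only: Ball_def lessThan_iff)
  show ?thesis
    unfolding le_def 1 2 3 by (rule refl)
qed

lemma cb_of_bool_eq: "cb x P \<Longrightarrow> cf x f \<Longrightarrow> cb x (\<lambda>e. f e = of_bool (P e))"
  by (rule cb_eq)

lemma cb_le_bt:
  "cf x k \<Longrightarrow> cf x t \<Longrightarrow> cf x h' \<Longrightarrow> cf x h \<Longrightarrow> cb x (\<lambda>e. le (secs (k e) (bt (t e))) (h' e) (h e))"
proof (rule cf_app4[of x "\<lambda>k t h' h. of_bool (le (secs k (bt t)) h' h)"])
  show "cb x (\<lambda>e. le (secs (e 0) (bt (e 1))) (e 2) (e 3))"
    unfolding le_secs_iff by (intro cb_intros cb_of_bool_eq cf_intros)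
qed

section \<open>Evaluation with a finite part of the oracle\<close>

text \<open>The value \<open>0\<close> means that no value is found and \<open>Suc v\<close> that the value is \<open>v\<close>.\<close>

definition oq :: "cantor \<Rightarrow> nat \<Rightarrow> nat \<Rightarrow> nat" where
  "oq x h q = (if odd q then if q div 2 \<le> hn h then Suc (of_bool (q div 2 \<in> hs h)) else 0
     else Suc (of_bool (x (q div 2))))"

text \<open>A total version of \<open>computes\<close>: an undecided oracle question that is asked
  makes the result undefined, and minimization searches only up to the height of
  \<open>h\<close>.\<close>

fun ev :: "cantor \<Rightarrow> nat \<Rightarrow> prog \<Rightarrow> nat list \<Rightarrow> nat" where
  "ev x h PZero ns = 1"
| "ev x h PSucc ns = (case ns of [] \<Rightarrow> 0 | n # _ \<Rightarrow> Suc (Suc n))"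
| "ev x h (PProj i) ns = (if i < length ns then Suc (ns ! i) else 0)"
| "ev x h POracle ns = (case ns of [] \<Rightarrow> 0 | n # _ \<Rightarrow> oq x h n)"
| "ev x h (PComp p qs) ns = (if \<exists>q\<in>set qs. ev x h q ns = 0 then 0
     else ev x h p (map (\<lambda>q. ev x h q ns - 1) qs))"
| "ev x h (PRec p q) ns = (case ns of [] \<Rightarrow> 0 | n # ns' \<Rightarrow>
     rec_nat (ev x h p ns') (\<lambda>i v. if v = 0 then 0 else ev x h q (i # (v - 1) # ns')) n)"
| "ev x h (PMin p) ns =
     (if \<exists>n<Suc (hn h). ev x h p (n # ns) = 1 \<and> (\<forall>m<n. 1 < ev x h p (m # ns))
      then Suc (THE n. ev x h p (n # ns) = 1 \<and> (\<forall>m<n. 1 < ev x h p (m # ns))) else 0)"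

lemma PMin_unique:
  fixes F :: "nat \<Rightarrow> nat"
  assumes "F n = 1 \<and> (\<forall>m<n. 1 < F m)"
  shows "(THE n. F n = 1 \<and> (\<forall>m<n. 1 < F m)) = n"
  using assms by (intro the_equality) (metis linorder_neqE_nat less_irrefl)+

lemma cf_oq: "cf x f \<Longrightarrow> cf x g \<Longrightarrow> cf x (\<lambda>e. oq x (f e) (g e))"
  unfolding oq_def by (intro cf_If cf_intros cb_intros cf_oracle cf_half)

text \<open>The program is fixed, so induction on its structure replaces a universal machine; only
  the arguments and the labelling vary with the environment.\<close>

lemma cf_ev:
  "(\<And>t. t \<in> set ts \<Longrightarrow> cf x t) \<Longrightarrow> cf x H \<Longrightarrow> cf x (\<lambda>e. ev x (H e) p (map (\<lambda>t. t e) ts))"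
proof (induction p arbitrary: ts H)
  case PZero
  then show ?case by (simp add: cf_const)
next
  case PSucc
  then show ?case by (cases ts) (auto intro!: cf_Suc cf_const)
next
  case (PProj i)
  then show ?case by (cases "i < length ts") (auto intro!: cf_Suc cf_const)
next
  case POracle
  then show ?case by (cases ts) (auto intro: cf_const cf_oq)
next
  case (PComp p qs)
  have q: "cf x (\<lambda>e. ev x (H e) q (map (\<lambda>t. t e) ts))" if "q \<in> set qs" for q
    using PComp that by blast
  have ex: "cb x (\<lambda>e. \<exists>q\<in>set qs'. ev x (H e) q (map (\<lambda>t. t e) ts) = 0)" if "set qs' \<subseteq> set qs" for qs'
    using that
  proof (induction qs')
    case (Cons q qs')
    have "cb x (\<lambda>e. ev x (H e) q (map (\<lambda>t. t e) ts) = 0 \<or>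
        (\<exists>q\<in>set qs'. ev x (H e) q (map (\<lambda>t. t e) ts) = 0))"
      using Cons by (intro cb_disj cb_eq cf_const q) auto
    then show ?case by (simp only: list.set bex_simps)
  qed (simp add: cf_const)
  have "cf x (\<lambda>e. ev x (H e) p (map (\<lambda>t. t e)
      (map (\<lambda>q e. ev x (H e) q (map (\<lambda>t. t e) ts) - 1) qs)))"
    using PComp.prems by (intro PComp.IH(1)) (auto intro!: cf_pred[unfolded One_nat_def] q)
  then show ?case
    by (simp only: ev.simps map_map comp_def) (intro cf_If cf_const ex, auto)
next
  case (PRec p q)
  show ?case
  proof (cases ts)
    case (Cons n ts')
    have "cf x (\<lambda>e. rec_nat (ev x (H e) p (map (\<lambda>t. t e) ts'))
      (\<lambda>i v. if v = 0 then 0 else ev x (H e) q (i # (v - 1) # map (\<lambda>t. t e) ts')) (n e))"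
    proof (rule cf_rec)
      show "cf x (\<lambda>e. ev x (H e) p (map (\<lambda>t. t e) ts'))"
        using PRec Cons by auto
      show "cf x n" using PRec Cons by auto
      have "cf x (\<lambda>e. ev x (H (\<lambda>j. e (Suc (Suc j)))) q (map (\<lambda>t. t e)
         ((\<lambda>e. e 0) # (\<lambda>e. e 1 - 1) # map (\<lambda>t e. t (\<lambda>j. e (Suc (Suc j)))) ts')))"
      proof (rule PRec.IH(2))
        show "cf x (\<lambda>e. H (\<lambda>j. e (Suc (Suc j))))"
          using cf_shift[OF cf_shift[OF PRec.prems(2)]] by simp
        fix t assume "t \<in> set ((\<lambda>e. e 0) # (\<lambda>e. e 1 - 1) # map (\<lambda>t e. t (\<lambda>j. e (Suc (Suc j)))) ts')"
        then consider "t = (\<lambda>e. e 0)" | "t = (\<lambda>e. e 1 - 1)" |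
            u where "t = (\<lambda>e. u (\<lambda>j. e (Suc (Suc j))))" "u \<in> set ts'" by auto
        then show "cf x t"
        proof cases
          case 3
          then have "cf x u" using PRec.prems(1) Cons by simp
          then show ?thesis using cf_shift[OF cf_shift] 3 by simp
        qed (auto intro: cf_var cf_pred[unfolded One_nat_def])
      qed
      then show "cf x (\<lambda>e. if e 1 = 0 then 0 else ev x (H (\<lambda>j. e (Suc (Suc j)))) q
          (e 0 # (e 1 - 1) # map (\<lambda>t. t (\<lambda>j. e (Suc (Suc j)))) ts'))"
        by (intro cf_If cb_eq cf_var cf_const) (simp add: comp_def)
    qed
    then show ?thesis using Cons by simp
  qed (simp add: cf_const)
next
  case (PMin p)
  let ?F = "\<lambda>n e. ev x (H e) p (n # map (\<lambda>t. t e) ts)"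
  let ?P = "\<lambda>n e. ?F n e = 1 \<and> (\<forall>m<n. 1 < ?F m e)"
  have "cf x (\<lambda>e. ev x (H (sh e)) p (map (\<lambda>t. t e) ((\<lambda>e. e 0) # map (\<lambda>t e. t (sh e)) ts)))"
    using PMin.prems by (intro PMin.IH) (auto intro: cf_var cf_shift)
  then have F: "cf x (\<lambda>e. ?F (e 0) (sh e))"
    by (simp add: comp_def)
  have F': "cf x (\<lambda>e. ?F (t e) (s e))" if "cf x t" "\<And>i. cf x (\<lambda>e. s e i)" for t s
  proof -
    have "cf x (\<lambda>e. (case i of 0 \<Rightarrow> t e | Suc j \<Rightarrow> s e j))" for i
      using that by (cases i) auto
    from cf_subst[OF F, of "\<lambda>i e. case i of 0 \<Rightarrow> t e | Suc j \<Rightarrow> s e j", OF this] show ?thesis by simp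
  qed
  have P: "cb x (\<lambda>e. ?P (t e) (s e))" if "cf x t" "\<And>i. cf x (\<lambda>e. s e i)" for t s
    using that by (intro cb_conj cb_eq cb_all cb_less F' cf_const cf_var) (auto intro: cf_shift[of x "\<lambda>e. s e _"])
  show ?case
  \<comment> \<open>Minimization becomes a search for its own result: \<open>Suc n\<close> at the
    first zero \<open>n\<close>, and \<open>0\<close> if there is none within the bound.\<close>
  proof (rule cf_search[where b = "\<lambda>e. Suc (hn (H e))" and
      R = "\<lambda>y e. (\<exists>n<Suc (hn (H e)). ?P n e \<and> y = Suc n) \<or> \<not> (\<exists>n<Suc (hn (H e)). ?P n e) \<and> y = 0"])
    show "cb x (\<lambda>e. (\<exists>n<Suc (hn (H (sh e))). ?P n (sh e) \<and> e 0 = Suc n) \<or>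
        \<not> (\<exists>n<Suc (hn (H (sh e))). ?P n (sh e)) \<and> e 0 = 0)"
      by (intro cb_disj cb_conj[of x "\<lambda>e. \<not> (\<exists>n<Suc (hn (H (sh e))). ?P n (sh e))"]
          cb_conj[of x "\<lambda>e. ?P _ (_ e)"] cb_not cb_ex P cf_var cb_eq cf_Suc cf_fs cf_const
          cf_shift[OF PMin.prems(2)])
        (intro cb_conj P cf_var cb_eq cf_Suc)
  next
    fix e
    have *: "ev x (H e) (PMin p) (map (\<lambda>t. t e) ts) =
        (if \<exists>n<Suc (hn (H e)). ?P n e then Suc (THE n. ?P n e) else 0)" by simp
    have the: "(THE n. ?P n e) = n" if "?P n e" for n
      using PMin_unique[of "\<lambda>n. ?F n e", OF that] .
    show "(\<exists>n<Suc (hn (H e)). ?P n e \<and> ev x (H e) (PMin p) (map (\<lambda>t. t e) ts) = Suc n) \<or>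
        \<not> (\<exists>n<Suc (hn (H e)). ?P n e) \<and> ev x (H e) (PMin p) (map (\<lambda>t. t e) ts) = 0"
      unfolding * using the by auto
    show "ev x (H e) (PMin p) (map (\<lambda>t. t e) ts) \<le> Suc (hn (H e))"
      unfolding * using the by auto
    show "y = ev x (H e) (PMin p) (map (\<lambda>t. t e) ts)"
      if "(\<exists>n<Suc (hn (H e)). ?P n e \<and> y = Suc n) \<or> \<not> (\<exists>n<Suc (hn (H e)). ?P n e) \<and> y = 0" for y
      using that unfolding * using the by auto
  qed (intro cf_Suc cf_fs PMin.prems)
qed

text \<open>The code of a pair of string and label is at least the length of the string, so up to
  its height a labelling already decides the real of the whole generic.\<close>

definition apx :: "cantor \<Rightarrow> nat \<Rightarrow> bool" where
  "apx y h \<longleftrightarrow> (\<forall>q\<le>hn h. q \<in> hs h \<longleftrightarrow> y q)"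

lemma oq_sound: "apx y h \<Longrightarrow> oq x h q = Suc v \<Longrightarrow> v = of_bool ((x \<squnion>\<^sub>T y) q)"
  by (auto simp: oq_def apx_def join_def split: if_splits)

lemma ev_sound: "apx y h \<Longrightarrow> ev x h p ns = Suc v \<Longrightarrow> computes (x \<squnion>\<^sub>T y) p ns v"
proof (induction p arbitrary: ns v)
  case POracle
  then show ?case by (auto split: list.splits dest: oq_sound intro: computes.intros(4))
next
  case (PComp p qs)
  from PComp.prems have nz: "\<And>q. q \<in> set qs \<Longrightarrow> ev x h q ns \<noteq> 0"
    and p: "ev x h p (map (\<lambda>q. ev x h q ns - 1) qs) = Suc v"
    by (auto split: if_splits)
  have "computes (x \<squnion>\<^sub>T y) q ns (ev x h q ns - 1)" if "q \<in> set qs" for q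
    using PComp.IH(2)[OF that PComp.prems(1)] nz[OF that] by simp
  then show ?case
    using PComp.IH(1)[OF PComp.prems(1) p]
    by (intro computes.intros(5)[where vs = "map (\<lambda>q. ev x h q ns - 1) qs"])
      (auto simp: list_all2_conv_all_nth)
next
  case (PRec p q)
  from PRec.prems obtain n ns' where ns: "ns = n # ns'" by (auto split: list.splits)
  let ?r = "rec_nat (ev x h p ns') (\<lambda>i v. if v = 0 then 0 else ev x h q (i # (v - 1) # ns'))"
  have "computes (x \<squnion>\<^sub>T y) (PRec p q) (n # ns') v" if "?r n = Suc v" for n v
    using that
  proof (induction n arbitrary: v)
    case 0
    then show ?case using PRec.IH(1) PRec.prems(1) by (auto intro: computes.intros(6))
  next
    case (Suc n)
    then obtain u where u: "?r n = Suc u" by (cases "?r n") auto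
    with Suc.prems have "ev x h q (n # u # ns') = Suc v" by simp
    then have "computes (x \<squnion>\<^sub>T y) q (n # u # ns') v" using PRec.IH(2) PRec.prems(1) by blast
    with Suc.IH[OF u] show ?case by (rule computes.intros(7))
  qed
  then show ?case using PRec.prems ns by simp
next
  case (PMin p)
  let ?P = "\<lambda>n. ev x h p (n # ns) = 1 \<and> (\<forall>m<n. 1 < ev x h p (m # ns))"
  from PMin.prems(2) obtain n where n: "?P n" by (auto split: if_splits)
  have "v = n" using PMin.prems(2) PMin_unique[OF n] by (auto split: if_splits)
  moreover have "computes (x \<squnion>\<^sub>T y) (PMin p) ns n"
  proof (rule computes.intros(8))
    show "computes (x \<squnion>\<^sub>T y) p (n # ns) 0"
      using PMin.IH[OF PMin.prems(1)] n by simp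
    show "\<forall>m<n. \<exists>v>0. computes (x \<squnion>\<^sub>T y) p (m # ns) v"
    proof (intro allI impI)
      fix m assume "m < n"
      then have "1 < ev x h p (m # ns)" using n by blast
      then obtain u where "ev x h p (m # ns) = Suc (Suc u)" by (auto dest!: less_imp_Suc_add)
      then show "\<exists>v>0. computes (x \<squnion>\<^sub>T y) p (m # ns) v"
        using PMin.IH[OF PMin.prems(1)] by blast
    qed
  qed
  ultimately show ?case by simp
qed (auto split: list.splits if_splits intro: computes.intros(1-3))

text \<open>A halting computation has finite use: beyond some height every approximation of
  \<open>y\<close> answers all its questions.\<close>

lemma ev_complete:
  "computes (x \<squnion>\<^sub>T y) p ns v \<Longrightarrow> \<exists>N. \<forall>h. apx y h \<and> N \<le> hn h \<longrightarrow> ev x h p ns = Suc v"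
proof (induction rule: computes.induct)
  case (4 n ns)
  then show ?case by (intro exI[of _ n]) (auto simp: oq_def apx_def join_def)
next
  case (5 ns qs vs p w)
  from 5(1) have "\<exists>N. \<forall>h. apx y h \<and> N \<le> hn h \<longrightarrow> list_all2 (\<lambda>q v. ev x h q ns = Suc v) qs vs"
  proof (induction rule: list_all2_induct)
    case (Cons q qs v vs)
    then obtain N1 N2 where "\<forall>h. apx y h \<and> N1 \<le> hn h \<longrightarrow> ev x h q ns = Suc v"
      "\<forall>h. apx y h \<and> N2 \<le> hn h \<longrightarrow> list_all2 (\<lambda>q v. ev x h q ns = Suc v) qs vs" by blast
    then show ?case by (intro exI[of _ "max N1 N2"]) auto
  qed simp
  then obtain N1 where N1: "\<And>h. apx y h \<Longrightarrow> N1 \<le> hn h \<Longrightarrow> list_all2 (\<lambda>q v. ev x h q ns = Suc v) qs vs"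
    by blast
  from "5.IH" obtain N2 where N2: "\<And>h. apx y h \<Longrightarrow> N2 \<le> hn h \<Longrightarrow> ev x h p vs = Suc w" by blast
  have "ev x h (PComp p qs) ns = Suc w" if h: "apx y h" "max N1 N2 \<le> hn h" for h
  proof -
    have l: "list_all2 (\<lambda>q v. ev x h q ns = Suc v) qs vs" using N1 h by simp
    then have "map (\<lambda>q. ev x h q ns - 1) qs = vs"
      by (intro nth_equalityI) (auto simp: list_all2_conv_all_nth)
    moreover have "\<forall>q\<in>set qs. ev x h q ns \<noteq> 0"
      using l by (auto simp: list_all2_conv_all_nth in_set_conv_nth)
    ultimately show ?thesis using N2 h by simp
  qed
  then show ?case by blast
next
  case (7 p q n ns v w)
  then obtain N1 N2 where "\<forall>h. apx y h \<and> N1 \<le> hn h \<longrightarrow> ev x h (PRec p q) (n # ns) = Suc v"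
    "\<forall>h. apx y h \<and> N2 \<le> hn h \<longrightarrow> ev x h q (n # v # ns) = Suc w" by blast
  then show ?case by (intro exI[of _ "max N1 N2"]) simp
next
  case (8 n p ns)
  have "\<exists>N. \<forall>m<n. \<forall>h. apx y h \<and> N \<le> hn h \<longrightarrow> 1 < ev x h p (m # ns)" 
    using 8(1)
  proof (induction n)
    case (Suc n)
    then have "\<forall>m<n. \<exists>v>0. computes (x \<squnion>\<^sub>T y) p (m # ns) v \<and>
        (\<exists>N. \<forall>h. apx y h \<and> N \<le> hn h \<longrightarrow> ev x h p (m # ns) = Suc v)" by auto
    with Suc.IH obtain N where "\<forall>m<n. \<forall>h. apx y h \<and> N \<le> hn h \<longrightarrow> 1 < ev x h p (m # ns)" by blast
    moreover obtain v where v: "v > 0" "\<exists>N. \<forall>h. apx y h \<and> N \<le> hn h \<longrightarrow> ev x h p (n # ns) = Suc v"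
      using Suc.prems by blast
    moreover from v obtain N' where "\<forall>h. apx y h \<and> N' \<le> hn h \<longrightarrow> ev x h p (n # ns) = Suc v" by blast
    ultimately show ?case using v(1) by (intro exI[of _ "max N N'"]) (auto simp: less_Suc_eq)
  qed simp
  then obtain N1 where N1: "\<And>m h. m < n \<Longrightarrow> apx y h \<Longrightarrow> N1 \<le> hn h \<Longrightarrow> 1 < ev x h p (m # ns)" by blast
  from "8.IH" obtain N2 where N2: "\<And>h. apx y h \<Longrightarrow> N2 \<le> hn h \<Longrightarrow> ev x h p (n # ns) = Suc 0" by blast
  \<comment> \<open>\<open>n\<close> enters the bound because \<open>ev\<close> looks for zeros only
    up to the height.\<close>
  have "ev x h (PMin p) ns = Suc n" if h: "apx y h" "max n (max N1 N2) \<le> hn h" for h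
  proof -
    have P: "ev x h p (n # ns) = 1 \<and> (\<forall>m<n. 1 < ev x h p (m # ns))"
      using N1 N2 h by simp
    then have "\<exists>n<Suc (hn h). ev x h p (n # ns) = 1 \<and> (\<forall>m<n. 1 < ev x h p (m # ns))"
      using h by (intro exI[of _ n]) auto
    then show ?thesis using PMin_unique[of "\<lambda>n. ev x h p (n # ns)", OF P] by simp
  qed
  then show ?case by blast
qed auto

section \<open>The computable game and its Kleene-Brouwer ordered tree\<close>

section \<open>The game of refuting well-foundedness\<close>

text \<open>Elements of the order computed by \<open>p\<close> are shifted by one, and \<open>0\<close> stands for a formal
  greatest element.\<close>

definition frc :: "cantor \<Rightarrow> prog \<Rightarrow> nat \<Rightarrow> nat \<Rightarrow> nat \<Rightarrow> bool" where
  "frc x p h m n \<longleftrightarrow> m \<noteq> 0 \<and> (if n = 0 then ev x h p [m - 1, m - 1] = 2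
     else m \<noteq> n \<and> ev x h p [m - 1, n - 1] = 2)"

lemma cb_frc: "cf x h \<Longrightarrow> cf x m \<Longrightarrow> cf x n \<Longrightarrow> cb x (\<lambda>e. frc x p (h e) (m e) (n e))"
proof -
  assume a: "cf x h" "cf x m" "cf x n"
  have ev: "cf x (\<lambda>e. ev x (h e) p [s e, t e])" if "cf x s" "cf x t" for s t
    using cf_ev[of "[s, t]" x h p] that a by auto
  have "cb x (\<lambda>e. m e \<noteq> 0 \<and> ((n e = 0 \<and> ev x (h e) p [m e - 1, m e - 1] = 2) \<or>
      (n e \<noteq> 0 \<and> m e \<noteq> n e \<and> ev x (h e) p [m e - 1, n e - 1] = 2)))"
    by (intro cb_conj cb_disj cb_not cb_eq cf_const a ev cf_pred)
  then show ?thesis by (rule cb_cong) (auto simp: frc_def)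
qed

definition s1 :: "nat \<Rightarrow> nat \<Rightarrow> nat" where "s1 h n = 2 * pr h n"
definition s2 :: "nat \<Rightarrow> nat \<Rightarrow> nat \<Rightarrow> nat" where "s2 h m k = Suc (2 * pr h (pr m k))"

text \<open>A position \<open>s1 h n\<close> carries the claim that \<open>h\<close> cannot be completed to a condition
  forcing \<open>n\<close> into the well-founded part; \<open>s2 h m k\<close> the claim that some \<open>k\<close> reals added to
  \<open>h\<close> force \<open>m\<close> out of it.  \<open>resp s k y\<close>: the finite set of positions coded by \<open>y\<close> is an
  admissible defence of \<open>s\<close> against challenge \<open>k\<close>.\<close>

definition resp :: "cantor \<Rightarrow> prog \<Rightarrow> nat \<Rightarrow> nat \<Rightarrow> nat \<Rightarrow> bool" where
  "resp x p s k y \<longleftrightarrow>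
    (even s \<longrightarrow> (\<forall>t<2 ^ pr k y. \<exists>s'<y. s' \<in> set_decode y \<and> odd s' \<and> valid (fs (s' div 2)) \<and>
       le (secs k (bt t)) (fs (s' div 2)) (fs (s div 2)) \<and>
       frc x p (fs (s' div 2)) (fs (sn (s' div 2))) (sn (s div 2)))) \<and>
    (odd s \<longrightarrow> (\<exists>t<2 ^ pr (sn (sn (s div 2))) k. \<forall>h<k. valid h \<and>
       le (secs (sn (sn (s div 2))) (bt t)) h (fs (s div 2)) \<longrightarrow>
       2 * pr h (fs (sn (s div 2))) \<in> set_decode y))"

lemma cb_resp: "cf x s \<Longrightarrow> cf x k \<Longrightarrow> cf x y \<Longrightarrow> cb x (\<lambda>e. resp x p (s e) (k e) (y e))"
proof (rule cf_app3[of x "\<lambda>s k y. of_bool (resp x p s k y)"])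
  have "cb x (\<lambda>e. even (e 0))" by (rule cb_cong[OF cb_not[OF cb_odd[OF cf_var]]]) simp
  then show "cb x (\<lambda>e. resp x p (e 0) (e 1) (e 2))"
    unfolding resp_def
    by (intro cb_conj cb_imp cb_all cb_ex cb_mem cb_odd cb_valid cb_le_bt cb_frc
        cf_power2 cf_pr cf_fs cf_sn cf_half cf_mult cf_var cf_const)
qed

text \<open>Patterns have \<open>pr k y\<close> bits because every labelling occurring in
  \<open>y\<close> is at most \<open>y\<close>, and by \<open>le_use\<close> no further bits of the
  \<open>k\<close> reals are read. The number \<open>k'\<close> is free: the defender also names how
  many reals are to push \<open>m\<close> out.\<close>

lemma resp_s1:
  "resp x p (s1 h n) k y \<longleftrightarrow> (\<forall>t<2 ^ pr k y. \<exists>h' m k'. s2 h' m k' \<in> set_decode y \<and> valid h' \<and>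
     le (secs k (bt t)) h' h \<and> frc x p h' m n)"
proof -
  have "(\<exists>s'<y. s' \<in> set_decode y \<and> odd s' \<and> valid (fs (s' div 2)) \<and>
       le X (fs (s' div 2)) h \<and> frc x p (fs (s' div 2)) (fs (sn (s' div 2))) n) \<longleftrightarrow>
     (\<exists>h' m k'. s2 h' m k' \<in> set_decode y \<and> valid h' \<and> le X h' h \<and> frc x p h' m n)" (is "?L \<longleftrightarrow> ?R") for X
  proof
    assume ?L
    then obtain s' where s': "s' \<in> set_decode y" "odd s'" "valid (fs (s' div 2))"
      "le X (fs (s' div 2)) h" "frc x p (fs (s' div 2)) (fs (sn (s' div 2))) n" by blast
    have "s2 (fs (s' div 2)) (fs (sn (s' div 2))) (sn (sn (s' div 2))) = s'"
      using s'(2) by (simp add: s2_def)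
    with s' show ?R by metis
  next
    assume ?R
    then obtain h' m k' where *: "s2 h' m k' \<in> set_decode y" "valid h'" "le X h' h" "frc x p h' m n"
      by blast
    moreover have "s2 h' m k' div 2 = pr h' (pr m k')" "odd (s2 h' m k')" by (simp_all add: s2_def)
    ultimately show ?L
      using mem_set_decode_less[OF *(1)] by (intro exI[of _ "s2 h' m k'"]) simp
  qed
  then show ?thesis by (simp add: resp_def s1_def)
qed

text \<open>The challenge \<open>l\<close> is a level in a compactness argument: survival at every
  \<open>l\<close> means bad patterns at all levels, from which weak Koenig's lemma produces actual
  reals.\<close>

lemma resp_s2:
  "resp x p (s2 h m k) l y \<longleftrightarrow> (\<exists>t<2 ^ pr k l. \<forall>h'<l. valid h' \<and> le (secs k (bt t)) h' h \<longrightarrow>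
     s1 h' m \<in> set_decode y)"
proof -
  have "s2 h m k div 2 = pr h (pr m k)" "odd (s2 h m k)" by (simp_all add: s2_def)
  then show ?thesis by (simp add: resp_def s1_def)
qed

subsection \<open>The Kleene-Brouwer order\<close>

fun kb :: "nat list \<Rightarrow> nat list \<Rightarrow> bool" where
  "kb [] ys = False"
| "kb (x # xs) [] = True"
| "kb (x # xs) (y # ys) = (x < y \<or> x = y \<and> kb xs ys)"

lemma kb_irrefl: "\<not> kb xs xs"
  by (induction xs) auto

lemma kb_trans: "kb xs ys \<Longrightarrow> kb ys zs \<Longrightarrow> kb xs zs"
proof (induction xs ys arbitrary: zs rule: kb.induct)
  case (2 x xs)
  then show ?case by simp
next
  case (3 x xs y ys)
  then show ?case by (cases zs) auto
qed simp

lemma kb_total: "xs \<noteq> ys \<Longrightarrow> kb xs ys \<or> kb ys xs"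
proof (induction xs ys rule: kb.induct)
  case (1 ys)
  then show ?case by (cases ys) auto
qed auto

lemma kb_append: "kb (xs @ [y]) xs"
  by (induction xs) auto

lemma ex_nat_split: "(\<exists>i. P i) \<longleftrightarrow> P 0 \<or> (\<exists>i. P (Suc i))"
  by (metis not0_implies_Suc)

text \<open>The bound on the place of the first difference makes the order decidable;
  \<open>i = length ys\<close> is the case of a proper extension, which counts as smaller.\<close>

lemma kb_iff:
  "kb xs ys \<longleftrightarrow> (\<exists>i<Suc (length ys). i < length xs \<and> (\<forall>j<i. xs ! j = ys ! j) \<and>
     (i = length ys \<or> xs ! i < ys ! i))"
proof (induction xs ys rule: kb.induct)
  case (2 x xs)
  have "0 < Suc (length ([]::nat list)) \<and> 0 < length (x # xs) \<and> (\<forall>j<0. (x # xs) ! j = [] ! j) \<and>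
     (0 = length ([]::nat list) \<or> (x # xs) ! 0 < [] ! 0)" by simp
  then show ?case unfolding kb.simps(2) by blast
next
  case (3 x xs y ys)
  show ?case
    unfolding kb.simps(3) "3.IH"
    by (subst (2) ex_nat_split) (cases "x = y"; simp add: All_less_Suc2)
qed simp

definition ltk :: "nat \<Rightarrow> nat \<Rightarrow> bool" where
  "ltk t' t \<longleftrightarrow> (\<exists>i<Suc (lenc t). i < lenc t' \<and> (\<forall>j<i. nthc t' j = nthc t j) \<and>
     (i = lenc t \<or> nthc t' i < nthc t i))"

lemma ltk_iff: "ltk t' t \<longleftrightarrow> kb (list_decode t') (list_decode t)"
proof -
  have "(i < Suc (lenc t) \<and> i < lenc t' \<and> (\<forall>j<i. nthc t' j = nthc t j) \<and>
      (i = lenc t \<or> nthc t' i < nthc t i)) \<longleftrightarrow>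
    (i < Suc (lenc t) \<and> i < lenc t' \<and> (\<forall>j<i. list_decode t' ! j = list_decode t ! j) \<and>
      (i = lenc t \<or> list_decode t' ! i < list_decode t ! i))" for i
    proof (cases "i < Suc (lenc t) \<and> i < lenc t'")
    case True
    then have "nthc t' j = list_decode t' ! j" "nthc t j = list_decode t ! j" if "j < i" for j
      using that by (auto intro!: nthc_eq)
    moreover have "nthc t' i = list_decode t' ! i" using True by (simp add: nthc_eq)
    moreover have "nthc t i = list_decode t ! i" if "i \<noteq> lenc t"
      using that True by (simp add: nthc_eq)
    ultimately show ?thesis by (cases "i = lenc t") auto
  qed blast
  then show ?thesis
    unfolding ltk_def kb_iff lenc_def[symmetric] by simp
qed

subsection \<open>The tree of partial defences\<close>

text \<open>Stage \<open>j\<close> treats the challenge \<open>(s, k)\<close> with \<open>fs j = pr s k\<close>; the second component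
  of \<open>j\<close> makes every challenge appear infinitely often.\<close>

definition tre :: "cantor \<Rightarrow> prog \<Rightarrow> nat \<Rightarrow> nat \<Rightarrow> bool" where
  "tre x p s0 t \<longleftrightarrow> (\<forall>j<lenc t. fs (fs j) = s0 \<or> (\<exists>i<j. fs (fs j) \<in> set_decode (nthc t i)) \<longrightarrow>
     resp x p (fs (fs j)) (sn (fs j)) (nthc t j))"

text \<open>One relation comprises the orders of all trees: the first component names the starting
  position, and elements with different starting positions are incomparable.\<close>

definition klt :: "cantor \<Rightarrow> prog \<Rightarrow> nat \<Rightarrow> nat \<Rightarrow> bool" where
  "klt x p a b \<longleftrightarrow> fs a = fs b \<and> tre x p (fs a) (sn a) \<and> tre x p (fs b) (sn b) \<and> ltk (sn a) (sn b)"

lemma cb_tre: "cf x s \<Longrightarrow> cf x t \<Longrightarrow> cb x (\<lambda>e. tre x p (s e) (t e))"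
  unfolding tre_def
  by (intro cb_all cb_imp cb_disj cb_eq cb_ex cb_mem cb_resp cf_nthc cf_fs cf_sn cf_lenc cf_var)
    (auto intro: cf_shift)

lemma cb_klt: "cf x a \<Longrightarrow> cf x b \<Longrightarrow> cb x (\<lambda>e. klt x p (a e) (b e))"
proof (rule cf_app2[of x "\<lambda>a b. of_bool (klt x p a b)"])
  show "cb x (\<lambda>e. klt x p (e 0) (e 1))"
    unfolding klt_def ltk_def
    by (intro cb_intros cb_tre cf_intros)
qed

lemma klt_irrefl: "\<not> klt x p a a"
  by (simp add: klt_def ltk_iff kb_irrefl)

lemma klt_trans: "klt x p a b \<Longrightarrow> klt x p b c \<Longrightarrow> klt x p a c"
  unfolding klt_def ltk_iff using kb_trans by auto

lemma klt_total:
  assumes "fs a = fs b" "tre x p (fs a) (sn a)" "tre x p (fs b) (sn b)" "a \<noteq> b"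
  shows "klt x p a b \<or> klt x p b a"
proof -
  have "sn a \<noteq> sn b" using assms(1,4) by (metis pr_fs_sn)
  then have "list_decode (sn a) \<noteq> list_decode (sn b)" by (simp add: list_decode_eq)
  then show ?thesis using kb_total assms unfolding klt_def ltk_iff by auto
qed

section \<open>The easy inequality: computing relative to a join\<close>

section \<open>Reducing an oracle to a join\<close>

fun redirect :: "prog \<Rightarrow> prog \<Rightarrow> prog" where
  "redirect d POracle = PComp POracle [d]"
| "redirect d (PComp p qs) = PComp (redirect d p) (map (redirect d) qs)"
| "redirect d (PRec p q) = PRec (redirect d p) (redirect d q)"
| "redirect d (PMin p) = PMin (redirect d p)"
| "redirect d p = p"

lemma computes_redirect:
  assumes d: "\<And>n ns. computes w d (n # ns) (f n)" and f: "\<And>n. w (f n) = x n"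
  shows "computes x p ns v \<Longrightarrow> computes w (redirect d p) ns v"
proof (induction rule: computes.induct)
  case (4 n ns)
  have "computes w POracle [f n] (of_bool (x n))"
    using computes.intros(4)[of w "f n" "[]"] by (simp add: f)
  then show ?case using d by (auto intro!: computes.intros(5)[of _ _ _ "[f n]"])
next
  case (5 ns qs vs p v)
  then show ?case
    by (auto intro!: computes.intros(5)[of _ _ _ vs] simp: list_all2_conv_all_nth)
next
  case (7 p q n ns v u)
  then show ?case using computes.intros(7) by simp
next
  case (8 n p ns)
  then show ?case using computes.intros(8)[of n w "redirect d p" ns] by auto
qed (simp_all add: computes.intros)

lemma computable_rel_join: "computable_rel x r \<Longrightarrow> computable_rel (x \<squnion>\<^sub>T y) r"
proof -
  assume "computable_rel x r"
  then obtain p where p: "\<And>m n. computes x p [m, n] (of_bool ((m, n) \<in> r))"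
    unfolding computable_rel_def by blast
  let ?w = "x \<squnion>\<^sub>T y"
  have "cf ?w (\<lambda>e. 2 * e 0)" by (intro cf_mult cf_const cf_var)
  then obtain n0 where "\<And>n. n \<ge> n0 \<Longrightarrow> \<exists>q. \<forall>e. computes ?w q (map e [0..<n]) (2 * e 0)"
    unfolding cf_def by blast
  then obtain q where q: "\<And>e. computes ?w q (map e [0..<Suc n0]) (2 * e 0)"
    by (meson le_SucI order_refl)
  let ?d = "PComp q (PProj 0 # replicate n0 PZero)"
  have d: "computes ?w ?d (n # ns) (2 * n)" for n ns
  proof (rule computes.intros(5))
    have "map (case_nat n (\<lambda>_. 0)) [0..<Suc n0] = n # replicate n0 0"
      by (rule nth_equalityI) (auto simp: nth_Cons split: nat.splits simp del: upt_Suc)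
    with q[of "case_nat n (\<lambda>_. 0)"] show "computes ?w q (n # replicate n0 0) (2 * n)" by simp
    have "list_all2 (\<lambda>q v. computes ?w q (n # ns) v) (replicate n0 PZero) (replicate n0 0)"
      by (simp add: list_all2_conv_all_nth computes.intros)
    then show "list_all2 (\<lambda>q v. computes ?w q (n # ns) v) (PProj 0 # replicate n0 PZero)
        (n # replicate n0 0)"
      using computes.intros(3)[of 0 "n # ns" ?w] by simp
  qed
  have "computes ?w (redirect ?d p) [m, n] (of_bool ((m, n) \<in> r))" for m n
    by (rule computes_redirect[OF d _ p]) (simp add: join_def)
  then show ?thesis unfolding computable_rel_def by blast
qed

section \<open>Second-order arithmetic over the reals of the model\<close>

section \<open>Comprehension in the reals of a model\<close>

text \<open>\<open>Df P\<close>: the predicate \<open>P\<close> of one real variable and an environment of number variables is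
  definable with parameters.  \<open>RR\<close> is the set of reals over which the real variable ranges.\<close>

locale world =
  fixes x :: cantor and RR :: "cantor set" and Df :: "(cantor \<Rightarrow> (nat \<Rightarrow> nat) \<Rightarrow> bool) \<Rightarrow> bool"
  assumes Df_conj: "Df P \<Longrightarrow> Df Q \<Longrightarrow> Df (\<lambda>z e. P z e \<and> Q z e)"
    and Df_not: "Df P \<Longrightarrow> Df (\<lambda>z e. \<not> P z e)"
    and Df_all: "Df (\<lambda>z e. S z (e 0) (sh e)) \<Longrightarrow> Df (\<lambda>z e. \<forall>n. S z n e)"
    and Df_real: "Df (\<lambda>z e. z (e i))"
    and Df_comp: "cb x C \<Longrightarrow> Df (\<lambda>z. C)"
    and Df_allr: "Df P \<Longrightarrow> Df (\<lambda>_ e. \<forall>z\<in>RR. P z e)"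
    and Df_inst: "Df P \<Longrightarrow> z0 \<in> RR \<Longrightarrow> Df (\<lambda>_. P z0)"
    and Df_ren: "Df P \<Longrightarrow> Df (\<lambda>z e. P z (\<lambda>i. e (v i)))"
    and Df_compr: "Df (\<lambda>_ e. y (e 0)) \<Longrightarrow> y \<in> RR"
begin

lemma Df_cong: "Df P \<Longrightarrow> (\<And>z e. P z e \<longleftrightarrow> Q z e) \<Longrightarrow> Df Q"
proof -
  assume "Df P" "\<And>z e. P z e \<longleftrightarrow> Q z e"
  moreover from this(2) have "P = Q" by (intro ext) blast
  ultimately show ?thesis by simp
qed

lemma Df_disj: "Df P \<Longrightarrow> Df Q \<Longrightarrow> Df (\<lambda>z e. P z e \<or> Q z e)"
  by (rule Df_cong[OF Df_not[OF Df_conj[OF Df_not Df_not]]]) auto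

lemma Df_imp: "Df P \<Longrightarrow> Df Q \<Longrightarrow> Df (\<lambda>z e. P z e \<longrightarrow> Q z e)"
  by (rule Df_cong[OF Df_disj[OF Df_not]]) auto

lemma Df_iff: "Df P \<Longrightarrow> Df Q \<Longrightarrow> Df (\<lambda>z e. P z e \<longleftrightarrow> Q z e)"
  by (rule Df_cong[OF Df_conj[OF Df_imp Df_imp, of P Q Q P]]) auto

lemma Df_ex: "Df (\<lambda>z e. S z (e 0) (sh e)) \<Longrightarrow> Df (\<lambda>z e. \<exists>n. S z n e)"
  by (rule Df_cong[OF Df_not[OF Df_all[of "\<lambda>z n e. \<not> S z n e", OF Df_not]]]) auto

lemma Df_app1:
  assumes "Df (\<lambda>z e. S z (e 0))" "cf x f"
  shows "Df (\<lambda>z e. S z (f e))"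
proof -
  have "Df (\<lambda>z e. \<forall>n. n = f e \<longrightarrow> S z n)"
    by (intro Df_all Df_imp assms(1) Df_comp cb_eq cf_var cf_shift assms(2))
  then show ?thesis by (rule Df_cong) auto
qed

lemma Df_app2:
  assumes "Df (\<lambda>z e. S z (e 0) (e 1))" "cf x f" "cf x g"
  shows "Df (\<lambda>z e. S z (f e) (g e))"
proof -
  have "Df (\<lambda>z e. \<forall>m n. m = f e \<and> n = g e \<longrightarrow> S z m n)"
    using Df_ren[OF assms(1), of "\<lambda>i. if i = 0 then 1 else 0"]
    by (intro Df_all Df_imp Df_comp cb_conj cb_eq cf_var
        cf_shift[OF cf_shift[OF assms(2)]] cf_shift[OF cf_shift[OF assms(3)]]) simp
  then show ?thesis by (rule Df_cong) auto
qed

lemma Df_app3: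
  assumes "Df (\<lambda>z e. S z (e 0) (e 1) (e 2))" "cf x f" "cf x g" "cf x h"
  shows "Df (\<lambda>z e. S z (f e) (g e) (h e))"
proof -
  have "Df (\<lambda>z e. \<forall>m n k. m = f e \<and> n = g e \<and> k = h e \<longrightarrow> S z m n k)"
    using Df_ren[OF assms(1), of "\<lambda>i. if i = 0 then 2 else if i = 1 then 1 else 0"]
    by (intro Df_all Df_imp Df_comp cb_conj cb_eq cf_var cf_shift[OF cf_shift[OF cf_shift[OF assms(2)]]]
        cf_shift[OF cf_shift[OF cf_shift[OF assms(3)]]] cf_shift[OF cf_shift[OF cf_shift[OF assms(4)]]])
      (simp add: numeral_2_eq_2)
  then show ?thesis by (rule Df_cong) auto
qed

lemma Df_mem: "z0 \<in> RR \<Longrightarrow> cf x f \<Longrightarrow> Df (\<lambda>_ e. z0 (f e))"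
  by (rule Df_app1[OF Df_inst[OF Df_real]])

lemma Df_bex: "Df (\<lambda>z e. S z (e 0) (sh e)) \<Longrightarrow> cf x f \<Longrightarrow> Df (\<lambda>z e. \<exists>n<f e. S z n e)"
  by (intro Df_ex Df_conj Df_comp cb_less cf_var cf_shift)

lemma Df_ball: "Df (\<lambda>z e. S z (e 0) (sh e)) \<Longrightarrow> cf x f \<Longrightarrow> Df (\<lambda>z e. \<forall>n<f e. S z n e)"
  by (intro Df_all Df_imp Df_comp cb_less cf_var cf_shift)

lemma Df_const: "Df (\<lambda>z e. b)"
  by (rule Df_comp[OF cb_const])

lemma Df_memr: "cf x f \<Longrightarrow> Df (\<lambda>z e. z (f e))"
  using Df_app1[of "\<lambda>z. z", OF Df_real] by simp

text \<open>Trades the real for a finite bit pattern that agrees with it, so that \<open>le\<close>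
  becomes a computable condition together with membership of numbers in \<open>z\<close>.\<close>

lemma le_bt_iff:
  "le (secs k z) h' h \<longleftrightarrow> (\<exists>t. (\<forall>i<pr k h'. i \<in> set_decode t \<longleftrightarrow> z i) \<and> le (secs k (bt t)) h' h)"
proof
  assume "le (secs k z) h' h"
  moreover have "le (secs k z) h' h \<longleftrightarrow> le (secs k (bt (set_encode {i. i < pr k h' \<and> z i}))) h' h"
    by (rule le_use) (simp add: set_encode_inverse)
  ultimately show "\<exists>t. (\<forall>i<pr k h'. i \<in> set_decode t \<longleftrightarrow> z i) \<and> le (secs k (bt t)) h' h"
    by (intro exI[of _ "set_encode {i. i < pr k h' \<and> z i}"]) (simp add: set_encode_inverse)
next
  assume "\<exists>t. (\<forall>i<pr k h'. i \<in> set_decode t \<longleftrightarrow> z i) \<and> le (secs k (bt t)) h' h"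
  then obtain t where t: "\<And>i. i < pr k h' \<Longrightarrow> bt t i = z i" "le (secs k (bt t)) h' h" by blast
  from le_use[of k h' "bt t" z, OF t(1)] t(2) show "le (secs k z) h' h" by simp
qed

lemma Df_le:
  "cf x k \<Longrightarrow> cf x h' \<Longrightarrow> cf x h \<Longrightarrow> Df (\<lambda>z e. le (secs (k e) z) (h' e) (h e))"
proof (rule Df_app3[of "\<lambda>z k h' h. le (secs k z) h' h"])
  have "Df (\<lambda>z e. \<exists>t. (\<forall>i<pr (e 0) (e 1). i \<in> set_decode t \<longleftrightarrow> z i) \<and>
      le (secs (e 0) (bt t)) (e 1) (e 2))"
  proof (intro Df_ex Df_conj Df_ball Df_iff Df_memr cf_var cf_pr)
    show "Df (\<lambda>z e. e 0 \<in> set_decode (e (Suc 0)))"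
      by (intro Df_comp cb_mem cf_var)
    show "Df (\<lambda>z e. le (secs (e (Suc 0)) (bt (e 0))) (e (Suc 1)) (e (Suc 2)))"
      by (intro Df_comp cb_le_bt cf_var)
  qed
  then show "Df (\<lambda>z e. le (secs (e 0) z) (e 1) (e 2))"
    by (rule Df_cong) (rule le_bt_iff[symmetric])
qed

subsection \<open>Weak Koenig's lemma\<close>

text \<open>The reals form the leftmost branch of the tree of bit patterns. This branch is
  arithmetical in \<open>Q\<close>, so comprehension puts it into \<open>RR\<close>; agreement on
  the first \<open>pr k h'\<close> bits carries each exclusion over to \<open>z\<close>.\<close>

lemma WKL:
  assumes Q: "Df (\<lambda>_ e. Q (e 0))"
    and fin: "\<And>l. \<exists>t. \<forall>h'<l. Q h' \<longrightarrow> \<not> le (secs k (bt t)) h' h"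
  obtains z where "z \<in> RR" "\<And>h'. Q h' \<Longrightarrow> \<not> le (secs k z) h' h"
proof -
  define ok where "ok l t \<longleftrightarrow> (\<forall>h'<l. Q h' \<longrightarrow> \<not> le (secs k (bt t)) h' h)" for l t
  define ag where "ag i t t' \<longleftrightarrow> (\<forall>j<i. j \<in> set_decode t' \<longleftrightarrow> j \<in> set_decode t)" for i t t' :: nat
  \<comment> \<open>Having acceptable extensions at every level is the arithmetical substitute for
    lying on an infinite branch.\<close>
  define good where "good i t \<longleftrightarrow> (\<forall>l. \<exists>t'. ag i t t' \<and> ok l t')" for i t
  define good0 where "good0 i t \<longleftrightarrow> (\<forall>l. \<exists>t'. ag i t t' \<and> i \<notin> set_decode t' \<and> ok l t')" for i t
  \<comment> \<open>A bit is \<open>1\<close> only where \<open>0\<close> is a dead end: the first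
    \<open>i\<close> bits of \<open>t\<close> follow the leftmost branch.\<close>
  define lm where "lm i t \<longleftrightarrow> (\<forall>j<i. j \<in> set_decode t \<longleftrightarrow> \<not> good0 j t)" for i t
  define z where "z i \<longleftrightarrow> (\<exists>t. lm (Suc i) t \<and> i \<in> set_decode t)" for i
  have ag_Suc: "ag (Suc i) t t' \<longleftrightarrow> ag i t t' \<and> (i \<in> set_decode t' \<longleftrightarrow> i \<in> set_decode t)" for i t t'
    unfolding ag_def All_less_Suc by blast
  have okD: "Df (\<lambda>_ e. ok (e 0) (e 1))"
    unfolding ok_def
    by (intro Df_ball Df_imp Df_not Df_comp cb_le_bt cf_var cf_const Df_app1[OF Q])
  have ag: "cb x (\<lambda>e. ag (e 0) (e 1) (e 2))"
  proof -
    have "cb x (\<lambda>e. \<forall>j<e 0. (j \<in> set_decode (e 2) \<longrightarrow> j \<in> set_decode (e 1)) \<and>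
        (j \<in> set_decode (e 1) \<longrightarrow> j \<in> set_decode (e 2)))"
      by (intro cb_all cb_conj cb_imp cb_mem cf_var)
    then show ?thesis by (rule cb_cong) (auto simp: ag_def)
  qed
  have good0D: "Df (\<lambda>_ e. good0 (e 0) (e 1))"
    unfolding good0_def
  proof (intro Df_all Df_ex Df_conj Df_not)
    show "Df (\<lambda>z e. ag (e (Suc (Suc 0))) (e (Suc (Suc 1))) (e 0))"
      using cf_app3[of x "\<lambda>a b c. of_bool (ag a b c)", OF ag cf_var cf_var cf_var]
      by (rule Df_comp)
    show "Df (\<lambda>z e. e (Suc (Suc 0)) \<in> set_decode (e 0))" by (intro Df_comp cb_mem cf_var)
    show "Df (\<lambda>z e. ok (e (Suc 0)) (e 0))" by (rule Df_app2[OF okD cf_var cf_var])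
  qed
  have lmD: "Df (\<lambda>_ e. lm (e 0) (e 1))"
    unfolding lm_def
    by (intro Df_ball Df_iff Df_not Df_comp cb_mem cf_var Df_app2[OF good0D])
  have zR: "z \<in> RR"
  proof (rule Df_compr)
    show "Df (\<lambda>_ e. z (e 0))"
      unfolding z_def
      by (intro Df_ex Df_conj Df_comp cb_mem cf_var Df_app2[OF lmD] cf_Suc)
  qed
  have ag_good0: "good0 i t \<longleftrightarrow> good0 i t'" if "ag i t t'" for i t t'
  proof -
    have "ag i t u \<longleftrightarrow> ag i t' u" for u using that unfolding ag_def by simp
    then show ?thesis unfolding good0_def by (simp only:)
  qed
  have lm_ag: "ag i t t'" if "lm i t" "lm i t'" for i t t'
    using that
  proof (induction i)
    case (Suc i)
    then have "lm i t" "lm i t'" by (auto simp: lm_def)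
    then have a: "ag i t t'" by (rule Suc.IH)
    then have "good0 i t \<longleftrightarrow> good0 i t'" by (rule ag_good0)
    then have "i \<in> set_decode t' \<longleftrightarrow> i \<in> set_decode t"
      using Suc.prems by (simp add: lm_def)
    with a show ?case by (simp add: ag_Suc)
  qed (simp add: ag_def)
  have lm_good: "good i t" if "lm i t" for i t
    using that
  proof (induction i)
    case 0
    show ?case unfolding good_def ag_def ok_def using fin by simp
  next
    case (Suc i)
    then have g: "good i t" by (auto simp: lm_def)
    show ?case
    proof (cases "i \<in> set_decode t")
      case False
      then have "good0 i t" using Suc.prems by (auto simp: lm_def)
      then show ?thesis using False unfolding good0_def good_def ag_Suc by blast
    next
      case True
      then have "\<not> good0 i t" using Suc.prems by (auto simp: lm_def)
      then obtain l0 where l0: "\<And>t'. ag i t t' \<Longrightarrow> ok l0 t' \<Longrightarrow> i \<in> set_decode t'"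
        unfolding good0_def by blast
      show ?thesis
        unfolding good_def
      proof
        fix l
        \<comment> \<open>Acceptability decreases with the level, so one pattern taken at the larger
          of \<open>l\<close> and the dead-end level \<open>l0\<close> serves both, and
          \<open>l0\<close> forces its bit \<open>i\<close> to be \<open>1\<close>.\<close>
        obtain t' where t': "ag i t t'" "ok (max l l0) t'" using g unfolding good_def by blast
        then have "ok l t'" "ok l0 t'" by (auto simp: ok_def)
        moreover have "ag (Suc i) t t'"
          using l0[OF t'(1) \<open>ok l0 t'\<close>] t'(1) True by (simp add: ag_Suc)
        ultimately show "\<exists>t'. ag (Suc i) t t' \<and> ok l t'" by blast
      qed
    qed
  qed
  have lm_ex: "\<exists>t. lm i t" for i
  proof (induction i)
    case (Suc i)
    then obtain t where t: "lm i t" by blast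
    define t' where "t' = set_encode ({j \<in> set_decode t. j < i} \<union> (if good0 i t then {} else {i}))"
    have "finite ({j \<in> set_decode t. j < i} \<union> (if good0 i t then {} else {i}))" by simp
    then have st: "set_decode t' = {j \<in> set_decode t. j < i} \<union> (if good0 i t then {} else {i})"
      unfolding t'_def by (rule set_encode_inverse)
    have a: "ag j t t'" if "j \<le> i" for j using that unfolding ag_def st by auto
    have "lm (Suc i) t'"
      unfolding lm_def
    proof (intro allI impI)
      fix j assume "j < Suc i"
      then consider "j < i" | "j = i" by linarith
      then show "j \<in> set_decode t' \<longleftrightarrow> \<not> good0 j t'"
      proof cases
        case 1
        then have "j \<in> set_decode t \<longleftrightarrow> \<not> good0 j t" using t unfolding lm_def by blast
        moreover have "good0 j t \<longleftrightarrow> good0 j t'" using 1 by (intro ag_good0 a) simp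
        moreover have "j \<in> set_decode t' \<longleftrightarrow> j \<in> set_decode t" using 1 unfolding st by simp
        ultimately show ?thesis by simp
      next
        case 2
        moreover have "good0 i t \<longleftrightarrow> good0 i t'" by (intro ag_good0 a) simp
        ultimately show ?thesis unfolding st by simp
      qed
    qed
    then show ?case by blast
  qed (simp add: lm_def)
  have z_lm: "z j \<longleftrightarrow> j \<in> set_decode t" if "lm i t" "j < i" for i j t
  proof -
    have "lm (Suc j) t" using that by (auto simp: lm_def)
    moreover from this have "j \<in> set_decode u \<longleftrightarrow> j \<in> set_decode t" if "lm (Suc j) u" for u
      using lm_ag[OF that, of t] unfolding ag_Suc by simp
    ultimately show ?thesis unfolding z_def by blast
  qed
  show ?thesis
  proof (rule that[OF zR])
    fix h' assume h': "Q h'"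
    obtain t where t: "lm (pr k h') t" using lm_ex by blast
    \<comment> \<open>Level \<open>Suc h'\<close> is the first that tests \<open>h'\<close>.\<close>
    obtain t' where t': "ag (pr k h') t t'" "ok (Suc h') t'"
      using lm_good[OF t] unfolding good_def by blast
    have "\<not> le (secs k (bt t')) h' h" using t'(2) h' by (auto simp: ok_def)
    moreover have "le (secs k (bt t')) h' h \<longleftrightarrow> le (secs k z) h' h"
      by (rule le_use) (use t'(1) z_lm[OF t] in \<open>auto simp: ag_def\<close>)
    ultimately show "\<not> le (secs k z) h' h" by simp
  qed
qed


subsection \<open>Sections of a real\<close>

definition fin :: "cantor set \<Rightarrow> bool" where "fin X \<longleftrightarrow> finite X \<and> X \<subseteq> RR"

lemma fin_Un: "fin X \<Longrightarrow> fin Y \<Longrightarrow> fin (X \<union> Y)"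
  by (auto simp: fin_def)

lemma fin_secs: "z \<in> RR \<Longrightarrow> fin (secs k z)"
proof -
  assume z: "z \<in> RR"
  have "sec z i \<in> RR" for i
    unfolding sec_def by (intro Df_compr Df_mem[OF z] cf_pr cf_const cf_var)
  then show ?thesis by (auto simp: fin_def secs_def)
qed

lemma ex_secs: "fin X \<Longrightarrow> \<exists>k. \<exists>z\<in>RR. X = secs k z"
proof -
  assume "fin X"
  then have "finite X" "X \<subseteq> RR" by (auto simp: fin_def)
  then show ?thesis
  proof (induction X rule: finite_induct)
    case empty
    have "(\<lambda>_. False) \<in> RR" by (rule Df_compr) (rule Df_const)
    then show ?case by (intro exI[of _ 0] bexI[of _ "\<lambda>_. False"]) (auto simp: secs_def)
  next
    case (insert y X)
    then obtain k z where z: "z \<in> RR" "X = secs k z" by auto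
    let ?z = "\<lambda>n. if fs n = k then y (sn n) else z n"
    have D: "Df (\<lambda>_ e. (fs (e 0) = k \<and> y (sn (e 0))) \<or> (fs (e 0) \<noteq> k \<and> z (e 0)))"
      using insert.prems
      by (intro Df_disj Df_conj Df_mem z cf_sn cf_var Df_comp cb_not cb_eq cf_fs cf_const) auto
    have "?z \<in> RR" by (rule Df_compr, rule Df_cong[OF D]) auto
    moreover have "insert y X = secs (Suc k) ?z"
    proof -
      have "sec ?z k = y" "i < k \<Longrightarrow> sec ?z i = sec z i" for i by (simp_all add: sec_def)
      then have "sec ?z ` {..<k} = sec z ` {..<k}" "sec ?z k = y" by (simp_all cong: image_cong_simp)
      then show ?thesis unfolding z(2) secs_def lessThan_Suc by simp
    qed
    ultimately show ?case by blast
  qed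
qed

text \<open>This is forcing of a negation, expressed through labellings alone: no condition below
  \<open>(h, X)\<close> has a labelling with \<open>Q\<close>.\<close>

definition noext :: "cantor set \<Rightarrow> nat \<Rightarrow> (nat \<Rightarrow> bool) \<Rightarrow> bool" where
  "noext X h Q \<longleftrightarrow> (\<forall>h'. valid h' \<and> le X h' h \<longrightarrow> \<not> Q h')"

lemma noext_mono: "noext X h Q \<Longrightarrow> le X h' h \<Longrightarrow> X \<subseteq> X' \<Longrightarrow> noext X' h' Q"
  unfolding noext_def by (blast intro: le_trans[of X h' h X'])

section \<open>Hierarchies of winning positions\<close>

text \<open>\<open>step p R A b s\<close>: some challenge to position \<open>s\<close> forces the defender into a position won
  by the challenger at an \<open>R\<close>-smaller index.  \<open>zed p R A b n h\<close>: the labelling \<open>h\<close> puts some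
  \<open>m\<close> below \<open>n\<close> that is not yet known to be well-founded before index \<open>b\<close>.\<close>

definition lth :: "(nat \<Rightarrow> nat \<Rightarrow> bool) \<Rightarrow> (nat \<Rightarrow> nat \<Rightarrow> bool) \<Rightarrow> nat \<Rightarrow> nat \<Rightarrow> bool" where
  "lth R A b s \<longleftrightarrow> (\<exists>b'. R b' b \<and> A b' s)"

definition step :: "prog \<Rightarrow> (nat \<Rightarrow> nat \<Rightarrow> bool) \<Rightarrow> (nat \<Rightarrow> nat \<Rightarrow> bool) \<Rightarrow> nat \<Rightarrow> nat \<Rightarrow> bool" where
  "step p R A b s \<longleftrightarrow> (\<exists>k. \<forall>y. resp x p s k y \<longrightarrow> (\<exists>s'. s' \<in> set_decode y \<and> lth R A b s'))"

definition hier :: "prog \<Rightarrow> (nat \<Rightarrow> nat \<Rightarrow> bool) \<Rightarrow> (nat \<Rightarrow> nat \<Rightarrow> bool) \<Rightarrow> bool" where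
  "hier p R A \<longleftrightarrow> (\<forall>b s. A b s \<longleftrightarrow> step p R A b s)"

abbreviation Df2 :: "(nat \<Rightarrow> nat \<Rightarrow> bool) \<Rightarrow> bool" where
  "Df2 R \<equiv> Df (\<lambda>_ e. R (e 0) (e 1))"

lemma Df_lth:
  assumes "Df2 R" "Df2 A" "cf x f" "cf x g"
  shows "Df (\<lambda>_ e. lth R A (f e) (g e))"
  unfolding lth_def
  by (intro Df_ex Df_conj Df_app2[of "\<lambda>_. R", OF assms(1)] Df_app2[of "\<lambda>_. A", OF assms(2)]
      cf_var cf_shift assms(3,4))

lemma step_mono: "step p R A b s \<Longrightarrow> (\<And>b s. A b s \<Longrightarrow> A' b s) \<Longrightarrow> step p R A' b s"
  unfolding step_def lth_def by meson

lemma Df_step: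
  assumes "Df2 R" "Df2 A" "cf x f" "cf x g"
  shows "Df (\<lambda>_ e. step p R A (f e) (g e))"
  unfolding step_def
  by (intro Df_ex Df_all Df_imp Df_conj Df_lth[OF assms(1,2)] Df_comp[OF cb_resp] Df_comp[OF cb_mem]
      cf_var cf_shift assms(3,4))

text \<open>Knaster-Tarski inside the model: comprehension with a quantifier over \<open>RR\<close>
  forms the intersection of all closed reals. It works for every definable \<open>R\<close>, which
  matters because the orders used later need not be truly well-founded.\<close>

lemma ex_hier:
  assumes R: "Df2 R"
  obtains A where "Df2 A" "hier p R A"
    "\<And>S b s. Df2 S \<Longrightarrow> (\<And>b s. step p R S b s \<Longrightarrow> S b s) \<Longrightarrow> A b s \<Longrightarrow> S b s"
proof -
  define clo where "clo z \<longleftrightarrow> (\<forall>b s. step p R (\<lambda>b s. z (pr b s)) b s \<longrightarrow> z (pr b s))" for z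
  define A where "A b s \<longleftrightarrow> (\<forall>z\<in>RR. clo z \<longrightarrow> z (pr b s))" for b s
  have "Df (\<lambda>z e. clo z)"
    unfolding clo_def step_def lth_def
    by (intro Df_all Df_imp Df_ex Df_conj Df_comp cb_resp cb_mem Df_app2[of "\<lambda>_. R", OF R]
        Df_memr cf_pr cf_var)
  then have A: "Df2 A"
    unfolding A_def by (intro Df_allr Df_imp Df_memr cf_pr cf_var)
  have least: "S b s" if S: "Df2 S" "\<And>b s. step p R S b s \<Longrightarrow> S b s" "A b s" for S b s
  proof -
    let ?z = "\<lambda>n. S (fs n) (sn n)"
    have "?z \<in> RR" by (intro Df_compr Df_app2[of "\<lambda>_. S", OF S(1)] cf_fs cf_sn cf_var)
    moreover have "clo ?z" using S(2) by (simp add: clo_def)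
    ultimately have "?z (pr b s)" using S(3) unfolding A_def by blast
    then show ?thesis by simp
  qed
  have 1: "A b s" if st: "step p R A b s" for b s
    unfolding A_def
  proof (intro ballI impI)
    fix z assume z: "z \<in> RR" "clo z"
    then have Az: "A b s \<Longrightarrow> z (pr b s)" for b s unfolding A_def by blast
    have "step p R (\<lambda>b s. z (pr b s)) b s" by (rule step_mono[OF st Az])
    then show "z (pr b s)" using z(2) unfolding clo_def by blast
  qed
  \<comment> \<open>By monotonicity, \<open>step\<close> applied to the least closed set is again
    closed, hence includes it.\<close>
  have 2: "step p R A b s" if "A b s" for b s
  proof (rule least[of "step p R A", OF _ _ that])
    show "Df2 (step p R A)" by (rule Df_step[OF R A cf_var cf_var])
    show "step p R A b s" if "step p R (step p R A) b s" for b s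
      by (rule step_mono[OF that 1])
  qed
  have "hier p R A" unfolding hier_def using 1 2 by blast
  then show ?thesis using that[of A] A least by blast
qed

definition zed :: "prog \<Rightarrow> (nat \<Rightarrow> nat \<Rightarrow> bool) \<Rightarrow> (nat \<Rightarrow> nat \<Rightarrow> bool) \<Rightarrow> nat \<Rightarrow> nat \<Rightarrow> nat \<Rightarrow> bool" where
  "zed p R A b n h \<longleftrightarrow> (\<exists>m k. frc x p h m n \<and> \<not> lth R A b (s2 h m k))"

lemma cf_s1: "cf x f \<Longrightarrow> cf x g \<Longrightarrow> cf x (\<lambda>e. s1 (f e) (g e))"
  unfolding s1_def by (intro cf_mult cf_const cf_pr)

lemma cf_s2: "cf x f \<Longrightarrow> cf x g \<Longrightarrow> cf x h \<Longrightarrow> cf x (\<lambda>e. s2 (f e) (g e) (h e))"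
  unfolding s2_def by (intro cf_mult cf_const cf_pr cf_Suc)

lemma Df_zed:
  assumes "Df2 R" "Df2 A" "cf x b" "cf x n" "cf x h"
  shows "Df (\<lambda>_ e. zed p R A (b e) (n e) (h e))"
  unfolding zed_def
  by (intro Df_ex Df_conj Df_not Df_comp[OF cb_frc] Df_lth[OF assms(1,2)] cf_s2 cf_var cf_shift assms(3-))

lemma le_s2: "h \<le> s2 h m k"
  using le_prod_encode_1[of h "pr m k"] by (simp add: s2_def)

text \<open>Translation between the game and forcing. A winning challenge \<open>k\<close> stands
  for \<open>k\<close> reals: if at some level every pattern were answered, the answering labellings
  would form a finite defence free of won positions. So unanswered patterns exist at all levels, and
  \<open>WKL\<close> turns them into reals.\<close>

lemma hier_s1:
  assumes A: "hier p R A" "Df2 A" "Df2 R"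
  shows "A b (s1 h n) \<longleftrightarrow> (\<exists>X. fin X \<and> noext X h (zed p R A b n))"
proof
  assume "A b (s1 h n)"
  then obtain k where k: "\<And>y. resp x p (s1 h n) k y \<Longrightarrow> \<exists>s'. s' \<in> set_decode y \<and> lth R A b s'"
    using A(1) unfolding hier_def step_def by blast
  define Q where "Q h' \<longleftrightarrow> valid h' \<and> zed p R A b n h'" for h'
  have QD: "Df (\<lambda>_ e. Q (e 0))"
    unfolding Q_def by (intro Df_conj Df_comp[OF cb_valid] Df_zed A cf_var cf_const)
  have ex: "\<exists>t. \<forall>h'<l. Q h' \<longrightarrow> \<not> le (secs k (bt t)) h' h" for l
  proof (rule ccontr)
    assume "\<not> ?thesis"
    then have neg: "\<And>t. \<exists>h'<l. Q h' \<and> le (secs k (bt t)) h' h" by blast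
    have "\<forall>h'. \<exists>m k'. Q h' \<longrightarrow> frc x p h' m n \<and> \<not> lth R A b (s2 h' m k')"
      unfolding Q_def zed_def by blast
    then obtain m k' where mk: "\<And>h'. Q h' \<Longrightarrow> frc x p h' (m h') n \<and> \<not> lth R A b (s2 h' (m h') (k' h'))"
      by metis
    \<comment> \<open>The level \<open>l\<close> keeps this defence finite, with one position for
      each answering labelling.\<close>
    define Y where "Y = (\<lambda>h'. s2 h' (m h') (k' h')) ` {h'. h' < l \<and> Q h'}"
    have "finite Y" unfolding Y_def by simp
    then have Y: "set_decode (set_encode Y) = Y" by (rule set_encode_inverse)
    have "resp x p (s1 h n) k (set_encode Y)"
      unfolding resp_s1 Y
    proof (intro allI impI)
      fix t
      obtain h' where "h' < l" "Q h'" "le (secs k (bt t)) h' h" using neg by blast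
      then show "\<exists>h' m k'. s2 h' m k' \<in> Y \<and> valid h' \<and> le (secs k (bt t)) h' h \<and> frc x p h' m n"
        using mk unfolding Y_def Q_def by blast
    qed
    from k[OF this] show False using mk unfolding Y by (auto simp: Y_def)
  qed
  obtain z where z: "z \<in> RR" "\<And>h'. Q h' \<Longrightarrow> \<not> le (secs k z) h' h"
    by (rule WKL[OF QD ex]) blast
  then have "noext (secs k z) h (zed p R A b n)" unfolding noext_def Q_def by blast
  then show "\<exists>X. fin X \<and> noext X h (zed p R A b n)" using fin_secs[OF z(1)] by blast
next
  assume "\<exists>X. fin X \<and> noext X h (zed p R A b n)"
  then obtain k z where z: "z \<in> RR" "noext (secs k z) h (zed p R A b n)" using ex_secs by blast
  have "\<exists>s'. s' \<in> set_decode y \<and> lth R A b s'" if y: "resp x p (s1 h n) k y" for y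
  proof -
    \<comment> \<open>The defender has to answer in particular the pattern formed by the first
      \<open>pr k y\<close> bits of the given reals; the answer is at most \<open>y\<close>, so
      \<open>le_use\<close> makes it an extension relative to the reals themselves.\<close>
    define Z where "Z = {i. i < pr k y \<and> z i}"
    have "Z \<subseteq> {..<pr k y}" "finite Z" unfolding Z_def by auto
    then have "set_encode Z < 2 ^ pr k y" and dZ: "set_decode (set_encode Z) = Z"
      by (auto intro: set_encode_less_power2 set_encode_inverse)
    then obtain h' m k' where *: "s2 h' m k' \<in> set_decode y" "valid h'"
      "le (secs k (bt (set_encode Z))) h' h" "frc x p h' m n"
      using y unfolding resp_s1 by blast
    have "h' \<le> y" using mem_set_decode_less[OF *(1)] le_s2[of h' m k'] by linarith
    then have "pr k h' \<le> pr k y" by (intro pr_mono) auto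
    then have "le (secs k (bt (set_encode Z))) h' h \<longleftrightarrow> le (secs k z) h' h"
      by (intro le_use) (auto simp: dZ Z_def)
    then have "\<not> zed p R A b n h'" using z(2) * unfolding noext_def by blast
    then have "lth R A b (s2 h' m k')" using *(4) unfolding zed_def by blast
    then show ?thesis using *(1) by blast
  qed
  then have "step p R A b (s1 h n)" unfolding step_def by blast
  then show "A b (s1 h n)" using A(1) unfolding hier_def by blast
qed

text \<open>An unwon position has a defence at every level \<open>l\<close>, that is, a bit pattern
  all of whose extensions below \<open>l\<close> lead to positions unwon before \<open>b\<close>;
  \<open>WKL\<close> turns these patterns into reals.\<close>

lemma hier_s2D:
  assumes A: "hier p R A" "Df2 A" "Df2 R" and n: "\<not> A b (s2 h m k)"
  shows "\<exists>X. fin X \<and> noext X h (\<lambda>h'. lth R A b (s1 h' m))"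
proof -
  define Q where "Q h' \<longleftrightarrow> valid h' \<and> lth R A b (s1 h' m)" for h'
  have QD: "Df (\<lambda>_ e. Q (e 0))"
    unfolding Q_def by (intro Df_conj Df_comp[OF cb_valid] Df_lth A cf_s1 cf_var cf_const)
  have ex: "\<exists>t. \<forall>h'<l. Q h' \<longrightarrow> \<not> le (secs k (bt t)) h' h" for l
  proof -
    obtain y where y: "resp x p (s2 h m k) l y" "\<And>s'. s' \<in> set_decode y \<Longrightarrow> \<not> lth R A b s'"
      using A(1) n unfolding hier_def step_def by blast
    from y(1) obtain t where "\<forall>h'<l. valid h' \<and> le (secs k (bt t)) h' h \<longrightarrow> s1 h' m \<in> set_decode y"
      unfolding resp_s2 by blast
    then show ?thesis using y(2) unfolding Q_def by blast
  qed
  obtain z where z: "z \<in> RR" "\<And>h'. Q h' \<Longrightarrow> \<not> le (secs k z) h' h"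
    by (rule WKL[OF QD ex]) blast
  then have "noext (secs k z) h (\<lambda>h'. lth R A b (s1 h' m))" unfolding noext_def Q_def by blast
  then show ?thesis using fin_secs[OF z(1)] by blast
qed

text \<open>The number \<open>k\<close> is chosen from \<open>X\<close> alone, uniformly in
  \<open>b\<close>: in the application it has to be fixed before an index is found.\<close>

lemma hier_s2I:
  assumes A: "hier p R A" and X: "fin X"
  shows "\<exists>k. \<forall>b. noext X h (\<lambda>h'. lth R A b (s1 h' m)) \<longrightarrow> \<not> A b (s2 h m k)"
proof -
  obtain k z where z: "z \<in> RR" "X = secs k z" using X ex_secs by blast
  have "\<not> A b (s2 h m k)" if no: "noext X h (\<lambda>h'. lth R A b (s1 h' m))" for b
  proof
    assume "A b (s2 h m k)"
    then obtain l where l: "\<And>y. resp x p (s2 h m k) l y \<Longrightarrow> \<exists>s'. s' \<in> set_decode y \<and> lth R A b s'"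
      using A unfolding hier_def step_def by blast
    define Z where "Z = {i. i < pr k l \<and> z i}"
    have "Z \<subseteq> {..<pr k l}" "finite Z" unfolding Z_def by auto
    then have Z: "set_encode Z < 2 ^ pr k l" and dZ: "set_decode (set_encode Z) = Z"
      by (auto intro: set_encode_less_power2 set_encode_inverse)
    define Y where "Y = (\<lambda>h'. s1 h' m) ` {h'. h' < l \<and> valid h' \<and> le (secs k (bt (set_encode Z))) h' h}"
    have "finite Y" unfolding Y_def by simp
    then have Y: "set_decode (set_encode Y) = Y" by (rule set_encode_inverse)
    have "resp x p (s2 h m k) l (set_encode Y)"
      unfolding resp_s2 Y using Z by (auto simp: Y_def)
    from l[OF this] obtain h' where h': "h' < l" "valid h'" "le (secs k (bt (set_encode Z))) h' h"
      "lth R A b (s1 h' m)" unfolding Y by (auto simp: Y_def)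
    have "pr k h' \<le> pr k l" using h'(1) by (intro pr_mono) auto
    then have "le (secs k (bt (set_encode Z))) h' h \<longleftrightarrow> le (secs k z) h' h"
      by (intro le_use) (auto simp: dZ Z_def)
    then show False using h' no unfolding noext_def z(2) by blast
  qed
  then show ?thesis by blast
qed

end

section \<open>Well-foundedness of the Kleene-Brouwer order in the model\<close>

definition pfx :: "nat \<Rightarrow> nat \<Rightarrow> bool" where
  "pfx u a \<longleftrightarrow> lenc u \<le> lenc a \<and> (\<forall>j<lenc u. nthc u j = nthc a j)"

lemma pfx_iff: "pfx u a \<longleftrightarrow> (\<exists>c. list_decode a = list_decode u @ c)"
proof
  assume a: "pfx u a"
  have "take (length (list_decode u)) (list_decode a) = list_decode u"
  proof (rule nth_equalityI)
    show l: "length (take (length (list_decode u)) (list_decode a)) = length (list_decode u)"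
      using a by (simp add: pfx_def lenc_def)
    fix i assume "i < length (take (length (list_decode u)) (list_decode a))"
    then have i: "i < lenc u" "i < lenc a" using l a by (simp_all add: lenc_def pfx_def)
    then have "nthc u i = nthc a i" using a by (simp add: pfx_def)
    then show "take (length (list_decode u)) (list_decode a) ! i = list_decode u ! i"
      using i by (simp add: nthc_eq lenc_def)
  qed
  then show "\<exists>c. list_decode a = list_decode u @ c" by (metis append_take_drop_id)
next
  assume "\<exists>c. list_decode a = list_decode u @ c"
  then obtain c where c: "list_decode a = list_decode u @ c" by blast
  then have l: "lenc u \<le> lenc a" by (simp add: lenc_def)
  moreover have "nthc u j = nthc a j" if "j < lenc u" for j
  proof -
    have "nthc a j = list_decode a ! j" using that l by (intro nthc_eq) simp
    then show ?thesis using nthc_eq[OF that] that by (simp add: c nth_append lenc_def)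
  qed
  ultimately show "pfx u a" by (simp add: pfx_def)
qed

lemma kb_append_iff: "kb (u @ c) (u @ d) \<longleftrightarrow> kb c d"
  by (induction u) auto

definition snoc :: "nat \<Rightarrow> nat \<Rightarrow> nat" where "snoc u y = list_encode (list_decode u @ [y])"

lemma list_decode_snoc[simp]: "list_decode (snoc u y) = list_decode u @ [y]"
  by (simp add: snoc_def)

lemma lenc_snoc[simp]: "lenc (snoc u y) = Suc (lenc u)"
  by (simp add: lenc_def)

lemma nthc_snoc: "j < lenc u \<Longrightarrow> nthc (snoc u y) j = nthc u j" "nthc (snoc u y) (lenc u) = y"
  by (simp_all add: nthc_eq lenc_def nth_append nthc_eq[of _ "snoc u y", unfolded lenc_def])

context world
begin

definition node :: "prog \<Rightarrow> nat \<Rightarrow> nat \<Rightarrow> bool" where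
  "node p s0 b \<longleftrightarrow> fs b = s0 \<and> tre x p s0 (sn b)"

text \<open>Under the full index relation the index carries no information, so this is leastness of
  the plain inductive definition, tested on definable sets.\<close>

definition least_closed :: "prog \<Rightarrow> (nat \<Rightarrow> nat \<Rightarrow> bool) \<Rightarrow> bool" where
  "least_closed p I \<longleftrightarrow> (\<forall>S. Df2 S \<longrightarrow> (\<forall>b s. step p (\<lambda>_ _. True) S b s \<longrightarrow> S b s) \<longrightarrow>
     (\<forall>b s. I b s \<longrightarrow> S b s))"

text \<open>A definable set of nodes without minimum would have a leftmost branch in the model.
  Every challenge to a position on the branch is answered at some later stage, so the positions on
  it defend each other, and their complement is a closed set omitting \<open>s0\<close>.\<close>

lemma node_wf:
  assumes least: "least_closed p I"
    and I: "I b0 s0" and S: "Df (\<lambda>_ e. S (e 0))" and ne: "S b1" "node p s0 b1"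
  shows "\<exists>b. S b \<and> node p s0 b \<and> (\<forall>b'. klt x p b' b \<longrightarrow> \<not> S b')"
proof (rule ccontr)
  assume neg: "\<not> ?thesis"
  define T where "T a \<longleftrightarrow> S (pr s0 a) \<and> tre x p s0 a" for a
  have TD: "Df (\<lambda>_ e. T (e 0))"
    unfolding T_def by (intro Df_conj Df_app1[OF S] Df_comp[OF cb_tre] cf_pr cf_const cf_var)
  have nomin: "\<exists>b. T b \<and> ltk b a" if "T a" for a
  proof -
    have "S (pr s0 a) \<and> node p s0 (pr s0 a)" using that by (simp add: T_def node_def)
    then obtain b' where "klt x p b' (pr s0 a)" "S b'" using neg by blast
    then have "T (sn b') \<and> ltk (sn b') a"
      unfolding klt_def T_def by (metis fst_conv prod_encode_inverse snd_conv pr_fs_sn)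
    then show ?thesis by blast
  qed
  \<comment> \<open>The initial segments of the leftmost branch: \<open>T\<close> has an element
    through \<open>u\<close> and none to the left of \<open>u\<close>.\<close>
  define L where "L u \<longleftrightarrow> (\<exists>a. T a \<and> pfx u a) \<and> (\<forall>b. T b \<and> ltk b u \<longrightarrow> pfx u b)" for u
  have pfxD: "cb x (\<lambda>e. pfx (e 0) (e 1))"
    unfolding pfx_def by (intro cb_intros cf_intros)
  have ltkD: "cb x (\<lambda>e. ltk (e 0) (e 1))"
    unfolding ltk_def by (intro cb_intros cf_intros)
  have LD: "Df (\<lambda>_ e. L (e 0))"
    unfolding L_def
    by (intro Df_conj Df_ex Df_all Df_imp Df_app1[OF TD] Df_app2[of "\<lambda>_. pfx", OF Df_comp[OF pfxD]]
       Df_app2[of "\<lambda>_. ltk", OF Df_comp[OF ltkD]] cf_var)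
  have ext: "\<exists>y. L (snoc u y)" if u: "L u" for u
  proof -
    obtain a where a: "T a" "pfx u a" using u unfolding L_def by blast
    \<comment> \<open>The branch cannot end at \<open>u\<close>: if \<open>u\<close> itself is in
      \<open>T\<close>, a smaller element exists, and it must extend \<open>u\<close>.\<close>
    have "\<exists>b. T b \<and> pfx u b \<and> list_decode b \<noteq> list_decode u"
    proof (cases "list_decode a = list_decode u")
      case True
      then have au: "a = u" by (simp add: list_decode_eq)
      obtain b where b: "T b" "ltk b a" using nomin[OF a(1)] by blast
      then have "pfx u b" using u au unfolding L_def by blast
      moreover have "list_decode b \<noteq> list_decode u" using b(2) au by (auto simp: ltk_iff kb_irrefl)
      ultimately show ?thesis using b by blast
    qed (use a in blast)
    then obtain b where b: "T b" "pfx u b" "list_decode b \<noteq> list_decode u" by blast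
    then obtain y0 c where c: "list_decode b = list_decode u @ y0 # c"
      unfolding pfx_iff by (metis append_Nil2 list.exhaust)
    define P where "P y \<longleftrightarrow> (\<exists>b. T b \<and> pfx (snoc u y) b)" for y
    have "P y0" unfolding P_def pfx_iff using b c by auto
    define y where "y = (LEAST y. P y)"
    have y: "P y" unfolding y_def using \<open>P y0\<close> by (rule LeastI)
    have ymin: "\<not> P y'" if "y' < y" for y' using that unfolding y_def by (rule not_less_Least)
    have "pfx (snoc u y) b" if b: "T b" "ltk b (snoc u y)" for b
    proof -
      have "kb (list_decode b) (list_decode u)"
        using b(2) kb_trans[OF _ kb_append] unfolding ltk_iff by simp
      then have "pfx u b" using u b(1) unfolding L_def ltk_iff by blast
      then obtain d where d: "list_decode b = list_decode u @ d" unfolding pfx_iff by blast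
      then have "kb d [y]" using b(2) by (simp add: ltk_iff kb_append_iff)
      then obtain y' d' where d': "d = y' # d'" "y' < y \<or> y' = y" by (cases d) auto
      have "P y'" unfolding P_def pfx_iff using b(1) d d' by auto
      then have "y' = y" using ymin d'(2) by blast
      then show ?thesis unfolding pfx_iff using d d' by simp
    qed
    then have "L (snoc u y)" using y unfolding L_def P_def by blast
    then show ?thesis by blast
  qed
  have ext_n: "\<exists>u'. L u' \<and> lenc u' = lenc u + n \<and> pfx u u'" if u: "L u" for u n
  proof (induction n)
    case 0
    show ?case using u by (auto simp: pfx_iff)
  next
    case (Suc n)
    then obtain u' where u': "L u'" "lenc u' = lenc u + n" "pfx u u'" by blast
    from ext[OF u'(1)] obtain y where "L (snoc u' y)" by blast
    moreover have "pfx u (snoc u' y)" using u'(3) by (auto simp: pfx_iff)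
    ultimately show ?case using u'(2) by (intro exI[of _ "snoc u' y"]) simp
  qed
  have L0: "L 0"
  proof -
    have "pfx 0 a" for a by (simp add: pfx_iff)
    moreover have "T (sn b1)" using ne unfolding T_def node_def by (metis pr_fs_sn)
    ultimately show ?thesis unfolding L_def by blast
  qed
  define C where "C s \<longleftrightarrow> s = s0 \<or> (\<exists>u. L u \<and> (\<exists>i<lenc u. s \<in> set_decode (nthc u i)))" for s
  have CD: "Df (\<lambda>_ e. C (e 0))"
    unfolding C_def
    by (intro Df_disj Df_ex Df_bex Df_conj Df_app1[OF LD] Df_comp[OF cb_mem] Df_comp[OF cb_eq]
        cf_nthc cf_lenc cf_var cf_const)
  have resp: "\<exists>y. resp x p s k y \<and> (\<forall>s'\<in>set_decode y. C s')" if s: "C s" for s k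
  proof -
    obtain u where u: "L u" "s = s0 \<or> (\<exists>i<lenc u. s \<in> set_decode (nthc u i))"
      using s L0 unfolding C_def by blast
    \<comment> \<open>Among the stages that treat \<open>(s, k)\<close>, this one comes after all
      stages recorded in \<open>u\<close>, when \<open>s\<close> is already on record.\<close>
    define j where "j = pr (pr s k) (lenc u)"
    have j: "lenc u \<le> j" unfolding j_def by (rule le_prod_encode_2)
    obtain u' where u': "L u'" "lenc u' = lenc u + (Suc j - lenc u)" "pfx u u'"
      using ext_n[OF u(1)] by blast
    then have len: "lenc u' = Suc j" using j by simp
    obtain a where a: "T a" "pfx u' a" using u'(1) unfolding L_def by blast
    have nth: "nthc u' i = nthc a i" if "i < Suc j" for i
      using a(2) that len unfolding pfx_def by simp
    have ja: "j < lenc a" using a(2) len unfolding pfx_def by simp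
    have "s = s0 \<or> (\<exists>i<j. s \<in> set_decode (nthc a i))"
    proof -
      have "nthc u i = nthc a i" if "i < lenc u" for i
        using u'(3) nth[of i] that j unfolding pfx_def by simp
      then show ?thesis using u(2) j by (metis order_less_le_trans)
    qed
    then have "resp x p s k (nthc a j)"
      using a(1) ja unfolding T_def tre_def by (auto simp: j_def)
    moreover have "C s'" if "s' \<in> set_decode (nthc a j)" for s'
      unfolding C_def using that nth[of j] u'(1) len by (intro disjI2 exI[of _ u'] conjI exI[of _ j]) auto
    ultimately show ?thesis by blast
  qed
  have "\<not> C s0"
  proof -
    have "Df2 (\<lambda>b s. \<not> C s)" by (intro Df_not Df_app1[OF CD] cf_var)
    moreover have "\<not> C s" if "step p (\<lambda>_ _. True) (\<lambda>b s. \<not> C s) b s" for b s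
    proof
      assume "C s"
      from that obtain k where "\<And>y. resp x p s k y \<Longrightarrow> \<exists>s'. s' \<in> set_decode y \<and> \<not> C s'"
        unfolding step_def lth_def by blast
      then show False using resp[OF \<open>C s\<close>, of k] by blast
    qed
    ultimately show ?thesis
      using least[unfolded least_closed_def, rule_format, of "\<lambda>b s. \<not> C s" b0 s0] I by blast
  qed
  then show False by (simp add: C_def)
qed

text \<open>A minimal counterexample replaces recursion on ranks: consider the nodes at which no
  recorded position is won at the index given by the node itself. A minimal one could be lengthened
  by an unbeaten answer to the scheduled challenge, and longer nodes are smaller.\<close>

lemma root_in_hier:
  assumes least: "least_closed p I"
    and I: "I b0 s0" and A: "hier p (klt x p) A" "Df2 A"
  shows "A (pr s0 0) s0"
proof (rule ccontr)
  assume na: "\<not> A (pr s0 0) s0"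
  define cm where "cm b s \<longleftrightarrow> s = fs b \<or> (\<exists>i<lenc (sn b). s \<in> set_decode (nthc (sn b) i))" for b s
  define S where "S b \<longleftrightarrow> (\<forall>s. cm b s \<longrightarrow> \<not> A b s)" for b
  have l0: "lenc 0 = 0" by (simp add: lenc_def)
  have "cb x (\<lambda>e. cm (e 0) (e 1))"
    unfolding cm_def by (intro cb_intros cf_intros)
  then have SD: "Df (\<lambda>_ e. S (e 0))"
    unfolding S_def
    by (intro Df_all Df_imp Df_not Df_app2[of "\<lambda>_. A", OF A(2)] Df_app2[of "\<lambda>_. cm", OF Df_comp] cf_var)
  have "S (pr s0 0)" using na by (simp add: S_def cm_def l0)
  moreover have "node p s0 (pr s0 0)" by (simp add: node_def tre_def l0)
  ultimately obtain b where b: "S b" "node p s0 b" "\<And>b'. klt x p b' b \<Longrightarrow> \<not> S b'"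
    using node_wf[OF least I SD] by blast
  define t where "t = sn b"
  have bt: "b = pr s0 t" "tre x p s0 t" using b(2) pr_fs_sn[of b] by (auto simp: node_def t_def)
  define s where "s = fs (fs (lenc t))"
  define k where "k = sn (fs (lenc t))"
  have "\<exists>y. (cm b s \<longrightarrow> resp x p s k y) \<and> (\<forall>s'\<in>set_decode y. \<not> lth (klt x p) A b s')"
  proof (cases "cm b s")
    case True
    then have "\<not> step p (klt x p) A b s" using b(1) A(1) unfolding S_def hier_def by blast
    then show ?thesis unfolding step_def by blast
  next
    case False
    \<comment> \<open>A challenge to a position not on record is met by the empty set, coded by
      \<open>0\<close>.\<close>
    then show ?thesis by (intro exI[of _ 0]) simp
  qed
  then obtain y where y: "cm b s \<Longrightarrow> resp x p s k y" "\<And>s'. s' \<in> set_decode y \<Longrightarrow> \<not> lth (klt x p) A b s'"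
    by blast
  define t' where "t' = snoc t y"
  have tre': "tre x p s0 t'"
    unfolding tre_def
  proof (intro allI impI)
    fix j assume j: "j < lenc t'" and c: "fs (fs j) = s0 \<or> (\<exists>i<j. fs (fs j) \<in> set_decode (nthc t' i))"
    have old: "nthc t' i = nthc t i" if "i < lenc t" for i unfolding t'_def by (rule nthc_snoc(1)[OF that])
    show "resp x p (fs (fs j)) (sn (fs j)) (nthc t' j)"
    proof (cases "j = lenc t")
      case True
      have "cm b s"
        using c old unfolding cm_def s_def bt(1) True by auto
      from y(1)[OF this] show ?thesis unfolding True t'_def nthc_snoc(2) s_def k_def .
    next
      case False
      then have j': "j < lenc t" using j unfolding t'_def by simp
      have "fs (fs j) = s0 \<or> (\<exists>i<j. fs (fs j) \<in> set_decode (nthc t i))"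
        using c old j' by (metis order.strict_trans)
      then show ?thesis using bt(2) j' unfolding tre_def old[OF j'] by blast
    qed
  qed
  define b' where "b' = pr s0 t'"
  have lt: "klt x p b' b"
    unfolding klt_def b'_def bt(1) using tre' bt(2)
    by (simp add: ltk_iff t'_def kb_append)
  have "S b'"
    unfolding S_def
  proof (intro allI impI notI)
    fix s' assume c: "cm b' s'" and A': "A b' s'"
    have "\<not> cm b s'"
    proof
      assume "cm b s'"
      then have "\<not> step p (klt x p) A b s'" using b(1) A(1) unfolding S_def hier_def by blast
      \<comment> \<open>Winning at a smaller index implies winning at a larger one, by transitivity
        of the order.\<close>
      moreover have "step p (klt x p) A b' s'" using A' A(1) unfolding hier_def by blast
      then have "step p (klt x p) A b s'"
        unfolding step_def lth_def using klt_trans[OF _ lt] by meson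
      ultimately show False by blast
    qed
    then have "s' \<in> set_decode y"
      using c unfolding cm_def b'_def bt(1) t'_def by (auto simp: less_Suc_eq nthc_snoc)
    then have "\<not> lth (klt x p) A b s'" by (rule y(2))
    then show False using lt A' unfolding lth_def by blast
  qed
  then show False using b(3)[OF lt] by blast
qed

end

section \<open>Embeddings of well-orders, and computable copies\<close>

section \<open>Comparing well-orders\<close>

text \<open>If \<open>k\<close> were shorter, it would be isomorphic to a proper initial segment of
  \<open>r\<close>, and \<open>f\<close> would induce a strictly increasing map of \<open>r\<close>
  into itself that moves some element down; its value at the least such element is a smaller
  one.\<close>

lemma ordLeq_if_strict_mono:
  assumes r: "Well_order r" and k: "Well_order k"
    and f: "\<And>a. a \<in> Field r \<Longrightarrow> f a \<in> Field k"
    and mono: "\<And>a b. (a, b) \<in> r \<Longrightarrow> a \<noteq> b \<Longrightarrow> (f a, f b) \<in> k \<and> f a \<noteq> f b"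
  shows "r \<le>o k"
proof (rule ccontr)
  assume "\<not> r \<le>o k"
  then have "k <o r" using r k not_ordLeq_iff_ordLess by blast
  then obtain a where a: "a \<in> Field r" and "k =o Restr r (underS r a)"
    using ordLess_iff_ordIso_Restr[OF r k] by blast
  then obtain g where g: "iso k (Restr r (underS r a)) g"
    unfolding ordIso_def by blast
  have wr: "Well_order (Restr r (underS r a))" using r by (rule Well_order_Restr)
  have gbij: "bij_betw g (Field k) (Field (Restr r (underS r a)))"
    and gemb: "\<And>c d. c \<in> Field k \<Longrightarrow> d \<in> Field k \<Longrightarrow> (c, d) \<in> k \<longleftrightarrow> (g c, g d) \<in> Restr r (underS r a)"
    using g iso_iff2[of k "Restr r (underS r a)" g] by blast+
  define h where "h c = g (f c)" for c
  have hin: "h c \<in> underS r a" if "c \<in> Field r" for c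
  proof -
    have "g (f c) \<in> Field (Restr r (underS r a))"
      using gbij f[OF that] by (auto simp: bij_betw_def)
    then show ?thesis unfolding h_def by (auto simp: Field_def)
  qed
  have hmono: "(h c, h d) \<in> r \<and> h c \<noteq> h d" if cd: "(c, d) \<in> r" "c \<noteq> d" for c d
  proof -
    have F: "c \<in> Field r" "d \<in> Field r" using cd by (auto simp: Field_def)
    have m: "(f c, f d) \<in> k" "f c \<noteq> f d" using mono[OF cd] by auto
    have "(g (f c), g (f d)) \<in> r" using gemb[OF f[OF F(1)] f[OF F(2)]] m by blast
    moreover have "g (f c) \<noteq> g (f d)"
      using gbij m(2) f[OF F(1)] f[OF F(2)] unfolding bij_betw_def inj_on_def by blast
    ultimately show ?thesis unfolding h_def by blast
  qed
  have wf: "wf (r - Id)" using r by (simp add: well_order_on_def)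
  define Q where "Q = {z. z \<in> Field r \<and> (h z, z) \<in> r - Id}"
  have "a \<in> Q" using hin[OF a] a unfolding Q_def underS_def by auto
  then obtain z where z: "z \<in> Q" "\<And>y. (y, z) \<in> r - Id \<Longrightarrow> y \<notin> Q"
    using wfE_min[OF wf] by metis
  then have zz: "z \<in> Field r" "(h z, z) \<in> r" "h z \<noteq> z" unfolding Q_def by auto
  then have "h z \<in> Field r" by (auto simp: Field_def)
  moreover have "(h (h z), h z) \<in> r \<and> h (h z) \<noteq> h z" using hmono[OF zz(2,3)] by simp
  ultimately have "h z \<in> Q" unfolding Q_def by auto
  then show False using z(2) zz by blast
qed

lemma computable_rel_underS:
  assumes "computable_rel x k"
  shows "computable_rel x (Restr k (underS k a))"
proof (rule computable_relI)
  have "cb x (\<lambda>e. (e 0, e 1) \<in> k \<and> (e 0 \<noteq> a \<and> (e 0, a) \<in> k) \<and> (e 1 \<noteq> a \<and> (e 1, a) \<in> k))"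
    using cf_app2[of x "\<lambda>c d. of_bool ((c, d) \<in> k)", OF computable_relD[OF assms]]
    by (intro cb_conj cb_not cb_eq cf_var cf_const) (simp_all add: cf_var cf_const)
  then show "cb x (\<lambda>e. (e 0, e 1) \<in> Restr k (underS k a))"
    by (rule cb_cong) (auto simp: underS_def)
qed

lemma has_type_ordIso: "k =o r \<Longrightarrow> has_type r \<alpha> \<Longrightarrow> has_type k \<alpha>"
  by transfer (rule ordIso_transitive)

lemma presentable_if_ordLeq:
  assumes r: "Well_order r" "has_type r \<alpha>" and k: "Well_order k" "computable_rel x k" and le: "r \<le>o k"
  shows "presentable x \<alpha>"
proof -
  have *: "presentable x \<alpha>" if k': "r =o k'" "computable_rel x k'" for k' :: "nat rel"
  proof -
    have wk: "Well_order k'" using k'(1) by (auto simp: ordIso_def)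
    have "has_type k' \<alpha>"
      using has_type_ordIso[OF ordIso_symmetric[OF k'(1)] r(2)] .
    then show ?thesis using wk k'(2) unfolding presentable_def by blast
  qed
  from le consider "r <o k" | "r =o k" using ordLeq_iff_ordLess_or_ordIso by blast
  then show ?thesis
  proof cases
    case 1
    then obtain a where "r =o Restr k (underS k a)"
      using ordLess_iff_ordIso_Restr[OF k(1) r(1)] by blast
    then show ?thesis using * computable_rel_underS[OF k(2)] by blast
  next
    case 2
    then show ?thesis using * k(2) by blast
  qed
qed

text \<open>New strings may always be labelled bottom, whatever reals have been promised.\<close>

lemma ex_longer:
  assumes "valid h"
  shows "\<exists>h'. valid h' \<and> le X h' h \<and> N \<le> hn h'"
proof -
  obtain n f where h: "h = hcode n f" using assms unfolding valid_def by blast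
  let ?f = "\<lambda>\<sigma>. if length \<sigma> \<le> n then f \<sigma> else LBot"
  let ?h = "hcode (max n N) ?f"
  have "le X ?h h"
    unfolding le_def h hs_hcode hn_hcode
  proof (intro conjI ballI)
    show "n \<le> max n N" by simp
    show "{pr (scode \<sigma>) (label_code (f \<sigma>)) |\<sigma>. length \<sigma> \<le> n} \<subseteq>
        {pr (scode \<sigma>) (label_code (?f \<sigma>)) |\<sigma>. length \<sigma> \<le> max n N}"
    proof
      fix q assume "q \<in> {pr (scode \<sigma>) (label_code (f \<sigma>)) |\<sigma>. length \<sigma> \<le> n}"
      then obtain \<sigma> where "q = pr (scode \<sigma>) (label_code (?f \<sigma>))" "length \<sigma> \<le> max n N" by auto
      then show "q \<in> {pr (scode \<sigma>) (label_code (?f \<sigma>)) |\<sigma>. length \<sigma> \<le> max n N}" by blast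
    qed
    fix q assume q: "q \<in> {pr (scode \<sigma>) (label_code (?f \<sigma>)) |\<sigma>. length \<sigma> \<le> max n N} -
       {pr (scode \<sigma>) (label_code (f \<sigma>)) |\<sigma>. length \<sigma> \<le> n}"
    then obtain \<sigma> where \<sigma>: "q = pr (scode \<sigma>) (label_code (?f \<sigma>))" by blast
    with q have "\<not> length \<sigma> \<le> n" by auto
    then show "sn q = 2 \<or> (\<forall>y\<in>X. \<not> pref (fs q) y)" using \<sigma> by simp
  qed
  moreover have "valid ?h" unfolding valid_def by blast
  ultimately show ?thesis by (intro exI[of _ ?h]) simp
qed

section \<open>Genericity: indices forced for the elements of the order, and their
  accessibility\<close>

section \<open>Generic filters and the rank argument\<close>

text \<open>The filter is seen through pairs of a labelling code and a finite set of reals, and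
  \<open>y\<close> is the real of the generic labelling. Genericity is demanded for dense sets of
  one shape: refute \<open>Z\<close>, or fix a witness \<open>m\<close> and refute \<open>U\<close>
  at \<open>m\<close>. All applications have this shape, so one construction of dense sets in the
  model is enough.\<close>

locale kgen = world +
  fixes G :: "(nat \<times> cantor set) set" and y :: cantor and p :: prog and r :: "nat rel"
  assumes G_cond: "(h, X) \<in> G \<Longrightarrow> valid h \<and> fin X"
    and G_dir: "(h, X) \<in> G \<Longrightarrow> (h', X') \<in> G \<Longrightarrow>
      \<exists>h'' X''. (h'', X'') \<in> G \<and> le X h'' h \<and> X \<subseteq> X'' \<and> le X' h'' h' \<and> X' \<subseteq> X''"
    and G_gen: "Df (\<lambda>_ e. Z (e 0)) \<Longrightarrow> Df2 B \<Longrightarrow> Df2 U \<Longrightarrow>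
      (\<And>h X. valid h \<Longrightarrow> fin X \<Longrightarrow> \<exists>h' X'. valid h' \<and> fin X' \<and> X \<subseteq> X' \<and> le X h' h \<and>
         (noext X' h' Z \<or> (\<exists>m. B h' m \<and> noext X' h' (\<lambda>h''. U h'' m)))) \<Longrightarrow>
      \<exists>h X. (h, X) \<in> G \<and> (noext X h Z \<or> (\<exists>m. B h m \<and> noext X h (\<lambda>h''. U h'' m)))"
    and G_apx: "(h, X) \<in> G \<Longrightarrow> apx y h"
    and r_wo: "Well_order r"
    and r_comp: "computes (x \<squnion>\<^sub>T y) p [m, n] (of_bool ((m, n) \<in> r))"
begin

text \<open>Where \<open>Z\<close> is not refuted some extension satisfies it, so density only has
  to be checked from there.\<close>

lemma generic:
  assumes "Df (\<lambda>_ e. Z (e 0))" "Df2 B" "Df2 U"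
    and dense: "\<And>h X h'. valid h \<Longrightarrow> fin X \<Longrightarrow> valid h' \<Longrightarrow> le X h' h \<Longrightarrow> Z h' \<Longrightarrow>
      \<exists>h'' X'' m. valid h'' \<and> fin X'' \<and> X \<subseteq> X'' \<and> le X h'' h \<and> B h'' m \<and> noext X'' h'' (\<lambda>h''. U h'' m)"
  obtains h X where "(h, X) \<in> G" "noext X h Z"
  | h X m where "(h, X) \<in> G" "B h m" "noext X h (\<lambda>h'. U h' m)"
proof -
  have "\<exists>h' X'. valid h' \<and> fin X' \<and> X \<subseteq> X' \<and> le X h' h \<and>
     (noext X' h' Z \<or> (\<exists>m. B h' m \<and> noext X' h' (\<lambda>h''. U h'' m)))" if hX: "valid h" "fin X" for h X
  proof (cases "noext X h Z")
    case True
    then show ?thesis using hX le_refl by blast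
  next
    case False
    then obtain h' where "valid h'" "le X h' h" "Z h'" unfolding noext_def by blast
    from dense[OF hX this] show ?thesis by blast
  qed
  from G_gen[OF assms(1-3) this] that show ?thesis by blast
qed

definition rlt :: "nat \<Rightarrow> nat \<Rightarrow> bool" where
  "rlt m n \<longleftrightarrow> m \<noteq> 0 \<and> (if n = 0 then (m - 1, m - 1) \<in> r else m \<noteq> n \<and> (m - 1, n - 1) \<in> r)"

text \<open>True well-foundedness of \<open>r\<close> enters here; the formal top is reached after
  all other elements.\<close>

lemma rlt_induct:
  assumes step: "\<And>n. (\<And>m. rlt m n \<Longrightarrow> P m) \<Longrightarrow> P n"
  shows "P n"
proof -
  have wf: "wf (r - Id)" using r_wo by (simp add: well_order_on_def)
  have P: "P (Suc k)" for k
  proof (induction k rule: wf_induct_rule[OF wf])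
    case (1 k)
    show ?case
    proof (rule step)
      fix m assume "rlt m (Suc k)"
      then obtain j where "m = Suc j" "(j, k) \<in> r - Id" by (cases m) (auto simp: rlt_def)
      then show "P m" using 1 by blast
    qed
  qed
  show ?thesis
  proof (cases n)
    case 0
    show ?thesis
    proof (rule step)
      fix m assume "rlt m n"
      then show "P m" using P by (cases m) (auto simp: rlt_def)
    qed
  qed (use P in simp)
qed

lemma rlt_dom: "rlt m n \<Longrightarrow> rlt m 0"
proof -
  assume m: "rlt m n"
  have "refl_on (Field r) r" using r_wo by (simp add: order_on_defs)
  moreover have "m - 1 \<in> Field r" using m by (auto simp: rlt_def Field_def split: if_splits)
  ultimately have "(m - 1, m - 1) \<in> r" by (simp add: refl_on_def)
  then show ?thesis using m by (auto simp: rlt_def)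
qed

lemma frc_sound: "(h, X) \<in> G \<Longrightarrow> frc x p h m n \<Longrightarrow> rlt m n"
proof -
  assume G: "(h, X) \<in> G" and f: "frc x p h m n"
  have "(a, b) \<in> r" if "ev x h p [a, b] = 2" for a b
  proof -
    have "computes (x \<squnion>\<^sub>T y) p [a, b] 1" using ev_sound[OF G_apx[OF G], of x p "[a, b]" 1] that by simp
    from computes_det[OF this r_comp[of a b]] show ?thesis by (cases "(a, b) \<in> r") auto
  qed
  then show ?thesis using f unfolding frc_def rlt_def by (auto split: if_splits)
qed

lemma frc_complete: "rlt m n \<Longrightarrow> \<exists>N. \<forall>h. apx y h \<and> N \<le> hn h \<longrightarrow> frc x p h m n"
proof -
  assume m: "rlt m n"
  have *: "\<exists>N. \<forall>h. apx y h \<and> N \<le> hn h \<longrightarrow> ev x h p [a, b] = 2" if "(a, b) \<in> r" for a b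
    using ev_complete[OF r_comp[of a b]] that by (simp add: numeral_2_eq_2)
  show ?thesis
  proof (cases "n = 0")
    case True
    then show ?thesis using *[of "m - 1" "m - 1"] m by (simp add: rlt_def frc_def)
  next
    case False
    then show ?thesis using *[of "m - 1" "n - 1"] m by (simp add: rlt_def frc_def)
  qed
qed

lemma G_long: "\<exists>h X. (h, X) \<in> G \<and> N \<le> hn h"
proof (rule generic[of "\<lambda>h. N \<le> hn h" "\<lambda>h m. N \<le> hn h" "\<lambda>h m. False"])
  show "Df (\<lambda>_ e. N \<le> hn (e 0))" "Df2 (\<lambda>h m. N \<le> hn h)" "Df2 (\<lambda>h m. False)"
    by (intro Df_comp cb_le cf_const cf_fs cf_var cb_const)+
next
  fix h X h' assume "valid h" "fin X" "valid h'" "le X h' h" "N \<le> hn h'"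
  then show "\<exists>h'' X'' m. valid h'' \<and> fin X'' \<and> X \<subseteq> X'' \<and> le X h'' h \<and> N \<le> hn h'' \<and>
     noext X'' h'' (\<lambda>h''. False)" by (auto simp: noext_def)
next
  fix h X assume G: "(h, X) \<in> G" "noext X h (\<lambda>h. N \<le> hn h)"
  then have False using ex_longer[of h X N] G_cond unfolding noext_def by blast
  then show ?thesis ..
next
  fix h X m assume "(h, X) \<in> G" "N \<le> hn h"
  then show ?thesis by blast
qed

lemma G_dir_long:
  assumes "(h, X) \<in> G" "(h', X') \<in> G"
  shows "\<exists>h'' X''. (h'', X'') \<in> G \<and> le X h'' h \<and> X \<subseteq> X'' \<and> le X' h'' h' \<and> X' \<subseteq> X'' \<and> N \<le> hn h''"
proof -
  obtain h1 X1 where 1: "(h1, X1) \<in> G" "le X h1 h" "X \<subseteq> X1" "le X' h1 h'" "X' \<subseteq> X1"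
    using G_dir[OF assms] by blast
  obtain h2 X2 where 2: "(h2, X2) \<in> G" "N \<le> hn h2" using G_long by blast
  obtain h3 X3 where 3: "(h3, X3) \<in> G" "le X1 h3 h1" "X1 \<subseteq> X3" "le X2 h3 h2"
    using G_dir[OF 1(1) 2(1)] by blast
  have "N \<le> hn h3" using 2(2) 3(4) by (simp add: le_def)
  moreover have "le X h3 h" "le X' h3 h'" using le_trans[OF _ 3(2)] 1 by blast+
  ultimately show ?thesis using 3 1 by blast
qed

text \<open>The generic gives \<open>n\<close> rank at most \<open>b\<close> along \<open>R\<close>:
  some condition ensures that whatever is put below \<open>n\<close> is won before
  \<open>b\<close>.\<close>

definition meets :: "(nat \<Rightarrow> nat \<Rightarrow> bool) \<Rightarrow> (nat \<Rightarrow> nat \<Rightarrow> bool) \<Rightarrow> nat \<Rightarrow> nat \<Rightarrow> bool" where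
  "meets R A b n \<longleftrightarrow> (\<exists>h X. (h, X) \<in> G \<and> noext X h (zed p R A b n))"

text \<open>A condition witnessing \<open>meets\<close> keeps doing so when its labelling grows
  inside the filter, and \<open>hier_s1\<close> then puts the position of a common extension into
  \<open>A\<close> at \<open>b\<close>.\<close>

lemma clash:
  assumes A: "hier p R A" "Df2 A" "Df2 R" and m: "meets R A b n"
    and G: "(h, X) \<in> G" "noext X h (\<lambda>h'. Q h')" and Q: "\<And>h'. A b (s1 h' n) \<Longrightarrow> Q h'"
  shows False
proof -
  obtain h1 X1 where 1: "(h1, X1) \<in> G" "noext X1 h1 (zed p R A b n)" using m unfolding meets_def by blast
  obtain h2 X2 where 2: "(h2, X2) \<in> G" "le X1 h2 h1" "X1 \<subseteq> X2" "le X h2 h" "X \<subseteq> X2"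
    using G_dir[OF 1(1) G(1)] by blast
  have "noext X1 h2 (zed p R A b n)" using noext_mono[OF 1(2) 2(2)] by blast
  then have "A b (s1 h2 n)" using hier_s1[OF A] G_cond[OF 1(1)] by blast
  then show False using Q G(2) 2(4) G_cond[OF 2(1)] unfolding noext_def by blast
qed

lemma meets_or:
  assumes A: "hier p R A" "Df2 A" "Df2 R"
  shows "meets R A b n \<or> (\<exists>h X. (h, X) \<in> G \<and> noext X h (\<lambda>h'. A b (s1 h' n)))"
proof (rule generic[of "\<lambda>h. A b (s1 h n)" "\<lambda>h m. True" "\<lambda>h m. zed p R A b n h"])
  show "Df (\<lambda>_ e. A b (s1 (e 0) n))"
    by (intro Df_app2[of "\<lambda>_. A", OF A(2)] cf_s1 cf_var cf_const)
  show "Df2 (\<lambda>h m. True)" by (rule Df_const)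
  show "Df2 (\<lambda>h m. zed p R A b n h)" by (intro Df_zed A cf_var cf_const)
next
  fix h X h' assume a: "valid h" "fin X" "valid h'" "le X h' h" "A b (s1 h' n)"
  then obtain Y where Y: "fin Y" "noext Y h' (zed p R A b n)" using hier_s1[OF A] by blast
  have "noext (X \<union> Y) h' (zed p R A b n)" using noext_mono[OF Y(2) le_refl] by blast
  then show "\<exists>h'' X'' m. valid h'' \<and> fin X'' \<and> X \<subseteq> X'' \<and> le X h'' h \<and> True \<and>
     noext X'' h'' (\<lambda>h''. zed p R A b n h'')" using a fin_Un[OF a(2) Y(1)] by blast
qed (auto simp: meets_def)

text \<open>By \<open>clash\<close>, \<open>n\<close> is not met at \<open>b\<close>, so genericity
  yields a labelling that puts below \<open>n\<close> some \<open>m\<close> whose position is unwon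
  before \<open>b\<close>, in particular unwon at \<open>b'\<close>. Then \<open>hier_s2D\<close>
  supplies reals that keep \<open>m\<close> unwon at all indices before \<open>b'\<close>.\<close>

lemma descend:
  assumes A: "hier p R A" "Df2 A" "Df2 R" and b': "R b' b"
    and G: "(h, X) \<in> G" "noext X h (\<lambda>h'. A b (s1 h' n))"
  shows "\<exists>m h' X'. rlt m n \<and> (h', X') \<in> G \<and> noext X' h' (\<lambda>h'. lth R A b' (s1 h' m))"
proof (rule generic[of "zed p R A b n" "\<lambda>h m. frc x p h m n" "\<lambda>h m. lth R A b' (s1 h m)"])
  show "Df (\<lambda>_ e. zed p R A b n (e 0))" by (intro Df_zed A cf_var cf_const)
  show "Df2 (\<lambda>h m. frc x p h m n)" by (intro Df_comp cb_frc cf_var cf_const)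
  show "Df2 (\<lambda>h m. lth R A b' (s1 h m))" by (intro Df_lth A cf_s1 cf_var cf_const)
next
  fix h X h' assume a: "valid h" "fin X" "valid h'" "le X h' h" "zed p R A b n h'"
  then obtain m k where mk: "frc x p h' m n" "\<not> lth R A b (s2 h' m k)" unfolding zed_def by blast
  then have "\<not> A b' (s2 h' m k)" using b' unfolding lth_def by blast
  from hier_s2D[OF A this] obtain Y where Y: "fin Y" "noext Y h' (\<lambda>h'. lth R A b' (s1 h' m))" by blast
  have "noext (X \<union> Y) h' (\<lambda>h'. lth R A b' (s1 h' m))" using noext_mono[OF Y(2) le_refl] by blast
  then show "\<exists>h'' X'' m. valid h'' \<and> fin X'' \<and> X \<subseteq> X'' \<and> le X h'' h \<and> frc x p h'' m n \<and>
     noext X'' h'' (\<lambda>h''. lth R A b' (s1 h'' m))" using a mk(1) fin_Un[OF a(2) Y(1)] by blast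
next
  fix h1 X1 assume "(h1, X1) \<in> G" "noext X1 h1 (zed p R A b n)"
  then have "meets R A b n" unfolding meets_def by blast
  from clash[OF A this G] have False by blast
  then show ?thesis ..
next
  fix h' X' m assume "(h', X') \<in> G" "frc x p h' m n" "noext X' h' (\<lambda>h'. lth R A b' (s1 h' m))"
  then show ?thesis using frc_sound by blast
qed

text \<open>Otherwise some condition forbids \<open>m\<close> at all indices before
  \<open>b\<close>. A longer condition puts \<open>m\<close> below \<open>n\<close>, so the
  positions \<open>s2 h3 m k\<close> are won before \<open>b\<close> for every \<open>k\<close>;
  with \<open>k\<close> counting its own reals this contradicts the prohibition.\<close>

lemma meets_below:
  assumes A: "hier p R A" "Df2 A" "Df2 R" and tr: "\<And>a b c. R a b \<Longrightarrow> R b c \<Longrightarrow> R a c"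
    and b: "meets R A b n" and m: "rlt m n"
  shows "\<exists>b'. R b' b \<and> meets R A b' m"
proof (rule generic[of "\<lambda>h. lth R A b (s1 h m)" "\<lambda>h b'. R b' b" "\<lambda>h b'. zed p R A b' m h"])
  show "Df (\<lambda>_ e. lth R A b (s1 (e 0) m))" by (intro Df_lth A cf_s1 cf_var cf_const)
  show "Df2 (\<lambda>h b'. R b' b)" by (intro Df_app2[of "\<lambda>_. R", OF A(3)] cf_var cf_const)
  show "Df2 (\<lambda>h b'. zed p R A b' m h)" by (intro Df_zed A cf_var cf_const)
next
  fix h X h' assume a: "valid h" "fin X" "valid h'" "le X h' h" "lth R A b (s1 h' m)"
  then obtain b' where b': "R b' b" "A b' (s1 h' m)" unfolding lth_def by blast
  then obtain Y where Y: "fin Y" "noext Y h' (zed p R A b' m)" using hier_s1[OF A] by blast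
  have "noext (X \<union> Y) h' (zed p R A b' m)" using noext_mono[OF Y(2) le_refl] by blast
  then show "\<exists>h'' X'' b'. valid h'' \<and> fin X'' \<and> X \<subseteq> X'' \<and> le X h'' h \<and> R b' b \<and>
     noext X'' h'' (\<lambda>h''. zed p R A b' m h'')" using a b'(1) fin_Un[OF a(2) Y(1)] by blast
next
  fix h1 X1 assume 1: "(h1, X1) \<in> G" "noext X1 h1 (\<lambda>h. lth R A b (s1 h m))"
  obtain h X where hX: "(h, X) \<in> G" "noext X h (zed p R A b n)" using b unfolding meets_def by blast
  obtain N where N: "\<And>h. apx y h \<Longrightarrow> N \<le> hn h \<Longrightarrow> frc x p h m n" using frc_complete[OF m] by blast
  obtain h3 X3 where 3: "(h3, X3) \<in> G" "le X h3 h" "X \<subseteq> X3" "le X1 h3 h1" "X1 \<subseteq> X3" "N \<le> hn h3"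
    using G_dir_long[OF hX(1) 1(1)] by blast
  have "frc x p h3 m n" using N G_apx 3 by blast
  moreover have "\<not> zed p R A b n h3" using hX(2) 3(2) G_cond[OF 3(1)] unfolding noext_def by blast
  ultimately have l: "lth R A b (s2 h3 m k)" for k unfolding zed_def by blast
  have "fin X3" using G_cond[OF 3(1)] by blast
  from hier_s2I[OF A(1) this, of h3 m] obtain k where
    k: "\<And>b. A b (s2 h3 m k) \<Longrightarrow> \<not> noext X3 h3 (\<lambda>h'. lth R A b (s1 h' m))" by blast
  from l[of k] obtain b' where b': "R b' b" "A b' (s2 h3 m k)" unfolding lth_def by blast
  from k[OF b'(2)] obtain h4 where h4: "valid h4" "le X3 h4 h3" "lth R A b' (s1 h4 m)"
    unfolding noext_def by blast
  then have "lth R A b (s1 h4 m)" using tr b'(1) unfolding lth_def by blast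
  moreover have "le X1 h4 h1" using le_trans[OF 3(4) h4(2) 3(5)] .
  ultimately have False using 1(2) h4(1) unfolding noext_def by blast
  then show ?thesis ..
next
  fix h X b' assume "(h, X) \<in> G" "R b' b" "noext X h (\<lambda>h. zed p R A b' m h)"
  then show ?thesis unfolding meets_def by blast
qed

text \<open>For the full index relation, a failure at \<open>n\<close> passes by
  \<open>descend\<close> to a smaller \<open>m\<close>, against the induction along
  \<open>r\<close>. So the formal top is met by the plain fixed point, and
  \<open>root_in_hier\<close> transfers this to the tree of an actual position
  \<open>s1 h0 0\<close>.\<close>

lemma ex_root:
  assumes A: "hier p (klt x p) A" "Df2 A"
  obtains I b0 s0 where "least_closed p I" "I b0 s0" "meets (klt x p) A (pr s0 0) 0"
proof -
  let ?T = "\<lambda>_ _ :: nat. True"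
  have kD: "Df2 (klt x p)" by (intro Df_comp cb_klt cf_var)
  obtain I where I: "Df2 I" "hier p ?T I"
    "\<And>S b s. Df2 S \<Longrightarrow> (\<And>b s. step p ?T S b s \<Longrightarrow> S b s) \<Longrightarrow> I b s \<Longrightarrow> S b s"
    using ex_hier[of ?T p, OF Df_const] by blast
  have lc: "least_closed p I" unfolding least_closed_def using I(3) by blast
  note TI = I(2,1) Df_const[of True]
  have mI: "meets ?T I 0 n" for n
  proof (induction n rule: rlt_induct)
    case (1 n)
    show ?case
    proof (rule ccontr)
      assume "\<not> ?thesis"
      then obtain h X where hX: "(h, X) \<in> G" "noext X h (\<lambda>h'. I 0 (s1 h' n))"
        using meets_or[OF TI] by blast
      obtain m h' X' where m: "rlt m n" "(h', X') \<in> G" "noext X' h' (\<lambda>h'. lth ?T I 0 (s1 h' m))"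
        using descend[OF TI TrueI hX] by blast
      show False
        by (rule clash[OF TI 1[OF m(1)] m(2,3)]) (auto simp: lth_def)
    qed
  qed
  show thesis
  \<comment> \<open>The labelling \<open>h0\<close> is carried along as the witness, since the tree
    and its root depend on it.\<close>
  proof (rule generic[of "\<lambda>h. I 0 (s1 h 0)" "\<lambda>h h0. I 0 (s1 h0 0)"
        "\<lambda>h h0. zed p (klt x p) A (pr (s1 h0 0) 0) 0 h"])
    show "Df (\<lambda>_ e. I 0 (s1 (e 0) 0))" "Df2 (\<lambda>h h0. I 0 (s1 h0 0))"
      by (intro Df_app2[of "\<lambda>_. I", OF I(1)] cf_s1 cf_var cf_const)+
    show "Df2 (\<lambda>h h0. zed p (klt x p) A (pr (s1 h0 0) 0) 0 h)"
      by (intro Df_zed kD A cf_pr cf_s1 cf_var cf_const)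
  next
    fix h X h' assume a: "valid h" "fin X" "valid h'" "le X h' h" "I 0 (s1 h' 0)"
    have "A (pr (s1 h' 0) 0) (s1 h' 0)" by (rule root_in_hier[OF lc a(5) A])
    then obtain Y where Y: "fin Y" "noext Y h' (zed p (klt x p) A (pr (s1 h' 0) 0) 0)"
      using hier_s1[OF A kD] by blast
    have "noext (X \<union> Y) h' (zed p (klt x p) A (pr (s1 h' 0) 0) 0)"
      using noext_mono[OF Y(2) le_refl] by blast
    then show "\<exists>h'' X'' h0. valid h'' \<and> fin X'' \<and> X \<subseteq> X'' \<and> le X h'' h \<and> I 0 (s1 h0 0) \<and>
       noext X'' h'' (\<lambda>h''. zed p (klt x p) A (pr (s1 h0 0) 0) 0 h'')"
      using a fin_Un[OF a(2) Y(1)] by blast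
  next
    fix h X assume "(h, X) \<in> G" "noext X h (\<lambda>h. I 0 (s1 h 0))"
    then show thesis using clash[OF TI mI] by blast
  next
    fix h X h0 assume "(h, X) \<in> G" "I 0 (s1 h0 0)"
      "noext X h (\<lambda>h. zed p (klt x p) A (pr (s1 h0 0) 0) 0 h)"
    then show thesis using that[OF lc, of 0 "s1 h0 0"] unfolding meets_def by blast
  qed
qed

text \<open>The model can pick a least index \<open>b\<close> that is reachable below a given
  condition, and a further condition forces that \<open>n\<close> is met at \<open>b\<close> and
  refused at everything smaller. Were \<open>b\<close> in the ill-founded part, some smaller element
  of \<open>r\<close> would be refused at indices of that part, although by induction it is met at
  an accessible, hence smaller, index.\<close>

lemma ex_accessible:
  assumes A: "hier p (klt x p) A" "Df2 A" and I: "least_closed p I" "I b0 s0"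
    and root: "meets (klt x p) A (pr s0 0) 0"
  shows "n = 0 \<or> rlt n 0 \<Longrightarrow> \<exists>b. node p s0 b \<and> meets (klt x p) A b n \<and> Wellfounded.accp (klt x p) b"
proof (induction n rule: rlt_induct)
  case (1 n)
  have kD: "Df2 (klt x p)" by (intro Df_comp cb_klt cf_var)
  have l0: "lenc 0 = 0" by (simp add: lenc_def)
  have nroot: "node p s0 (pr s0 0)" by (simp add: node_def tre_def l0)
  have nodeI: "node p s0 b'" if "klt x p b' b" "node p s0 b" for b b'
    using that by (auto simp: klt_def node_def)
  note AA = A kD
  let ?R = "klt x p"
  have nD: "cf x f \<Longrightarrow> Df (\<lambda>_ e. node p s0 (f e))" for f
    unfolding node_def by (intro Df_comp cb_conj cb_eq cb_tre cf_fs cf_sn cf_const)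
  obtain b1 where b1: "node p s0 b1" "meets ?R A b1 n"
  proof (cases "n = 0")
    case True
    then show ?thesis using that[OF nroot] root by blast
  next
    case False
    then have "rlt n 0" using "1.prems" by blast
    from meets_below[OF AA _ root this] klt_trans obtain b' where "?R b' (pr s0 0)" "meets ?R A b' n" by blast
    then show ?thesis using that nodeI nroot by blast
  qed
  show ?case
  proof (rule generic[of "\<lambda>h. \<exists>b. node p s0 b \<and> A b (s1 h n)" "\<lambda>h b. node p s0 b"
        "\<lambda>h b. zed p ?R A b n h \<or> lth ?R A b (s1 h n)"])
    show "Df (\<lambda>_ e. \<exists>b. node p s0 b \<and> A b (s1 (e 0) n))"
      by (intro Df_ex Df_conj nD Df_app2[of "\<lambda>_. A", OF A(2)] cf_s1 cf_var cf_const)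
    show "Df2 (\<lambda>h b. node p s0 b)" by (intro nD cf_var)
    show "Df2 (\<lambda>h b. zed p ?R A b n h \<or> lth ?R A b (s1 h n))"
      by (intro Df_disj Df_zed Df_lth kD A cf_s1 cf_var cf_const)
  next
    fix h X h' assume a: "valid h" "fin X" "valid h'" "le X h' h" "\<exists>b. node p s0 b \<and> A b (s1 h' n)"
    \<comment> \<open>A finite set of reals is the set of columns of one real, so it can serve as a
      parameter of the definable set \<open>S\<close>.\<close>
    obtain k z where z: "z \<in> RR" "X = secs k z" using ex_secs[OF a(2)] by blast
    define S where "S b \<longleftrightarrow> (\<exists>h'. valid h' \<and> le X h' h \<and> A b (s1 h' n))" for b
    have "Df (\<lambda>z e. le (secs k z) (e 0) h)" by (intro Df_le cf_const cf_var)
    from Df_inst[OF this z(1)] have lD: "Df (\<lambda>_ e. le X (e 0) h)" by (simp add: z(2))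
    have SD: "Df (\<lambda>_ e. S (e 0))"
      unfolding S_def
      by (intro Df_ex Df_conj lD Df_comp[OF cb_valid] Df_app2[of "\<lambda>_. A", OF A(2)] cf_s1 cf_var cf_const)
    obtain c where "node p s0 c" "S c" using a unfolding S_def by blast
    from node_wf[OF I SD this(2,1)] obtain b where b: "S b" "node p s0 b" "\<And>b'. ?R b' b \<Longrightarrow> \<not> S b'" by blast
    from b(1) obtain h1 where h1: "valid h1" "le X h1 h" "A b (s1 h1 n)" unfolding S_def by blast
    then obtain Y where Y: "fin Y" "noext Y h1 (zed p ?R A b n)" using hier_s1[OF AA] by blast
    have "noext (X \<union> Y) h1 (zed p ?R A b n)" using noext_mono[OF Y(2) le_refl] by blast
    moreover have "noext (X \<union> Y) h1 (\<lambda>h'. lth ?R A b (s1 h' n))"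
      unfolding noext_def
    proof (intro allI impI notI)
      fix h2 assume h2: "valid h2 \<and> le (X \<union> Y) h2 h1" and l: "lth ?R A b (s1 h2 n)"
      then have "le X h2 h" using le_trans[OF h1(2), of "X \<union> Y" h2] by blast
      then show False using l h2 b(3) unfolding lth_def S_def by blast
    qed
    ultimately have "noext (X \<union> Y) h1 (\<lambda>h. zed p ?R A b n h \<or> lth ?R A b (s1 h n))"
      unfolding noext_def by blast
    then show "\<exists>h'' X'' b. valid h'' \<and> fin X'' \<and> X \<subseteq> X'' \<and> le X h'' h \<and> node p s0 b \<and>
        noext X'' h'' (\<lambda>h. zed p ?R A b n h \<or> lth ?R A b (s1 h n))"
      using h1 b(2) fin_Un[OF a(2) Y(1)] by blast
  next
    fix h X assume "(h, X) \<in> G" "noext X h (\<lambda>h. \<exists>b. node p s0 b \<and> A b (s1 h n))"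
    from clash[OF AA b1(2) this] b1(1) show ?thesis by blast
  next
    fix h X b
    assume hX: "(h, X) \<in> G" and b: "node p s0 b"
      and no: "noext X h (\<lambda>h. zed p ?R A b n h \<or> lth ?R A b (s1 h n))"
    have "meets ?R A b n" using hX no unfolding meets_def noext_def by blast
    show ?thesis
    proof (cases "Wellfounded.accp ?R b")
      case True
      then show ?thesis using b \<open>meets ?R A b n\<close> by blast
    next
      case False
      \<comment> \<open>The ill-founded part has no least element. Two steps into it are taken: one
        because \<open>A\<close> is refused only strictly before \<open>b\<close>, one because
        \<open>descend\<close> asks for an index below \<open>c\<close>.\<close>
      then obtain c where c: "?R c b" "\<not> Wellfounded.accp ?R c" using accp.intros by metis
      then obtain d where d: "?R d c" "\<not> Wellfounded.accp ?R d" using accp.intros by metis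
      have "noext X h (\<lambda>h. A c (s1 h n))" using no c(1) unfolding noext_def lth_def by blast
      from descend[OF AA d(1) hX this] obtain m h' X' where
        m: "rlt m n" "(h', X') \<in> G" "noext X' h' (\<lambda>h'. lth ?R A d (s1 h' m))" by blast
      from "1.IH"[OF m(1)] rlt_dom[OF m(1)] obtain e where
        e: "node p s0 e" "meets ?R A e m" "Wellfounded.accp ?R e" by blast
      have nd: "node p s0 d" using nodeI c d b by blast
      \<comment> \<open>An accessible element cannot lie above an inaccessible one, and the nodes of
        one tree are linearly ordered.\<close>
      have "?R e d"
      proof (rule ccontr)
        assume "\<not> ?R e d"
        moreover have "e \<noteq> d" using e(3) d(2) by blast
        ultimately have "?R d e" using klt_total[of e d x p] e(1) nd by (auto simp: node_def)
        then show False using accp_downward[OF e(3)] d(2) by blast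
      qed
      then have "lth ?R A d (s1 h' m)" if "A e (s1 h' m)" for h' using that unfolding lth_def by blast
      from clash[OF AA e(2) m(2,3) this] show ?thesis by blast
    qed
  qed
qed

theorem presentable_generic:
  assumes "has_type r \<alpha>"
  shows "presentable x \<alpha>"
proof -
  let ?R = "klt x p"
  have kD: "Df2 ?R" by (intro Df_comp cb_klt cf_var)
  obtain A where A: "Df2 A" "hier p ?R A"
    by (rule ex_hier[OF kD, of p]) (rule that; assumption)
  note AA = A(2,1) kD
  obtain I b0 s0 where I: "least_closed p I" "I b0 s0" "meets ?R A (pr s0 0) 0"
    by (rule ex_root[OF A(2,1)])
  obtain b where b: "node p s0 b" "meets ?R A b 0" "Wellfounded.accp ?R b"
    using ex_accessible[OF A(2,1) I, of 0] by blast
  \<comment> \<open>Cutting strictly below \<open>b\<close> leaves only accessible elements; the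
    formal top is met at \<open>b\<close>, so every element of \<open>r\<close> finds an index in
    \<open>K\<close>.\<close>
  define K where "K = {(c, d). (?R c d \<or> c = d) \<and> ?R c b \<and> ?R d b}"
  have FK: "Field K = {c. ?R c b}" unfolding K_def Field_def by auto
  have nb: "fs c = s0 \<and> tre x p s0 (sn c)" if "?R c b" for c
    using that b(1) by (auto simp: klt_def node_def)
  have wfK: "wf (K - Id)"
  proof (rule wfUNIVI)
    fix P :: "nat \<Rightarrow> bool" and c
    assume hyp: "\<forall>c. (\<forall>d. (d, c) \<in> K - Id \<longrightarrow> P d) \<longrightarrow> P c"
    have acc: "P c" if "Wellfounded.accp ?R c" for c
      using that
    proof (induction c rule: accp_induct_rule)
      case (1 c)
      have "P d" if "(d, c) \<in> K - Id" for d using that 1 unfolding K_def by auto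
      then show ?case using hyp by blast
    qed
    show "P c"
    proof (cases "?R c b")
      case True
      then show ?thesis using acc accp_downward[OF b(3)] by blast
    next
      case False
      then have "\<forall>d. (d, c) \<notin> K" unfolding K_def by auto
      then show ?thesis using hyp by blast
    qed
  qed
  have "refl_on (Field K) K" unfolding refl_on_def FK by (auto simp: K_def)
  moreover have "trans K" unfolding trans_def K_def using klt_trans by blast
  moreover have "antisym K" unfolding antisym_def K_def using klt_trans klt_irrefl by blast
  moreover have "total_on (Field K) K"
    unfolding total_on_def FK
  proof (intro ballI impI)
    fix c d assume "c \<in> {c. ?R c b}" "d \<in> {c. ?R c b}" "c \<noteq> d"
    then show "(c, d) \<in> K \<or> (d, c) \<in> K"
      using klt_total[of c d x p] nb[of c] nb[of d] by (auto simp: K_def)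
  qed
  ultimately have K: "Well_order K"
    using wfK by (auto simp: order_on_defs well_order_on_def Field_def)
  have Kc: "computable_rel x K"
  proof (rule computable_relI)
    have "cb x (\<lambda>e. (?R (e 0) (e 1) \<or> e 0 = e 1) \<and> ?R (e 0) b \<and> ?R (e 1) b)"
      by (intro cb_conj cb_disj cb_klt cb_eq cf_var cf_const)
    then show "cb x (\<lambda>e. (e 0, e 1) \<in> K)" by (rule cb_cong) (simp add: K_def)
  qed
  \<comment> \<open>\<open>Suc m\<close>, because elements of \<open>r\<close> are shifted by one in
    the game.\<close>
  define W where "W m = {c. ?R c b \<and> meets ?R A c (Suc m)}" for m
  have Wne: "\<exists>c. c \<in> W m" if "m \<in> Field r" for m
  proof -
    have "refl_on (Field r) r" using r_wo by (simp add: order_on_defs)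
    then have "rlt (Suc m) 0" using that by (simp add: rlt_def refl_on_def)
    from meets_below[OF AA _ b(2) this] klt_trans show ?thesis unfolding W_def by blast
  qed
  \<comment> \<open>The least index is taken outside the model, where \<open>K\<close> is
    well-founded; the resulting map need not belong to the model.\<close>
  define \<rho> where "\<rho> m = (SOME c. c \<in> W m \<and> (\<forall>d. ?R d c \<longrightarrow> d \<notin> W m))" for m
  have \<rho>: "\<rho> m \<in> W m \<and> (\<forall>d. ?R d (\<rho> m) \<longrightarrow> d \<notin> W m)" if m: "m \<in> Field r" for m
  proof -
    obtain c where c: "c \<in> W m" using Wne[OF m] by blast
    obtain c' where c': "c' \<in> W m" "\<And>d. (d, c') \<in> K - Id \<Longrightarrow> d \<notin> W m"
      using wfE_min[OF wfK c] by metis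
    have "d \<notin> W m" if "?R d c'" for d
    proof
      assume "d \<in> W m"
      then have "(d, c') \<in> K - Id" using that c'(1) klt_irrefl unfolding K_def W_def by auto
      then show False using c'(2) \<open>d \<in> W m\<close> by blast
    qed
    with c'(1) have "c' \<in> W m \<and> (\<forall>d. ?R d c' \<longrightarrow> d \<notin> W m)" by blast
    then show ?thesis unfolding \<rho>_def by (rule someI)
  qed
  have "r \<le>o K"
  proof (rule ordLeq_if_strict_mono[OF r_wo K, of \<rho>])
    show "\<rho> a \<in> Field K" if "a \<in> Field r" for a
      using \<rho>[OF that] unfolding FK W_def by blast
    fix a c assume ac: "(a, c) \<in> r" "a \<noteq> c"
    then have F: "a \<in> Field r" "c \<in> Field r" by (auto simp: Field_def)
    have a: "\<rho> a \<in> W a" "\<And>d. ?R d (\<rho> a) \<Longrightarrow> d \<notin> W a" using \<rho>[OF F(1)] by blast+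
    have c: "?R (\<rho> c) b" "meets ?R A (\<rho> c) (Suc c)" using \<rho>[OF F(2)] unfolding W_def by blast+
    have "rlt (Suc a) (Suc c)" using ac by (simp add: rlt_def)
    from meets_below[OF AA _ c(2) this] klt_trans obtain d where
      d: "?R d (\<rho> c)" "meets ?R A d (Suc a)" by blast
    have db: "?R d b" using klt_trans[OF d(1) c(1)] .
    then have "d \<in> W a" using d(2) unfolding W_def by blast
    then have "\<not> ?R d (\<rho> a)" using a(2) by blast
    then have "\<rho> a = d \<or> ?R (\<rho> a) d"
      using klt_total[of "\<rho> a" d x p] nb[OF db] nb[of "\<rho> a"] a(1) unfolding W_def by auto
    then have "?R (\<rho> a) (\<rho> c)" using d(1) klt_trans by blast
    then show "(\<rho> a, \<rho> c) \<in> K \<and> \<rho> a \<noteq> \<rho> c"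
      using a(1) c(1) klt_irrefl unfolding K_def W_def by auto
  qed
  from presentable_if_ordLeq[OF r_wo assms K Kc this] show ?thesis .
qed

end

section \<open>Definable predicates, finite sets and natural numbers in a model of ZF\<close>

section \<open>Definability over a model of set theory\<close>

primrec bnd :: "fm \<Rightarrow> nat" where
  "bnd (FMem i j) = Suc (max i j)"
| "bnd (FEq i j) = Suc (max i j)"
| "bnd (FNeg \<phi>) = bnd \<phi>"
| "bnd (FConj \<phi> \<psi>) = max (bnd \<phi>) (bnd \<psi>)"
| "bnd (FAll i \<phi>) = max (Suc i) (bnd \<phi>)"

lemma sat_agree: "(\<And>i. i < bnd \<phi> \<Longrightarrow> e i = e' i) \<Longrightarrow> sat M E \<phi> e \<longleftrightarrow> sat M E \<phi> e'"
proof (induction \<phi> arbitrary: e e')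
  case (FNeg \<phi>)
  have "sat M E \<phi> e \<longleftrightarrow> sat M E \<phi> e'" by (rule FNeg.IH) (use FNeg.prems in simp)
  then show ?case by simp
next
  case (FConj \<phi> \<psi>)
  have "sat M E \<phi> e \<longleftrightarrow> sat M E \<phi> e'" by (rule FConj.IH(1)) (use FConj.prems in simp)
  moreover have "sat M E \<psi> e \<longleftrightarrow> sat M E \<psi> e'" by (rule FConj.IH(2)) (use FConj.prems in simp)
  ultimately show ?case by simp
next
  case (FAll i \<phi>)
  have "sat M E \<phi> (e(i := a)) \<longleftrightarrow> sat M E \<phi> (e'(i := a))" for a
    by (rule FAll.IH) (use FAll.prems in auto)
  then show ?case by simp
qed simp_all

text \<open>To avoid capture, the bound variable is renamed beyond all values of \<open>f\<close> on
  the variables of the body, for which their sum is a crude bound.\<close>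

primrec ren :: "fm \<Rightarrow> (nat \<Rightarrow> nat) \<Rightarrow> fm" where
  "ren (FMem i j) f = FMem (f i) (f j)"
| "ren (FEq i j) f = FEq (f i) (f j)"
| "ren (FNeg \<phi>) f = FNeg (ren \<phi> f)"
| "ren (FConj \<phi> \<psi>) f = FConj (ren \<phi> f) (ren \<psi> f)"
| "ren (FAll i \<phi>) f = FAll (Suc (\<Sum>j<bnd \<phi>. f j)) (ren \<phi> (f(i := Suc (\<Sum>j<bnd \<phi>. f j))))"

lemma sat_ren: "sat M E (ren \<phi> f) e \<longleftrightarrow> sat M E \<phi> (\<lambda>i. e (f i))"
proof (induction \<phi> arbitrary: f e)
  case (FAll i \<phi>)
  let ?k = "Suc (\<Sum>j<bnd \<phi>. f j)"
  have "sat M E (ren \<phi> (f(i := ?k))) (e(?k := a)) \<longleftrightarrow> sat M E \<phi> ((\<lambda>i. e (f i))(i := a))" for a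
    unfolding FAll.IH
  proof (rule sat_agree)
    fix j assume "j < bnd \<phi>"
    then have "f j \<le> (\<Sum>j<bnd \<phi>. f j)" by (intro member_le_sum) auto
    then show "(e(?k := a)) ((f(i := ?k)) j) = ((\<lambda>i. e (f i))(i := a)) j" by auto
  qed
  then show ?case by simp
qed simp_all

text \<open>Even variables are read from the environment, odd ones hold the parameters.\<close>

definition mix :: "(nat \<Rightarrow> 'a) \<Rightarrow> (nat \<Rightarrow> 'a) \<Rightarrow> nat \<Rightarrow> 'a" where
  "mix e d = (\<lambda>i. if even i then e (i div 2) else d (i div 2))"

locale zfm =
  fixes M :: "'a set" and E :: "'a \<Rightarrow> 'a \<Rightarrow> bool"
  assumes ZF: "ZF_model M E" and omM: "omega_model M E"
begin

lemma extensionality: "a \<in> M \<Longrightarrow> b \<in> M \<Longrightarrow> (\<And>z. z \<in> M \<Longrightarrow> E z a \<longleftrightarrow> E z b) \<Longrightarrow> a = b"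
  using ZF[unfolded ZF_model_def, THEN conjunct1] by blast

lemma foundation: "a \<in> M \<Longrightarrow> z \<in> M \<Longrightarrow> E z a \<Longrightarrow> \<exists>z\<in>M. E z a \<and> (\<forall>y\<in>M. \<not> (E y z \<and> E y a))"
  using ZF[unfolded ZF_model_def, THEN conjunct2, THEN conjunct1] by blast

lemma pairing: "a \<in> M \<Longrightarrow> b \<in> M \<Longrightarrow> \<exists>c\<in>M. upair_in M E a b c"
  using ZF[unfolded ZF_model_def, THEN conjunct2, THEN conjunct2, THEN conjunct1] by blast

lemma union: "a \<in> M \<Longrightarrow> \<exists>u\<in>M. \<forall>z\<in>M. E z u \<longleftrightarrow> (\<exists>y\<in>M. E z y \<and> E y a)"
  using ZF[unfolded ZF_model_def, THEN conjunct2, THEN conjunct2, THEN conjunct2, THEN conjunct1] by blast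

lemma powerset: "a \<in> M \<Longrightarrow> \<exists>b\<in>M. \<forall>z\<in>M. E z b \<longleftrightarrow> subset_in M E z a"
  using ZF[unfolded ZF_model_def, THEN conjunct2, THEN conjunct2, THEN conjunct2, THEN conjunct2, THEN conjunct1] by blast

lemma infinity: "\<exists>i\<in>M. inductive_in M E i"
  using ZF[unfolded ZF_model_def, THEN conjunct2, THEN conjunct2, THEN conjunct2, THEN conjunct2, THEN conjunct2, THEN conjunct1] by blast

lemma separation: "range e \<subseteq> M \<Longrightarrow> a \<in> M \<Longrightarrow>
    \<exists>b\<in>M. \<forall>z\<in>M. E z b \<longleftrightarrow> E z a \<and> sat M E \<phi> (e(0 := z))"
  using ZF[unfolded ZF_model_def, THEN conjunct2, THEN conjunct2, THEN conjunct2, THEN conjunct2, THEN conjunct2, THEN conjunct2, THEN conjunct1] by meson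

lemma replacement:
  assumes "range e \<subseteq> M" "a \<in> M"
    and f: "\<And>u v v'. u \<in> M \<Longrightarrow> E u a \<Longrightarrow> v \<in> M \<Longrightarrow> v' \<in> M \<Longrightarrow> sat M E \<phi> (e(0 := u, 1 := v)) \<Longrightarrow>
       sat M E \<phi> (e(0 := u, 1 := v')) \<Longrightarrow> v = v'"
  shows "\<exists>b\<in>M. \<forall>v\<in>M. E v b \<longleftrightarrow> (\<exists>u\<in>M. E u a \<and> sat M E \<phi> (e(0 := u, 1 := v)))"
proof -
  have "\<forall>u\<in>M. E u a \<longrightarrow> (\<forall>v\<in>M. \<forall>v'\<in>M.
      sat M E \<phi> (e(0 := u, 1 := v)) \<and> sat M E \<phi> (e(0 := u, 1 := v')) \<longrightarrow> v = v')"
    by (intro ballI impI, elim conjE) (rule f)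
  with ZF[unfolded ZF_model_def, THEN conjunct2, THEN conjunct2, THEN conjunct2, THEN conjunct2,
      THEN conjunct2, THEN conjunct2, THEN conjunct2, THEN spec, THEN spec, THEN mp, OF assms(1),
      THEN bspec, OF assms(2), of \<phi>]
  show ?thesis by (rule mp)
qed

subsection \<open>Definable predicates of an environment\<close>

text \<open>Lets closure properties be proved for predicates, with formula and parameters hidden.
  Agreement is demanded only on environments in \<open>M\<close>, where separation and replacement
  evaluate formulas.\<close>

definition dfn :: "((nat \<Rightarrow> 'a) \<Rightarrow> bool) \<Rightarrow> bool" where
  "dfn P \<longleftrightarrow> (\<exists>\<phi> d. range d \<subseteq> M \<and> (\<forall>e. range e \<subseteq> M \<longrightarrow> (sat M E \<phi> (mix e d) \<longleftrightarrow> P e)))"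

lemma dfnI: "range d \<subseteq> M \<Longrightarrow> (\<And>e. range e \<subseteq> M \<Longrightarrow> sat M E \<phi> (mix e d) \<longleftrightarrow> P e) \<Longrightarrow> dfn P"
  unfolding dfn_def by (intro exI[of _ \<phi>] exI[of _ d]) simp

lemma dfnE:
  assumes "dfn P"
  obtains \<phi> d where "range d \<subseteq> M" "\<And>e. range e \<subseteq> M \<Longrightarrow> sat M E \<phi> (mix e d) \<longleftrightarrow> P e"
proof -
  from assms[unfolded dfn_def] show ?thesis
  proof (elim exE conjE)
    fix \<phi> d assume "range d \<subseteq> M" "\<forall>e. range e \<subseteq> M \<longrightarrow> sat M E \<phi> (mix e d) \<longleftrightarrow> P e"
    then show ?thesis by (intro that[of d \<phi>]) simp_all
  qed
qed

lemma dfn_cong: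
  assumes "dfn P" "\<And>e. range e \<subseteq> M \<Longrightarrow> P e \<longleftrightarrow> Q e"
  shows "dfn Q"
proof -
  obtain \<phi> d where "range d \<subseteq> M" "\<And>e. range e \<subseteq> M \<Longrightarrow> sat M E \<phi> (mix e d) \<longleftrightarrow> P e"
    using assms(1) by (rule dfnE) (rule that; simp)
  then show ?thesis using assms(2) by (intro dfnI[of d \<phi>]) simp_all
qed

lemma M_ne: obtains m where "m \<in> M"
  using infinity by blast

lemma dfn_mem: "dfn (\<lambda>e. E (e i) (e j))"
proof -
  obtain m where "m \<in> M" by (rule M_ne)
  then show ?thesis by (intro dfnI[of "\<lambda>_. m" "FMem (2 * i) (2 * j)"]) (auto simp: mix_def)
qed

lemma dfn_eq: "dfn (\<lambda>e. e i = e j)"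
proof -
  obtain m where "m \<in> M" by (rule M_ne)
  then show ?thesis by (intro dfnI[of "\<lambda>_. m" "FEq (2 * i) (2 * j)"]) (auto simp: mix_def)
qed

lemma dfn_not: "dfn P \<Longrightarrow> dfn (\<lambda>e. \<not> P e)"
proof -
  assume "dfn P"
  then obtain \<phi> d where "range d \<subseteq> M" "\<And>e. range e \<subseteq> M \<Longrightarrow> sat M E \<phi> (mix e d) \<longleftrightarrow> P e"
    by (rule dfnE) (rule that; simp)
  then show ?thesis by (intro dfnI[of d "FNeg \<phi>"]) simp_all
qed

lemma dfn_conj: "dfn P \<Longrightarrow> dfn Q \<Longrightarrow> dfn (\<lambda>e. P e \<and> Q e)"
proof -
  assume a: "dfn P" "dfn Q"
  obtain \<phi> d where P: "range d \<subseteq> M" "\<And>e. range e \<subseteq> M \<Longrightarrow> sat M E \<phi> (mix e d) \<longleftrightarrow> P e"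
    using a(1) by (rule dfnE) (rule that; simp)
  obtain \<psi> c where Q: "range c \<subseteq> M" "\<And>e. range e \<subseteq> M \<Longrightarrow> sat M E \<psi> (mix e c) \<longleftrightarrow> Q e"
    using a(2) by (rule dfnE) (rule that; simp)
  \<comment> \<open>The parameters of both formulas are interleaved into one sequence;
    \<open>?f\<close> and \<open>?g\<close> find them again.\<close>
  let ?f = "\<lambda>i. if even i then i else Suc (2 * (2 * (i div 2)))"
  let ?g = "\<lambda>i. if even i then i else Suc (2 * Suc (2 * (i div 2)))"
  have f: "(\<lambda>i. mix e (mix d c) (?f i)) = mix e d" and g: "(\<lambda>i. mix e (mix d c) (?g i)) = mix e c" for e
    by (auto simp: mix_def fun_eq_iff elim!: oddE)
  have "range (mix d c) \<subseteq> M" using P(1) Q(1) by (simp add: mix_def image_subset_iff)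
  then show ?thesis
    by (intro dfnI[of "mix d c" "FConj (ren \<phi> ?f) (ren \<psi> ?g)"]) (simp_all add: sat_ren f g P Q)
qed

lemma dfn_ren: "dfn P \<Longrightarrow> dfn (\<lambda>e. P (\<lambda>i. e (v i)))"
proof -
  assume "dfn P"
  then obtain \<phi> d where P: "range d \<subseteq> M" "\<And>e. range e \<subseteq> M \<Longrightarrow> sat M E \<phi> (mix e d) \<longleftrightarrow> P e"
    by (rule dfnE) (rule that; simp)
  let ?f = "\<lambda>i. if even i then 2 * v (i div 2) else i"
  have f: "(\<lambda>i. mix e d (?f i)) = mix (\<lambda>i. e (v i)) d" for e
    by (auto simp: mix_def fun_eq_iff)
  have "sat M E \<phi> (mix (\<lambda>i. e (v i)) d) \<longleftrightarrow> P (\<lambda>i. e (v i))" if "range e \<subseteq> M" for e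
    using that by (intro P(2)) (simp add: image_subset_iff)
  then show ?thesis
    using P(1) by (intro dfnI[of d "ren \<phi> ?f"]) (simp_all add: sat_ren f)
qed

lemma range_case: "a \<in> M \<Longrightarrow> range e \<subseteq> M \<Longrightarrow> range (case_nat a e) \<subseteq> M"
  by (auto simp: image_subset_iff split: nat.split)

lemma dfn_all: "dfn (\<lambda>e. P (e 0) (sh e)) \<Longrightarrow> dfn (\<lambda>e. \<forall>a\<in>M. P a e)"
proof -
  assume "dfn (\<lambda>e. P (e 0) (sh e))"
  then obtain \<phi> d where P: "range d \<subseteq> M"
    "\<And>e. range e \<subseteq> M \<Longrightarrow> sat M E \<phi> (mix e d) \<longleftrightarrow> P (e 0) (sh e)"
    by (rule dfnE) (rule that; simp)
  \<comment> \<open>An even number beyond all variables of the formula is a fresh slot for the bound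
    variable; the other even variables move down to close the gap.\<close>
  define k where "k = 2 * bnd \<phi>"
  let ?f = "\<lambda>i. if i = 0 then k else if even i then i - 2 else i"
  have "sat M E (ren \<phi> ?f) ((mix e d)(k := a)) \<longleftrightarrow> P a e" if "a \<in> M" "range e \<subseteq> M" for e a
  proof -
    have "sat M E (ren \<phi> ?f) ((mix e d)(k := a)) \<longleftrightarrow> sat M E \<phi> (mix (case_nat a e) d)"
      unfolding sat_ren
    proof (rule sat_agree)
      fix i assume i: "i < bnd \<phi>"
      show "((mix e d)(k := a)) (?f i) = mix (case_nat a e) d i"
      proof (cases "even i")
        case True
        then obtain n where n: "i = 2 * n" by blast
        then show ?thesis using i by (cases n) (auto simp: mix_def k_def)
      next
        case False
        then have "i \<noteq> k" by (auto simp: k_def)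
        then show ?thesis using False by (auto simp: mix_def elim: oddE)
      qed
    qed
    also have "\<dots> \<longleftrightarrow> P a e" using P(2)[OF range_case[OF that]] by simp
    finally show ?thesis .
  qed
  then show ?thesis
    using P(1) by (intro dfnI[of d "FAll k (ren \<phi> ?f)"]) simp_all
qed

lemma dfn_inst: "dfn (\<lambda>e. P (e 0) (sh e)) \<Longrightarrow> a \<in> M \<Longrightarrow> dfn (\<lambda>e. P a e)"
proof -
  assume D: "dfn (\<lambda>e. P (e 0) (sh e))" and a: "a \<in> M"
  from D obtain \<phi> d where P: "range d \<subseteq> M"
    "\<And>e. range e \<subseteq> M \<Longrightarrow> sat M E \<phi> (mix e d) \<longleftrightarrow> P (e 0) (sh e)"
    by (rule dfnE) (rule that; simp)
  \<comment> \<open>Variable \<open>0\<close> becomes the first parameter slot \<open>1\<close>, and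
    the old parameters move up.\<close>
  let ?f = "\<lambda>i. if i = 0 then 1 else if even i then i - 2 else i + 2"
  have f: "(\<lambda>i. mix e (case_nat a d) (?f i)) = mix (case_nat a e) d" for e
  proof
    fix i
    show "mix e (case_nat a d) (?f i) = mix (case_nat a e) d i"
    proof (cases "even i")
      case True
      then obtain n where n: "i = 2 * n" by blast
      then show ?thesis by (cases n) (auto simp: mix_def)
    next
      case False
      then show ?thesis by (auto simp: mix_def elim!: oddE)
    qed
  qed
  have "range (case_nat a d) \<subseteq> M" using a P(1) by (rule range_case)
  moreover have "sat M E (ren \<phi> ?f) (mix e (case_nat a d)) \<longleftrightarrow> P a e" if "range e \<subseteq> M" for e
    unfolding sat_ren f using P(2)[OF range_case[OF a that]] by simp
  ultimately show ?thesis by (rule dfnI)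
qed

lemma dfn_disj: "dfn P \<Longrightarrow> dfn Q \<Longrightarrow> dfn (\<lambda>e. P e \<or> Q e)"
  by (rule dfn_cong[OF dfn_not[OF dfn_conj[OF dfn_not dfn_not]]]) auto

lemma dfn_imp: "dfn P \<Longrightarrow> dfn Q \<Longrightarrow> dfn (\<lambda>e. P e \<longrightarrow> Q e)"
  by (rule dfn_cong[OF dfn_disj[OF dfn_not]]) auto

lemma dfn_iff: "dfn P \<Longrightarrow> dfn Q \<Longrightarrow> dfn (\<lambda>e. P e \<longleftrightarrow> Q e)"
  by (rule dfn_cong[OF dfn_conj[OF dfn_imp dfn_imp, of P Q Q P]]) auto

lemma dfn_ex: "dfn (\<lambda>e. P (e 0) (sh e)) \<Longrightarrow> dfn (\<lambda>e. \<exists>a\<in>M. P a e)"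
  by (rule dfn_cong[OF dfn_not[OF dfn_all[of "\<lambda>a e. \<not> P a e", OF dfn_not]]]) auto

lemma dfn_const: "dfn (\<lambda>e. b)"
proof (cases b)
  case True
  then show ?thesis by (intro dfn_cong[OF dfn_eq[of 0 0]]) simp
next
  case False
  then show ?thesis by (intro dfn_cong[OF dfn_not[OF dfn_eq[of 0 0]]]) simp
qed

lemma dfn_inM: "dfn (\<lambda>e. e i \<in> M)"
  by (rule dfn_cong[OF dfn_const[of True]]) (simp add: image_subset_iff)

lemma dfn_mem_const: "a \<in> M \<Longrightarrow> dfn (\<lambda>e. E (e i) a)"
  using dfn_inst[of "\<lambda>a e. E (e i) a", OF dfn_mem] .

lemma dfn_eq_const: "a \<in> M \<Longrightarrow> dfn (\<lambda>e. e i = a)"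
  using dfn_inst[of "\<lambda>a e. e i = a", OF dfn_eq] .

lemmas dfn_logic = dfn_conj dfn_disj dfn_imp dfn_iff dfn_not dfn_all dfn_ex dfn_mem dfn_eq dfn_inM

lemma dfn_separation:
  assumes Q: "dfn (\<lambda>e. Q (e 0))" and a: "a \<in> M"
  shows "\<exists>b\<in>M. \<forall>z\<in>M. E z b \<longleftrightarrow> E z a \<and> Q z"
proof -
  obtain \<phi> d where P: "range d \<subseteq> M" "\<And>e. range e \<subseteq> M \<Longrightarrow> sat M E \<phi> (mix e d) \<longleftrightarrow> Q (e 0)"
    using Q by (rule dfnE) (rule that; simp)
  let ?e = "mix (\<lambda>_. a) d"
  have "range ?e \<subseteq> M" using P(1) a by (simp add: mix_def image_subset_iff)
  from separation[OF this a, of \<phi>] obtain b where b: "b \<in> M"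
    "\<And>z. z \<in> M \<Longrightarrow> E z b \<longleftrightarrow> E z a \<and> sat M E \<phi> (?e(0 := z))" by blast
  have "sat M E \<phi> (?e(0 := z)) \<longleftrightarrow> Q z" if "z \<in> M" for z
  proof -
    have "?e(0 := z) = mix ((\<lambda>_. a)(0 := z)) d" by (auto simp: mix_def fun_eq_iff elim!: evenE)
    moreover have "range ((\<lambda>_. a)(0 := z)) \<subseteq> M" using a that by auto
    note P(2)[OF this]
    ultimately show ?thesis by simp
  qed
  then show ?thesis using b by blast
qed

lemma dfn_replacement:
  assumes Q: "dfn (\<lambda>e. Q (e 0) (e 1))" and a: "a \<in> M"
    and f: "\<And>u v v'. u \<in> M \<Longrightarrow> E u a \<Longrightarrow> v \<in> M \<Longrightarrow> v' \<in> M \<Longrightarrow> Q u v \<Longrightarrow> Q u v' \<Longrightarrow> v = v'"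
  shows "\<exists>b\<in>M. \<forall>v\<in>M. E v b \<longleftrightarrow> (\<exists>u\<in>M. E u a \<and> Q u v)"
proof -
  obtain \<phi> d where P: "range d \<subseteq> M" "\<And>e. range e \<subseteq> M \<Longrightarrow> sat M E \<phi> (mix e d) \<longleftrightarrow> Q (e 0) (e 1)"
    using Q by (rule dfnE) (rule that; simp)
  \<comment> \<open>Replacement reserves the variables \<open>0\<close> and \<open>1\<close> for
    argument and value, so the parameters are moved to the even positions from \<open>2\<close>
    on.\<close>
  let ?f = "\<lambda>i. if odd i then Suc i else if i = 2 then 1 else 0"
  let ?e = "\<lambda>i. d (i div 2 - 1)"
  have "sat M E (ren \<phi> ?f) (?e(0 := u, 1 := v)) \<longleftrightarrow> Q u v" if "u \<in> M" "v \<in> M" for u v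
  proof -
    have "(\<lambda>i. (?e(0 := u, 1 := v)) (?f i)) = mix (\<lambda>i. if i = 1 then v else u) d"
    proof
      fix i
      show "(?e(0 := u, 1 := v)) (?f i) = mix (\<lambda>i. if i = 1 then v else u) d i"
        by (cases "odd i") (auto simp: mix_def elim!: oddE evenE)
    qed
    moreover have "range (\<lambda>i. if i = (1::nat) then v else u) \<subseteq> M" using that by auto
    note P(2)[OF this]
    ultimately show ?thesis unfolding sat_ren by simp
  qed
  moreover have "range ?e \<subseteq> M" using P(1) by (simp add: image_subset_iff)
  ultimately show ?thesis
    using replacement[of ?e a "ren \<phi> ?f"] a f by simp
qed

end

context zfm
begin

lemma dfn_empty_in: "dfn (\<lambda>e. empty_in M E (e i))"
  unfolding empty_in_def by (intro dfn_logic)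
lemma dfn_succ_in: "dfn (\<lambda>e. succ_in M E (e i) (e j))"
  unfolding succ_in_def by (intro dfn_logic)
lemma dfn_inductive_in: "dfn (\<lambda>e. inductive_in M E (e i))"
  unfolding inductive_in_def by (intro dfn_logic dfn_empty_in dfn_succ_in)
lemma dfn_upair_in: "dfn (\<lambda>e. upair_in M E (e i) (e j) (e k))"
  unfolding upair_in_def by (intro dfn_logic)
lemma dfn_opair_in: "dfn (\<lambda>e. opair_in M E (e i) (e j) (e k))"
  unfolding opair_in_def by (intro dfn_logic dfn_upair_in)

subsection \<open>Finite sets and pairs\<close>

definition el :: "'a \<Rightarrow> 'a set" where "el a = {z \<in> M. E z a}"

definition mk :: "'a set \<Rightarrow> 'a" where "mk S = (SOME a. a \<in> M \<and> el a = S)"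

lemma el_inject: "a \<in> M \<Longrightarrow> b \<in> M \<Longrightarrow> el a = el b \<longleftrightarrow> a = b"
  using extensionality[of a b] unfolding el_def by blast

text \<open>The induction takes place outside \<open>M\<close>: a truly finite set is reached by
  finitely many uses of pairing and union.\<close>

lemma ex_fin_set: "finite S \<Longrightarrow> S \<subseteq> M \<Longrightarrow> \<exists>a\<in>M. el a = S"
proof (induction S rule: finite_induct)
  case empty
  obtain i where "i \<in> M" "inductive_in M E i" using infinity by blast
  then obtain a where "a \<in> M" "empty_in M E a" unfolding inductive_in_def by blast
  then show ?case unfolding empty_in_def el_def by blast
next
  case (insert z S)
  then obtain a where a: "a \<in> M" "el a = S" by blast
  have z: "z \<in> M" using insert.prems by blast
  obtain c where c: "c \<in> M" "upair_in M E z z c" using pairing[OF z z] by blast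
  obtain d where d: "d \<in> M" "upair_in M E a c d" using pairing[OF a(1) c(1)] by blast
  obtain u where u: "u \<in> M" "\<forall>v\<in>M. E v u \<longleftrightarrow> (\<exists>y\<in>M. E v y \<and> E y d)" using union[OF d(1)] by blast
  have "E v u \<longleftrightarrow> E v a \<or> v = z" if "v \<in> M" for v
  proof -
    have "E v u \<longleftrightarrow> (\<exists>y\<in>M. E v y \<and> E y d)" using u(2) that by blast
    also have "\<dots> \<longleftrightarrow> E v a \<or> E v c" using d a(1) c(1) unfolding upair_in_def by auto
    also have "\<dots> \<longleftrightarrow> E v a \<or> v = z" using c that unfolding upair_in_def by auto
    finally show ?thesis .
  qed
  then have "el u = insert z (el a)" using z unfolding el_def by blast
  then show ?case using u(1) a(2) by blast
qed

lemma mk: "finite S \<Longrightarrow> S \<subseteq> M \<Longrightarrow> mk S \<in> M \<and> el (mk S) = S"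
  unfolding mk_def by (rule someI_ex) (use ex_fin_set in blast)

lemma mk_in: "finite S \<Longrightarrow> S \<subseteq> M \<Longrightarrow> mk S \<in> M" and el_mk: "finite S \<Longrightarrow> S \<subseteq> M \<Longrightarrow> el (mk S) = S"
  using mk by blast+

lemma mk_eqI: "a \<in> M \<Longrightarrow> finite (el a) \<Longrightarrow> a = mk (el a)"
  using mk[of "el a"] el_inject[of a "mk (el a)"] unfolding el_def by blast

definition op :: "'a \<Rightarrow> 'a \<Rightarrow> 'a" where "op a b = mk {mk {a}, mk {a, b}}"

lemma upair_iff: "a \<in> M \<Longrightarrow> b \<in> M \<Longrightarrow> c \<in> M \<Longrightarrow> upair_in M E a b c \<longleftrightarrow> c = mk {a, b}"
proof -
  assume a: "a \<in> M" "b \<in> M" "c \<in> M"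
  then have "mk {a, b} \<in> M" "el (mk {a, b}) = {a, b}" using mk[of "{a, b}"] by auto
  moreover have "upair_in M E a b c \<longleftrightarrow> el c = {a, b}"
    unfolding upair_in_def el_def using a by auto
  ultimately show ?thesis using el_inject[OF a(3), of "mk {a, b}"] by simp
qed

lemma op_in: "a \<in> M \<Longrightarrow> b \<in> M \<Longrightarrow> op a b \<in> M"
  unfolding op_def by (intro mk_in) (auto intro!: mk_in)

lemma opair_iff: "a \<in> M \<Longrightarrow> b \<in> M \<Longrightarrow> c \<in> M \<Longrightarrow> opair_in M E a b c \<longleftrightarrow> c = op a b"
proof -
  assume a: "a \<in> M" "b \<in> M" "c \<in> M"
  have m: "mk {a} \<in> M" "mk {a, b} \<in> M" using a by (auto intro!: mk_in)
  have 1: "upair_in M E a a u \<longleftrightarrow> u = mk {a}" if "u \<in> M" for u using upair_iff[of a a u] a that by simp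
  have 2: "upair_in M E a b u \<longleftrightarrow> u = mk {a, b}" if "u \<in> M" for u using upair_iff[of a b u] a that by simp
  have "opair_in M E a b c \<longleftrightarrow> upair_in M E (mk {a}) (mk {a, b}) c"
    unfolding opair_in_def using 1 2 m by auto
  then show ?thesis using upair_iff[OF m a(3)] unfolding op_def by simp
qed

lemma mk_inject: "finite S \<Longrightarrow> S \<subseteq> M \<Longrightarrow> finite T \<Longrightarrow> T \<subseteq> M \<Longrightarrow> mk S = mk T \<longleftrightarrow> S = T"
  using el_mk[of S] el_mk[of T] by metis

lemma op_inject: "a \<in> M \<Longrightarrow> b \<in> M \<Longrightarrow> c \<in> M \<Longrightarrow> d \<in> M \<Longrightarrow> op a b = op c d \<longleftrightarrow> a = c \<and> b = d"
proof -
  assume a: "a \<in> M" "b \<in> M" "c \<in> M" "d \<in> M"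
  have m: "mk {a} \<in> M" "mk {a, b} \<in> M" "mk {c} \<in> M" "mk {c, d} \<in> M" using a by (auto intro!: mk_in)
  have "op a b = op c d \<longleftrightarrow> {mk {a}, mk {a, b}} = {mk {c}, mk {c, d}}"
    unfolding op_def using m by (intro mk_inject) auto
  also have "\<dots> \<longleftrightarrow> a = c \<and> b = d"
  proof
    assume *: "{mk {a}, mk {a, b}} = {mk {c}, mk {c, d}}"
    have i: "mk {a} = mk {c} \<longleftrightarrow> {a} = {c}" "mk {a} = mk {c, d} \<longleftrightarrow> {a} = {c, d}"
      "mk {a, b} = mk {c} \<longleftrightarrow> {a, b} = {c}" "mk {a, b} = mk {c, d} \<longleftrightarrow> {a, b} = {c, d}"
      using a by - (rule mk_inject; simp)+
    from * have "({a} = {c} \<and> {a, b} = {c, d}) \<or> ({a} = {c, d} \<and> {a, b} = {c})"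
      unfolding doubleton_eq_iff i .
    then show "a = c \<and> b = d" by (auto simp: doubleton_eq_iff)
  qed simp
  finally show ?thesis .
qed

lemma app_iff: "f \<in> M \<Longrightarrow> a \<in> M \<Longrightarrow> b \<in> M \<Longrightarrow> app_in M E f a b \<longleftrightarrow> E (op a b) f"
  unfolding app_in_def using opair_iff op_in by auto

lemma function_iff:
  assumes "f \<in> M" "a \<in> M" "b \<in> M"
  shows "function_in M E f a b \<longleftrightarrow> (\<exists>F. (\<forall>u\<in>el a. F u \<in> el b) \<and> el f = (\<lambda>u. op u (F u)) ` el a)"
proof
  assume fn: "function_in M E f a b"
  have ran: "\<exists>u v. u \<in> el a \<and> v \<in> el b \<and> q = op u v" if "q \<in> el f" for q
    using fn that opair_iff unfolding function_in_def el_def by blast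
  have ex1: "\<exists>!v. v \<in> M \<and> E (op u v) f" if u: "u \<in> el a" for u
  proof -
    have "\<exists>!v. v \<in> M \<and> app_in M E f u v" using fn u unfolding function_in_def el_def by blast
    moreover have "u \<in> M" using u by (simp add: el_def)
    ultimately show ?thesis using app_iff[OF assms(1)] by (metis (no_types, lifting))
  qed
  define F where "F u = (THE v. v \<in> M \<and> E (op u v) f)" for u
  have F: "F u \<in> M \<and> E (op u (F u)) f" if "u \<in> el a" for u
    unfolding F_def using theI'[OF ex1[OF that]] .
  have Fu: "v = F u" if "u \<in> el a" "v \<in> M" "E (op u v) f" for u v
    using ex1[OF that(1)] F[OF that(1)] that by blast
  have "F u \<in> el b" if u: "u \<in> el a" for u
  proof -
    have uM: "u \<in> M" using u by (simp add: el_def)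
    have "op u (F u) \<in> el f" using F[OF u] op_in[OF uM] unfolding el_def by blast
    then obtain u' v' where "u' \<in> el a" "v' \<in> el b" "op u (F u) = op u' v'" using ran by blast
    then show ?thesis using op_inject[OF uM, of "F u" u' v'] F[OF u] by (auto simp: el_def)
  qed
  moreover have "el f = (\<lambda>u. op u (F u)) ` el a"
  proof (intro equalityI subsetI)
    fix q assume q: "q \<in> el f"
    then obtain u v where uv: "u \<in> el a" "v \<in> el b" "q = op u v" using ran by blast
    then have "v = F u" using q by (intro Fu) (auto simp: el_def)
    then show "q \<in> (\<lambda>u. op u (F u)) ` el a" using uv by blast
  next
    fix q assume "q \<in> (\<lambda>u. op u (F u)) ` el a"
    then obtain u where u: "u \<in> el a" "q = op u (F u)" by blast
    then show "q \<in> el f" using F[OF u(1)] op_in[of u "F u"] unfolding el_def by auto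
  qed
  ultimately show "\<exists>F. (\<forall>u\<in>el a. F u \<in> el b) \<and> el f = (\<lambda>u. op u (F u)) ` el a" by blast
next
  assume "\<exists>F. (\<forall>u\<in>el a. F u \<in> el b) \<and> el f = (\<lambda>u. op u (F u)) ` el a"
  then obtain F where F: "\<And>u. u \<in> el a \<Longrightarrow> F u \<in> el b" "el f = (\<lambda>u. op u (F u)) ` el a" by blast
  have elM: "\<And>c u. u \<in> el c \<Longrightarrow> u \<in> M" by (simp add: el_def)
  show "function_in M E f a b"
    unfolding function_in_def
  proof (intro conjI ballI impI assms)
    fix q assume "q \<in> M" "E q f"
    then have "q \<in> el f" by (simp add: el_def)
    then obtain u where u: "u \<in> el a" "q = op u (F u)" using F(2) by blast
    then have "opair_in M E u (F u) q" using opair_iff elM F(1) op_in by metis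
    then show "\<exists>u\<in>M. \<exists>v\<in>M. E u a \<and> E v b \<and> opair_in M E u v q"
      using u(1) F(1)[OF u(1)] unfolding el_def by blast
  next
    fix u assume u: "u \<in> M" "E u a"
    then have ua: "u \<in> el a" by (simp add: el_def)
    have FM: "F u \<in> M" using F(1)[OF ua] elM by blast
    show "\<exists>!v. v \<in> M \<and> app_in M E f u v"
    proof (rule ex1I[of _ "F u"])
      have "op u (F u) \<in> el f" using F(2) ua by blast
      then show "F u \<in> M \<and> app_in M E f u (F u)" using FM app_iff[OF assms(1) u(1) FM] by (simp add: el_def)
    next
      fix v assume v: "v \<in> M \<and> app_in M E f u v"
      then have "op u v \<in> el f" using app_iff[OF assms(1) u(1), of v] op_in[OF u(1), of v] by (simp add: el_def)
      then obtain u' where "u' \<in> el a" "op u v = op u' (F u')" using F(2) by blast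
      then show "v = F u" using op_inject[OF u(1), of v u' "F u'"] v elM F(1) by metis
    qed
  qed
qed

subsection \<open>Natural numbers\<close>

text \<open>The least inductive set is cut out of any inductive one by separation; it is inductive
  because the empty set and successors are unique by extensionality, and so are shared by all
  inductive sets.\<close>

lemma ex_omega: "\<exists>w\<in>M. omega_in M E w"
proof -
  obtain i where i: "i \<in> M" "inductive_in M E i" using infinity by blast
  have "dfn (\<lambda>e. \<forall>j\<in>M. inductive_in M E j \<longrightarrow> E (e 0) j)"
    by (intro dfn_logic dfn_inductive_in)
  from dfn_separation[OF this i(1)] obtain w where
    w: "w \<in> M" "\<forall>z\<in>M. E z w \<longleftrightarrow> E z i \<and> (\<forall>j\<in>M. inductive_in M E j \<longrightarrow> E z j)" by blast
  have wj: "E z w \<longleftrightarrow> (\<forall>j\<in>M. inductive_in M E j \<longrightarrow> E z j)" if "z \<in> M" for z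
    using w(2) i that by blast
  have emp: "a = b" if "empty_in M E a" "empty_in M E b" for a b
    using that extensionality[of a b] unfolding empty_in_def by blast
  have suc: "b = c" if "succ_in M E a b" "succ_in M E a c" for a b c
    using that extensionality[of b c] unfolding succ_in_def by blast
  have "inductive_in M E w"
    unfolding inductive_in_def
  proof (intro conjI ballI impI)
    show "w \<in> M" by fact
    obtain a where a: "a \<in> M" "empty_in M E a" "E a i" using i(2) unfolding inductive_in_def by blast
    have "E a j" if j: "j \<in> M" "inductive_in M E j" for j
    proof -
      obtain a' where "a' \<in> M" "empty_in M E a'" "E a' j" using j(2) unfolding inductive_in_def by blast
      then show ?thesis using emp[OF a(2)] by blast
    qed
    then show "\<exists>a\<in>M. empty_in M E a \<and> E a w" using wj[OF a(1)] a by blast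
  next
    fix a assume a: "a \<in> M" "E a w"
    then have aj: "\<And>j. j \<in> M \<Longrightarrow> inductive_in M E j \<Longrightarrow> E a j" using wj by blast
    obtain b where b: "b \<in> M" "succ_in M E a b" "E b i"
      using i aj[OF i] a(1) unfolding inductive_in_def by blast
    have "E b j" if j: "j \<in> M" "inductive_in M E j" for j
    proof -
      obtain b' where "b' \<in> M" "succ_in M E a b'" "E b' j"
        using j(2) aj[OF j] a(1) unfolding inductive_in_def by blast
      then show ?thesis using suc[OF b(2)] by blast
    qed
    then show "\<exists>b\<in>M. succ_in M E a b \<and> E b w" using wj[OF b(1)] b by blast
  qed
  moreover have "subset_in M E w j" if "j \<in> M" "inductive_in M E j" for j
    unfolding subset_in_def using w(1) wj that by blast
  ultimately show ?thesis using w(1) unfolding omega_in_def by blast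
qed

definition om :: 'a where "om = (SOME w. w \<in> M \<and> omega_in M E w)"

lemma om: "om \<in> M" "omega_in M E om"
proof -
  have "om \<in> M \<and> omega_in M E om" unfolding om_def by (rule someI_ex) (use ex_omega in blast)
  then show "om \<in> M" "omega_in M E om" by blast+
qed

lemma omega_iff: "omega_in M E w \<longleftrightarrow> w = om"
proof
  assume w: "omega_in M E w"
  then have wM: "w \<in> M" "inductive_in M E w" unfolding omega_in_def inductive_in_def by blast+
  have "inductive_in M E om" using om unfolding omega_in_def by blast
  then have "subset_in M E w om" "subset_in M E om w" using w wM om unfolding omega_in_def by blast+
  then show "w = om" using extensionality[of w om] wM om unfolding subset_in_def by blast
qed (use om in simp)

primrec num :: "nat \<Rightarrow> 'a" where
  "num 0 = mk {}"
| "num (Suc n) = mk (insert (num n) (el (num n)))"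

lemma num_el: "num n \<in> M \<and> el (num n) = num ` {..<n}"
proof (induction n)
  case 0
  then show ?case using mk[of "{}"] by simp
next
  case (Suc n)
  then have "finite (insert (num n) (el (num n)))" "insert (num n) (el (num n)) \<subseteq> M"
    by (auto simp: el_def)
  from mk[OF this] Suc show ?case by (simp add: lessThan_Suc)
qed

declare num.simps [simp del]

lemma num_in[simp]: "num n \<in> M" and el_num: "el (num n) = num ` {..<n}"
  using num_el by blast+

lemma no_loop: "a \<in> M \<Longrightarrow> \<not> E a a"
proof
  assume a: "a \<in> M" "E a a"
  have m: "mk {a} \<in> M" "el (mk {a}) = {a}" using mk[of "{a}"] a by auto
  then have "E a (mk {a})" by (auto simp: el_def)
  from foundation[OF m(1) a(1) this] obtain z where "z \<in> el (mk {a})" "\<forall>y\<in>M. \<not> (E y z \<and> E y (mk {a}))"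
    unfolding el_def by blast
  then show False using m a \<open>E a (mk {a})\<close> by auto
qed

lemma num_less_neq: "m < n \<Longrightarrow> num m \<noteq> num n"
proof
  assume mn: "m < n" "num m = num n"
  then have "num m \<in> el (num n)" unfolding el_num by blast
  then show False using no_loop[of "num n"] mn by (simp add: el_def)
qed

lemma num_inject[simp]: "num m = num n \<longleftrightarrow> m = n"
  using num_less_neq by (metis linorder_neqE_nat)

lemma E_num[simp]: "E (num m) (num n) \<longleftrightarrow> m < n"
proof -
  have "E (num m) (num n) \<longleftrightarrow> num m \<in> el (num n)" by (simp add: el_def)
  then show ?thesis unfolding el_num by auto
qed

lemma empty_iff: "empty_in M E a \<longleftrightarrow> a = num 0"
proof -
  have "empty_in M E a \<longleftrightarrow> a \<in> M \<and> el a = el (num 0)"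
    unfolding el_num unfolding empty_in_def el_def by auto
  then show ?thesis using el_inject[of a "num 0"] num_in by metis
qed

lemma succ_iff: "succ_in M E (num n) b \<longleftrightarrow> b = num (Suc n)"
proof -
  have "succ_in M E (num n) b \<longleftrightarrow> b \<in> M \<and> el b = insert (num n) (el (num n))"
    unfolding succ_in_def el_def using num_in[of n] by auto
  also have "\<dots> \<longleftrightarrow> b \<in> M \<and> el b = el (num (Suc n))"
    by (simp only: el_num lessThan_Suc image_insert)
  finally show ?thesis using el_inject[of b "num (Suc n)"] num_in by metis
qed

lemma numeral_iff: "numeral_in M E n a \<longleftrightarrow> a = num n"
proof (induction n arbitrary: a)
  case 0
  then show ?case by (simp only: numeral_in.simps empty_iff)
next
  case (Suc n)
  then show ?case by (simp only: numeral_in.simps) (use succ_iff num_in in blast)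
qed

text \<open>The assumption that the natural numbers of \<open>M\<close> are the true ones enters
  here.\<close>

lemma el_om: "el om = range num"
proof (intro equalityI subsetI)
  fix a assume "a \<in> el om"
  then show "a \<in> range num"
    using om numeral_iff omM unfolding omega_model_def el_def by blast
next
  have ind: "inductive_in M E om" using om(2) unfolding omega_in_def by (rule conjunct1)
  have "E (num n) om" for n
  proof (induction n)
    case 0
    from ind obtain a where "empty_in M E a" "E a om" unfolding inductive_in_def by blast
    then show ?case unfolding empty_iff by simp
  next
    case (Suc n)
    with ind obtain b where "succ_in M E (num n) b" "E b om"
      unfolding inductive_in_def using num_in[of n] by blast
    then show ?case unfolding succ_iff by simp
  qed
  then show "a \<in> el om" if "a \<in> range num" for a using that by (auto simp: el_def)
qed

end

section \<open>Computations as a definable relation\<close>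

lemma computes_PComp_iff: "computes x (PComp p qs) ns v \<longleftrightarrow>
    (\<exists>ws. list_all2 (\<lambda>q w. computes x q ns w) qs ws \<and> computes x p ws v)"
proof
  assume "computes x (PComp p qs) ns v"
  then show "\<exists>ws. list_all2 (\<lambda>q w. computes x q ns w) qs ws \<and> computes x p ws v"
    by (rule computes_PCompE) blast
qed (use computes.intros(5) in blast)

lemma computes_PMin_iff: "computes x (PMin p) ns n \<longleftrightarrow>
    (\<forall>m. m < n \<longrightarrow> (\<exists>v. v \<noteq> 0 \<and> computes x p (m # ns) v)) \<and> computes x p (n # ns) 0"
proof
  assume "computes x (PMin p) ns n"
  then show "(\<forall>m. m < n \<longrightarrow> (\<exists>v. v \<noteq> 0 \<and> computes x p (m # ns) v)) \<and> computes x p (n # ns) 0"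
    by (rule computes_PMinE) simp
next
  assume "(\<forall>m. m < n \<longrightarrow> (\<exists>v. v \<noteq> 0 \<and> computes x p (m # ns) v)) \<and> computes x p (n # ns) 0"
  then show "computes x (PMin p) ns n" by (intro computes.intros(8)) simp_all
qed

lemma computes_PRec_seq: "computes x (PRec p q) (n # ns) v \<Longrightarrow>
    \<exists>F. F n = v \<and> computes x p ns (F 0) \<and> (\<forall>i<n. computes x q (i # F i # ns) (F (Suc i)))"
proof (induction n arbitrary: v)
  case 0
  then have "computes x p ns v" by (auto elim: computes_PRecE)
  then show ?case by (intro exI[of _ "\<lambda>_. v"]) simp
next
  case (Suc n)
  then obtain u where u: "computes x (PRec p q) (n # ns) u" "computes x q (n # u # ns) v"
    by (auto elim: computes_PRecE)
  from Suc.IH[OF u(1)] obtain F where F: "F n = u" "computes x p ns (F 0)"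
    "\<forall>i<n. computes x q (i # F i # ns) (F (Suc i))" by blast
  then show ?case using u(2) by (intro exI[of _ "F(Suc n := v)"]) (auto simp: less_Suc_eq)
qed

context zfm
begin

subsection \<open>Numbers and reals of the model\<close>

text \<open>Decoding is total, with value \<open>0\<close> on elements that are not numerals, so that quantifiers
  over numbers become quantifiers over the whole model.\<close>

definition N :: "'a \<Rightarrow> nat" where "N a = (if a \<in> range num then inv num a else 0)"

lemma inj_num: "inj num"
  by (rule injI) simp

lemma N_num[simp]: "N (num n) = n"
  by (simp add: N_def inv_f_f[OF inj_num])

lemma num_N_eq: "a \<in> M \<Longrightarrow> b = num (N a) \<longleftrightarrow> E a om \<and> b = a \<or> \<not> E a om \<and> b = num 0"
proof -
  assume a: "a \<in> M"
  have *: "E a om \<longleftrightarrow> a \<in> range num" using el_om a by (auto simp: el_def)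
  show ?thesis
  proof (cases "a \<in> range num")
    case True
    then obtain n where "a = num n" by blast
    then show ?thesis using * by simp
  next
    case False
    then show ?thesis unfolding * by (simp add: N_def)
  qed
qed

definition Rl :: "'a \<Rightarrow> cantor" where "Rl a = (\<lambda>n. E (num n) a)"

lemma range_in: "range e \<subseteq> M \<Longrightarrow> e i \<in> M"
  by blast

lemma dfn_is_num: "dfn (\<lambda>e. e j = num (N (e i)))"
proof -
  have "dfn (\<lambda>e. E (e i) om \<and> e j = e i \<or> \<not> E (e i) om \<and> e j = num 0)"
    by (intro dfn_disj dfn_conj dfn_not dfn_mem_const om dfn_eq dfn_eq_const num_in)
  then show ?thesis by (rule dfn_cong) (simp add: num_N_eq range_in)
qed

lemma dfn_num: "dfn (\<lambda>e. P (e 0) (sh e)) \<Longrightarrow> dfn (\<lambda>e. P (num (N (e i))) e)"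
proof -
  assume "dfn (\<lambda>e. P (e 0) (sh e))"
  then have "dfn (\<lambda>e. \<exists>a\<in>M. a = num (N (e i)) \<and> P a e)"
    by (intro dfn_ex dfn_conj dfn_is_num)
  then show ?thesis by (rule dfn_cong) simp
qed

lemma dfn_allN: "dfn (\<lambda>e. P (N (e 0)) (sh e)) \<Longrightarrow> dfn (\<lambda>e. \<forall>n. P n e)"
proof -
  assume "dfn (\<lambda>e. P (N (e 0)) (sh e))"
  then have "dfn (\<lambda>e. \<forall>a\<in>M. P (N a) e)" by (rule dfn_all)
  then show ?thesis
    by (rule dfn_cong) (metis N_num num_in)
qed

lemma dfn_exN: "dfn (\<lambda>e. P (N (e 0)) (sh e)) \<Longrightarrow> dfn (\<lambda>e. \<exists>n. P n e)"
  by (rule dfn_cong[OF dfn_not[OF dfn_allN[of "\<lambda>n e. \<not> P n e", OF dfn_not]]]) auto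

lemma dfn_N_eq: "dfn (\<lambda>e. N (e i) = N (e j))"
  using dfn_num[of "\<lambda>a e. a = num (N (e j))" i] dfn_is_num by simp

lemma dfn_N_const: "dfn (\<lambda>e. N (e i) = n)"
  using dfn_num[of "\<lambda>a e. a = num n" i] dfn_eq_const[of "num n"] by simp

lemma dfn_N_Suc: "dfn (\<lambda>e. N (e i) = Suc (N (e j)))"
proof -
  have "dfn (\<lambda>e. succ_in M E (num (N (e j))) (num (N (e i))))"
    by (rule dfn_num[of "\<lambda>a e. succ_in M E a (num (N (e i)))"],
        rule dfn_num[of "\<lambda>a e. succ_in M E (e 0) a"], rule dfn_succ_in)
  then show ?thesis by (simp add: succ_iff)
qed

lemma dfn_N_less: "dfn (\<lambda>e. N (e i) < N (e j))"
proof -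
  have "dfn (\<lambda>e. E (num (N (e i))) (num (N (e j))))"
    by (rule dfn_num[of "\<lambda>a e. E a (num (N (e j)))"],
        rule dfn_num[of "\<lambda>a e. E (e 0) a"], rule dfn_mem)
  then show ?thesis by simp
qed

lemma dfn_Rl: "dfn (\<lambda>e. Rl (e i) (N (e j)))"
  unfolding Rl_def by (rule dfn_num[of "\<lambda>a e. E a (e i)"], rule dfn_mem)

lemma dfn_Rl_const: "c \<in> M \<Longrightarrow> dfn (\<lambda>e. Rl c (N (e j)))"
  unfolding Rl_def by (rule dfn_num[of "\<lambda>a e. E a c"], rule dfn_mem_const)

definition rel :: "'a \<Rightarrow> nat \<Rightarrow> nat \<Rightarrow> bool" where "rel a i j \<longleftrightarrow> E (op (num i) (num j)) a"

lemma dfn_rel: "dfn (\<lambda>e. rel (e a) (N (e i)) (N (e j)))"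
proof -
  have "dfn (\<lambda>e. app_in M E (e a) (num (N (e i))) (num (N (e j))))"
    unfolding app_in_def
    by (rule dfn_num[of "\<lambda>u e. e a \<in> M \<and> (\<exists>p\<in>M. opair_in M E u (num (N (e j))) p \<and> E p (e a))"],
        rule dfn_num[of "\<lambda>u e. e (Suc a) \<in> M \<and> (\<exists>p\<in>M. opair_in M E (e 0) u p \<and> E p (e (Suc a)))"])
      (intro dfn_conj dfn_inM dfn_ex dfn_opair_in dfn_mem)
  then show ?thesis
    by (rule dfn_cong) (simp add: rel_def app_iff range_in)
qed

text \<open>Induction on the external program avoids formalizing programs inside \<open>M\<close>.
  Only recursion requires a quantifier over sets of the model, namely over the finite table of
  intermediate values.\<close>

lemma dfn_computes:
  assumes c: "c \<in> M" "Rl c = x"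
  shows "dfn (\<lambda>e. computes x p (map (\<lambda>i. N (e i)) vs) (N (e u)))"
proof (induction p arbitrary: vs u)
  case PZero
  have "computes x PZero ns v \<longleftrightarrow> v = 0" for ns v
    by (auto elim: computes_PZeroE intro: computes.intros(1))
  then show ?case using dfn_N_const[of u 0] by simp
next
  case PSucc
  have "computes x PSucc ns v \<longleftrightarrow> ns \<noteq> [] \<and> v = Suc (hd ns)" for ns v
    by (cases ns) (auto elim: computes_PSuccE intro: computes.intros(2))
  then show ?case using dfn_N_Suc[of u "hd vs"] dfn_const[of False] by (cases vs) simp_all
next
  case (PProj i)
  have "computes x (PProj i) ns v \<longleftrightarrow> i < length ns \<and> v = ns ! i" for ns v
    by (auto elim: computes_PProjE intro: computes.intros(3))
  then show ?case using dfn_N_eq[of u "vs ! i"] dfn_const[of False] by (cases "i < length vs") simp_all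
next
  case POracle
  have *: "computes x POracle ns v \<longleftrightarrow> ns \<noteq> [] \<and> (x (hd ns) \<and> v = 1 \<or> \<not> x (hd ns) \<and> v = 0)" for ns v
  proof (cases ns)
    case (Cons n ms)
    have "computes x POracle (n # ms) v \<longleftrightarrow> v = of_bool (x n)"
      using computes.intros(4)[of x n ms] computes_det by blast
    then show ?thesis using Cons by auto
  qed (auto elim: computes_POracleE)
  show ?case
  proof (cases vs)
    case (Cons v ws)
    have "dfn (\<lambda>e. Rl c (N (e v)) \<and> N (e u) = 1 \<or> \<not> Rl c (N (e v)) \<and> N (e u) = 0)"
      by (intro dfn_disj dfn_conj dfn_not dfn_Rl_const c(1) dfn_N_const)
    then show ?thesis unfolding * by (simp add: Cons c(2))
  qed (simp add: * dfn_const)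
next
  case (PComp p qs)
  \<comment> \<open>The list of inner programs has a fixed length, so the quantifier over value
    lists unfolds into finitely many number quantifiers; \<open>us\<close> collects the values
    already found.\<close>
  have "dfn (\<lambda>e. \<exists>ws. list_all2 (\<lambda>q w. computes x q (map (\<lambda>i. N (e i)) vs) w) qs' ws \<and>
      computes x p (map (\<lambda>i. N (e i)) us @ ws) (N (e u)))" if "set qs' \<subseteq> set qs" for qs' us vs u
    using that
  proof (induction qs' arbitrary: us vs u)
    case Nil
    then show ?case using PComp.IH(1)[of us u] by simp
  next
    case (Cons q qs')
    have "dfn (\<lambda>e. \<exists>w. computes x q (map (\<lambda>i. N (e i)) vs) w \<and>
        (\<exists>ws. list_all2 (\<lambda>q w. computes x q (map (\<lambda>i. N (e i)) vs) w) qs' ws \<and>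
          computes x p (map (\<lambda>i. N (e i)) us @ w # ws) (N (e u))))"
    proof (rule dfn_exN, rule dfn_conj)
      show "dfn (\<lambda>e. computes x q (map (\<lambda>i. N (e (Suc i))) vs) (N (e 0)))"
        using PComp.IH(2)[of q "map Suc vs" 0] Cons.prems by (simp add: comp_def)
      show "dfn (\<lambda>e. \<exists>ws. list_all2 (\<lambda>q w. computes x q (map (\<lambda>i. N (e (Suc i))) vs) w) qs' ws \<and>
          computes x p (map (\<lambda>i. N (e (Suc i))) us @ N (e 0) # ws) (N (e (Suc u))))"
        using Cons.IH[of "map Suc vs" "map Suc us @ [0]" "Suc u"] Cons.prems by (simp add: comp_def)
    qed
    then show ?case by (rule dfn_cong) (auto simp: list_all2_Cons1)
  qed
  from this[of qs vs "[]" u] show ?case by (simp add: computes_PComp_iff)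
next
  case (PRec p q)
  show ?case
  proof (cases vs)
    case Nil
    have "\<not> computes x (PRec p q) [] v" for v by (auto elim: computes_PRecE)
    then show ?thesis using Nil by (simp add: dfn_const)
  next
    case (Cons n ws)
    \<comment> \<open>The table only has to justify each entry by an earlier one and need not be a
      function. The variables \<open>z\<close> and \<open>j\<close> name \<open>0\<close> and
      \<open>Suc i\<close>, as the definable atoms speak about variables.\<close>
    let ?P = "\<lambda>a n ns v. rel a n v \<and> (\<forall>z. z = 0 \<longrightarrow> (\<forall>b. rel a z b \<longrightarrow> computes x p ns b)) \<and>
        (\<forall>i j. j = Suc i \<longrightarrow> (\<forall>b. rel a j b \<longrightarrow> (\<exists>c. rel a i c \<and> computes x q (i # c # ns) b)))"
    have iff: "computes x (PRec p q) (n # ns) v \<longleftrightarrow> (\<exists>a\<in>M. ?P a n ns v)" for n ns v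
    proof
      assume "computes x (PRec p q) (n # ns) v"
      then obtain F where F: "F n = v" "computes x p ns (F 0)"
        "\<forall>i<n. computes x q (i # F i # ns) (F (Suc i))" using computes_PRec_seq by blast
      define a where "a = mk ((\<lambda>i. op (num i) (num (F i))) ` {..n})"
      have a: "a \<in> M \<and> el a = (\<lambda>i. op (num i) (num (F i))) ` {..n}"
        unfolding a_def by (rule mk) (auto intro: op_in)
      have ra: "rel a i j \<longleftrightarrow> i \<le> n \<and> j = F i" for i j
      proof -
        have "rel a i j \<longleftrightarrow> op (num i) (num j) \<in> el a"
          unfolding rel_def el_def using op_in by simp
        also have "\<dots> \<longleftrightarrow> i \<le> n \<and> j = F i" using a by (auto simp: op_inject)
        finally show ?thesis .
      qed
      show "\<exists>a\<in>M. ?P a n ns v"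
        using a F by (intro bexI[of _ a]) (auto simp: ra)
    next
      assume "\<exists>a\<in>M. ?P a n ns v"
      then obtain a where aP: "?P a n ns v" by (elim bexE)
      have a: "rel a n v" "rel a 0 b \<Longrightarrow> computes x p ns b"
        "rel a (Suc i) b \<Longrightarrow> \<exists>c. rel a i c \<and> computes x q (i # c # ns) b" for i b
        using aP by simp_all
      have "computes x (PRec p q) (i # ns) b" if "rel a i b" for i b
        using that
      proof (induction i arbitrary: b)
        case 0
        then show ?case using a(2) computes.intros(6) by blast
      next
        case (Suc i)
        obtain c where "rel a i c" "computes x q (i # c # ns) b" using a(3)[OF Suc.prems] by blast
        then show ?case using Suc.IH computes.intros(7) by blast
      qed
      then show "computes x (PRec p q) (n # ns) v" using a(1) by blast
    qed
    have "dfn (\<lambda>e. \<exists>a\<in>M. ?P a (N (e n)) (map (\<lambda>i. N (e i)) ws) (N (e u)))"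
    proof (intro dfn_ex dfn_conj dfn_allN dfn_imp dfn_exN dfn_rel)
      show "dfn (\<lambda>e. N (e 0) = 0)" by (rule dfn_N_const)
      show "dfn (\<lambda>e. computes x p (map (\<lambda>i. N (e (Suc (Suc (Suc i))))) ws) (N (e 0)))"
        using PRec.IH(1)[of "map (\<lambda>i. Suc (Suc (Suc i))) ws" 0] by (simp add: comp_def)
      show "dfn (\<lambda>e. N (e 0) = Suc (N (e (Suc 0))))" by (rule dfn_N_Suc)
      show "dfn (\<lambda>e. computes x q (N (e (Suc (Suc (Suc 0)))) # N (e 0) #
          map (\<lambda>i. N (e (Suc (Suc (Suc (Suc (Suc i))))))) ws) (N (e (Suc 0))))"
        using PRec.IH(2)[of "Suc (Suc (Suc 0)) # 0 # map (\<lambda>i. Suc (Suc (Suc (Suc (Suc i))))) ws" "Suc 0"]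
        by (simp add: comp_def)
    qed
    then show ?thesis by (simp add: Cons iff)
  qed
next
  case (PMin p)
  have "dfn (\<lambda>e. (\<forall>m. m < N (e u) \<longrightarrow> (\<exists>v. v \<noteq> 0 \<and> computes x p (m # map (\<lambda>i. N (e i)) vs) v)) \<and>
      (\<exists>v. v = 0 \<and> computes x p (N (e u) # map (\<lambda>i. N (e i)) vs) v))"
  proof (intro dfn_conj dfn_allN dfn_imp dfn_exN dfn_not dfn_N_less dfn_N_const)
    show "dfn (\<lambda>e. computes x p (N (e (Suc 0)) # map (\<lambda>i. N (e (Suc (Suc i)))) vs) (N (e 0)))"
      using PMin.IH[of "Suc 0 # map (\<lambda>i. Suc (Suc i)) vs" 0] by (simp add: comp_def)
    show "dfn (\<lambda>e. computes x p (N (e (Suc u)) # map (\<lambda>i. N (e (Suc i))) vs) (N (e 0)))"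
      using PMin.IH[of "Suc u # map Suc vs" 0] by (simp add: comp_def)
  qed
  then show ?case by (simp add: computes_PMin_iff)
qed

lemma dfn_cb:
  assumes c: "c \<in> M" "Rl c = x" and P: "cb x P"
  shows "dfn (\<lambda>e. P (\<lambda>i. N (e i)))"
proof -
  obtain n p where p: "\<And>e. computes x p (map e [0..<n]) (of_bool (P e))"
    using P unfolding cf_def by blast
  have "P e \<longleftrightarrow> computes x p (map e [0..<n]) 1" for e
    using p[of e] computes_det[OF p[of e], of 1] by (cases "P e") auto
  moreover have "dfn (\<lambda>e. \<exists>v. v = 1 \<and> computes x p (map (\<lambda>i. N (e i)) [0..<n]) v)"
  proof (intro dfn_exN dfn_conj dfn_N_const)
    show "dfn (\<lambda>e. computes x p (map (\<lambda>i. N (e (Suc i))) [0..<n]) (N (e 0)))"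
      using dfn_computes[OF c, of p "map Suc [0..<n]" 0] by (simp add: comp_def)
  qed
  ultimately show ?thesis by simp
qed

end

section \<open>Reals, strings and definable classes of the model\<close>

context zfm
begin

definition gr :: "cantor \<Rightarrow> 'a set" where "gr z = range (\<lambda>n. op (num n) (num (of_bool (z n))))"

lemma mem_gr: "op (num n) (num b) \<in> gr z \<longleftrightarrow> b = of_bool (z n)"
  unfolding gr_def by (auto simp: op_inject)

lemma gr_subset: "gr z \<subseteq> M"
  unfolding gr_def by (auto intro: op_in)

lemma gr_inject: "gr z = gr z' \<longleftrightarrow> z = z'"
proof
  assume "gr z = gr z'"
  then have "of_bool (z n) = (of_bool (z' n) :: nat)" for n
    using mem_gr[of n "of_bool (z n)" z] mem_gr[of n "of_bool (z n)" z'] by simp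
  then show "z = z'" by (simp add: fun_eq_iff)
qed simp

lemma el_two: "el (num 2) = {num 0, num 1}"
  unfolding el_num by (auto simp: numeral_2_eq_2 lessThan_Suc)

lemma real_iff: "real_in M E a \<longleftrightarrow> a \<in> M \<and> (\<exists>z. el a = gr z)"
proof
  assume "real_in M E a"
  then have f: "function_in M E a om (num 2)" unfolding real_in_def omega_iff numeral_iff by blast
  then have aM: "a \<in> M" unfolding function_in_def by blast
  from f obtain F where F: "\<And>u. u \<in> el om \<Longrightarrow> F u \<in> el (num 2)" "el a = (\<lambda>u. op u (F u)) ` el om"
    unfolding function_iff[OF aM om(1) num_in] by blast
  define z where "z n \<longleftrightarrow> F (num n) = num 1" for n
  have "F (num n) = num (of_bool (z n))" for n
    using F(1)[of "num n"] unfolding el_om el_two z_def by auto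
  then have "el a = gr z" unfolding F(2) el_om gr_def by (simp add: image_image)
  then show "a \<in> M \<and> (\<exists>z. el a = gr z)" using aM by blast
next
  assume "a \<in> M \<and> (\<exists>z. el a = gr z)"
  then obtain z where a: "a \<in> M" "el a = gr z" by blast
  have "function_in M E a om (num 2)"
    unfolding function_iff[OF a(1) om(1) num_in]
  proof (intro exI[of _ "\<lambda>u. num (of_bool (z (N u)))"] conjI ballI)
    show "num (of_bool (z (N u))) \<in> el (num 2)" for u unfolding el_two by simp
    show "el a = (\<lambda>u. op u (num (of_bool (z (N u))))) ` el om"
      unfolding a(2) gr_def el_om by (simp add: image_image)
  qed
  then show "real_in M E a"
    unfolding real_in_def omega_iff numeral_iff using om(1) num_in[of 2] by blast
qed

lemma codes_real_iff: "codes_real M E a z \<longleftrightarrow> a \<in> M \<and> el a = gr z"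
proof (cases "a \<in> M \<and> (\<exists>z'. el a = gr z')")
  case True
  then obtain z' where a: "a \<in> M" "el a = gr z'" by blast
  have "(\<forall>n. \<exists>i\<in>M. \<exists>b\<in>M. numeral_in M E n i \<and> numeral_in M E (of_bool (z n)) b \<and> app_in M E a i b) \<longleftrightarrow>
      (\<forall>n. op (num n) (num (of_bool (z n))) \<in> el a)"
    unfolding numeral_iff using a(1) by (auto simp: app_iff el_def op_in)
  also have "\<dots> \<longleftrightarrow> el a = gr z"
    unfolding a(2) mem_gr gr_inject by (auto simp: fun_eq_iff)
  finally show ?thesis unfolding codes_real_def real_iff using True by (simp only: simp_thms)
next
  case False
  then show ?thesis unfolding codes_real_def real_iff by blast
qed

definition RR :: "cantor set" where "RR = {z. contains_real M E z}"

lemma dfn_opair_n: "dfn (\<lambda>e. opair_in M E (e i) (num (N (e j))) (e k))"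
  by (rule dfn_num[of "\<lambda>a e. opair_in M E (e i) a (e k)"], rule dfn_opair_in)

lemma dfn_opair_nn: "dfn (\<lambda>e. opair_in M E (num (N (e i))) (num (N (e j))) (e k))"
  by (rule dfn_num[of "\<lambda>a e. opair_in M E a (num (N (e j))) (e k)"], rule dfn_opair_n)

text \<open>Reals enter the forcing as functions from omega to \<open>2\<close>, while
  \<open>Rl\<close> reads an element as a set of numerals; separation leads from graphs to sets,
  replacement back.\<close>

lemma RR_iff: "z \<in> RR \<longleftrightarrow> (\<exists>a\<in>M. Rl a = z)"
proof
  assume "z \<in> RR"
  then obtain a where a: "a \<in> M" "el a = gr z"
    unfolding RR_def contains_real_def codes_real_iff by blast
  have "dfn (\<lambda>e. \<exists>b. b = 1 \<and> (\<exists>q\<in>M. opair_in M E (e 0) (num b) q \<and> E q a))"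
    by (intro dfn_exN dfn_conj dfn_N_const dfn_ex dfn_opair_n dfn_mem_const a(1))
  from dfn_separation[OF this om(1)] obtain b where b: "b \<in> M"
    "\<forall>u\<in>M. E u b \<longleftrightarrow> E u om \<and> (\<exists>b. b = 1 \<and> (\<exists>q\<in>M. opair_in M E u (num b) q \<and> E q a))" by blast
  have "Rl b n \<longleftrightarrow> z n" for n
  proof -
    have "E (num n) om" using el_om by (auto simp: el_def)
    then have "Rl b n \<longleftrightarrow> op (num n) (num 1) \<in> el a"
      unfolding Rl_def using b(2) op_in[of "num n" "num 1"] by (auto simp: opair_iff el_def)
    then show ?thesis unfolding a(2) mem_gr by simp
  qed
  then show "\<exists>a\<in>M. Rl a = z" using b(1) by blast
next
  assume "\<exists>a\<in>M. Rl a = z"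
  then obtain b where b: "b \<in> M" "Rl b = z" by blast
  let ?Q = "\<lambda>u v. \<exists>c. (E u b \<and> c = 1 \<or> \<not> E u b \<and> c = 0) \<and> opair_in M E u (num c) v"
  have Q: "dfn (\<lambda>e. ?Q (e 0) (e 1))"
    by (intro dfn_exN dfn_conj dfn_disj dfn_not dfn_mem_const b(1) dfn_N_const dfn_opair_n)
  have Qiff: "?Q (num n) v \<longleftrightarrow> v = op (num n) (num (of_bool (z n)))" if "v \<in> M" for n v
    using b(2)[symmetric] that by (auto simp: opair_iff Rl_def)
  have omE: "E u om \<longleftrightarrow> u \<in> range num" if "u \<in> M" for u using el_om that by (auto simp: el_def)
  have "\<exists>a\<in>M. \<forall>v\<in>M. E v a \<longleftrightarrow> (\<exists>u\<in>M. E u om \<and> ?Q u v)"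
  proof (rule dfn_replacement[OF Q om(1)])
    fix u v v' assume "u \<in> M" "E u om" "v \<in> M" "v' \<in> M" "?Q u v" "?Q u v'"
    moreover from this obtain n where "u = num n" using omE by blast
    ultimately show "v = v'" using Qiff by simp
  qed
  then obtain a where a: "a \<in> M" "\<And>v. v \<in> M \<Longrightarrow> E v a \<longleftrightarrow> (\<exists>u\<in>M. E u om \<and> ?Q u v)" by blast
  have "v \<in> el a \<longleftrightarrow> v \<in> gr z" for v
  proof (cases "v \<in> M")
    case True
    have "E v a \<longleftrightarrow> (\<exists>n. ?Q (num n) v)" using a(2)[OF True] omE num_in by blast
    also have "\<dots> \<longleftrightarrow> v \<in> gr z" unfolding Qiff[OF True] gr_def by blast
    finally show ?thesis using True by (simp add: el_def)
  next
    case False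
    then show ?thesis using gr_subset by (auto simp: el_def)
  qed
  then have "el a = gr z" by blast
  then show "z \<in> RR" unfolding RR_def contains_real_def codes_real_iff using a(1) by blast
qed

definition fr :: "cantor \<Rightarrow> 'a" where "fr z = (SOME a. a \<in> M \<and> el a = gr z)"

lemma fr: "z \<in> RR \<Longrightarrow> fr z \<in> M \<and> el (fr z) = gr z"
  unfolding fr_def
  by (rule someI_ex) (simp add: RR_def contains_real_def codes_real_iff Bex_def)

lemma fr_eq: "a \<in> M \<Longrightarrow> el a = gr z \<Longrightarrow> z \<in> RR \<and> a = fr z"
proof -
  assume a: "a \<in> M" "el a = gr z"
  then have "z \<in> RR" unfolding RR_def contains_real_def codes_real_iff by blast
  then show ?thesis using fr[of z] a el_inject[of a "fr z"] by simp
qed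

lemma fr_inject: "z \<in> RR \<Longrightarrow> z' \<in> RR \<Longrightarrow> fr z = fr z' \<longleftrightarrow> z = z'"
  using fr[of z] fr[of z'] gr_inject[of z z'] by auto

subsection \<open>The class of definable predicates of one real and of numbers\<close>

definition Df :: "(cantor \<Rightarrow> (nat \<Rightarrow> nat) \<Rightarrow> bool) \<Rightarrow> bool" where
  "Df P \<longleftrightarrow> dfn (\<lambda>e. P (Rl (e 0)) (\<lambda>i. N (e (Suc i))))"

lemma world: "c \<in> M \<Longrightarrow> world (Rl c) RR Df"
proof
  fix P Q assume "Df P" "Df Q"
  then show "Df (\<lambda>z e. P z e \<and> Q z e)" unfolding Df_def by (rule dfn_conj)
next
  fix P assume "Df P"
  then show "Df (\<lambda>z e. \<not> P z e)" unfolding Df_def by (rule dfn_not)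
next
  fix S assume "Df (\<lambda>z e. S z (e 0) (sh e))"
  \<comment> \<open>Slot \<open>0\<close> holds the real, so the number variable to be quantified is
    first moved to the front.\<close>
  from dfn_ren[OF this[unfolded Df_def], of "\<lambda>i. if i = 0 then 1 else if i = 1 then 0 else i"]
  have "dfn (\<lambda>e. S (Rl (e (Suc 0))) (N (e 0)) (\<lambda>i. N (e (Suc (Suc i)))))" by simp
  from dfn_allN[of "\<lambda>n e. S (Rl (e 0)) n (\<lambda>i. N (e (Suc i)))", OF this]
  show "Df (\<lambda>z e. \<forall>n. S z n e)" unfolding Df_def .
next
  show "Df (\<lambda>z e. z (e i))" for i unfolding Df_def by (rule dfn_Rl)
next
  fix C assume c: "c \<in> M" "cb (Rl c) C"
  from dfn_ren[OF dfn_cb[OF c(1) refl c(2)], of Suc]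
  show "Df (\<lambda>z. C)" unfolding Df_def .
next
  fix P assume "Df P"
  from dfn_ren[OF this[unfolded Df_def], of "\<lambda>i. if i = 0 then 0 else Suc i"]
  have "dfn (\<lambda>e. P (Rl (e 0)) (\<lambda>i. N (e (Suc (Suc i)))))" by simp
  from dfn_all[of "\<lambda>a e. P (Rl a) (\<lambda>i. N (e (Suc i)))", OF this]
  have "dfn (\<lambda>e. \<forall>a\<in>M. P (Rl a) (\<lambda>i. N (e (Suc i))))" .
  then show "Df (\<lambda>_ e. \<forall>z\<in>RR. P z e)"
    unfolding Df_def by (rule dfn_cong) (simp add: Ball_def RR_iff, metis)
next
  fix P z0 assume P: "Df P" and "z0 \<in> RR"
  then obtain a where a: "a \<in> M" "Rl a = z0" unfolding RR_iff by blast
  from dfn_ren[OF P[unfolded Df_def], of "\<lambda>i. if i = 0 then 0 else Suc i"]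
  have "dfn (\<lambda>e. P (Rl (e 0)) (\<lambda>i. N (e (Suc (Suc i)))))" by simp
  from dfn_inst[of "\<lambda>a e. P (Rl a) (\<lambda>i. N (e (Suc i)))", OF this a(1)]
  show "Df (\<lambda>_. P z0)" unfolding Df_def a(2) .
next
  fix P v assume "Df P"
  from dfn_ren[OF this[unfolded Df_def], of "\<lambda>i. case i of 0 \<Rightarrow> 0 | Suc j \<Rightarrow> Suc (v j)"]
  show "Df (\<lambda>z e. P z (\<lambda>i. e (v i)))" unfolding Df_def by simp
next
  fix y assume "Df (\<lambda>_ e. y (e 0))"
  from dfn_ren[OF this[unfolded Df_def], of "\<lambda>_. 0"] have "dfn (\<lambda>e. y (N (e 0)))" .
  from dfn_separation[OF this om(1)] obtain b where
    b: "b \<in> M" "\<And>u. u \<in> M \<Longrightarrow> E u b \<longleftrightarrow> E u om \<and> y (N u)" by blast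
  have "E (num n) om" for n using el_om by (auto simp: el_def)
  then have "Rl b = y" unfolding Rl_def using b(2) by auto
  then show "y \<in> RR" unfolding RR_iff using b(1) by blast
qed

subsection \<open>Conditions of the model\<close>

definition str :: "bool list \<Rightarrow> 'a" where
  "str \<sigma> = mk ((\<lambda>i. op (num i) (num (of_bool (\<sigma> ! i)))) ` {..<length \<sigma>})"

lemma str: "str \<sigma> \<in> M \<and> el (str \<sigma>) = (\<lambda>i. op (num i) (num (of_bool (\<sigma> ! i)))) ` {..<length \<sigma>}"
  unfolding str_def by (rule mk) (auto intro: op_in)

lemma str_in[simp]: "str \<sigma> \<in> M" using str by blast

lemma mem_str: "op (num i) (num b) \<in> el (str \<sigma>) \<longleftrightarrow> i < length \<sigma> \<and> b = of_bool (\<sigma> ! i)"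
  using str[of \<sigma>] by (auto simp: op_inject)

lemma str_inject[simp]: "str \<sigma> = str \<tau> \<longleftrightarrow> \<sigma> = \<tau>"
proof
  assume "str \<sigma> = str \<tau>"
  then have *: "i < length \<sigma> \<and> b = of_bool (\<sigma> ! i) \<longleftrightarrow> i < length \<tau> \<and> b = of_bool (\<tau> ! i)" for i b :: nat
    using mem_str[of i b \<sigma>] mem_str[of i b \<tau>] by simp
  then have "i < length \<sigma> \<longleftrightarrow> i < length \<tau>" for i by blast
  then have "length \<sigma> = length \<tau>" by (metis linorder_neqE_nat less_irrefl)
  moreover have "\<sigma> ! i = \<tau> ! i" if "i < length \<sigma>" for i
    using *[of i "of_bool (\<sigma> ! i)"] that by simp
  ultimately show "\<sigma> = \<tau>" by (rule nth_equalityI)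
qed simp

lemma string_iff: "string_of_length_in M E (num k) s \<longleftrightarrow> (\<exists>\<sigma>. length \<sigma> = k \<and> s = str \<sigma>)"
proof
  assume "string_of_length_in M E (num k) s"
  then have f: "function_in M E s (num k) (num 2)" unfolding string_of_length_in_def numeral_iff by blast
  then have sM: "s \<in> M" unfolding function_in_def by blast
  from f obtain F where F: "\<And>u. u \<in> el (num k) \<Longrightarrow> F u \<in> el (num 2)" "el s = (\<lambda>u. op u (F u)) ` el (num k)"
    unfolding function_iff[OF sM num_in num_in] by blast
  define \<sigma> where "\<sigma> = map (\<lambda>i. F (num i) = num 1) [0..<k]"
  have "F (num i) = num (of_bool (\<sigma> ! i))" if "i < k" for i
    using F(1)[of "num i"] that unfolding el_num[of k] el_two \<sigma>_def by auto
  then have "el s = el (str \<sigma>)"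
    unfolding F(2) el_num conjunct2[OF str] by (simp add: image_image \<sigma>_def)
  then have "s = str \<sigma>" using el_inject[OF sM str_in] by simp
  then show "\<exists>\<sigma>. length \<sigma> = k \<and> s = str \<sigma>" by (intro exI[of _ \<sigma>]) (simp add: \<sigma>_def)
next
  assume "\<exists>\<sigma>. length \<sigma> = k \<and> s = str \<sigma>"
  then obtain \<sigma> where s: "length \<sigma> = k" "s = str \<sigma>" by blast
  have "function_in M E (str \<sigma>) (num k) (num 2)"
    unfolding function_iff[OF str_in num_in num_in]
  proof (intro exI[of _ "\<lambda>u. num (of_bool (\<sigma> ! N u))"] conjI ballI)
    show "num (of_bool (\<sigma> ! N u)) \<in> el (num 2)" for u unfolding el_two by simp
    show "el (str \<sigma>) = (\<lambda>u. op u (num (of_bool (\<sigma> ! N u)))) ` el (num k)"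
      using conjunct2[OF str[of \<sigma>]] unfolding el_num s(1) by (simp add: image_image)
  qed
  moreover have "E (num k) om" using el_om by (auto simp: el_def)
  ultimately show "string_of_length_in M E (num k) s"
    unfolding string_of_length_in_def omega_iff numeral_iff s(2) using om(1) num_in[of 2] by blast
qed

lemma string_num: "string_of_length_in M E k s \<Longrightarrow> \<exists>n. k = num n"
proof -
  assume "string_of_length_in M E k s"
  then have "E k om" "function_in M E s k (num 2)"
    unfolding string_of_length_in_def omega_iff numeral_iff by blast+
  moreover from this(2) have "k \<in> M" unfolding function_in_def by blast
  ultimately show ?thesis using el_om by (auto simp: el_def)
qed

lemma codes_string_iff: "s \<in> M \<Longrightarrow> codes_string M E s \<sigma> \<longleftrightarrow> s = str \<sigma>"
proof -
  assume s: "s \<in> M"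
  have 1: "(\<exists>k\<in>M. numeral_in M E (length \<sigma>) k \<and> string_of_length_in M E k s) \<longleftrightarrow>
      (\<exists>\<tau>. length \<tau> = length \<sigma> \<and> s = str \<tau>)"
    unfolding numeral_iff using string_iff num_in by auto
  have 2: "(\<forall>n<length \<sigma>. \<exists>i\<in>M. \<exists>b\<in>M. numeral_in M E n i \<and> numeral_in M E (of_bool (\<sigma> ! n)) b \<and>
      app_in M E s i b) \<longleftrightarrow> (\<forall>n<length \<sigma>. op (num n) (num (of_bool (\<sigma> ! n))) \<in> el s)"
    unfolding numeral_iff using s by (auto simp: app_iff el_def op_in)
  show ?thesis
    unfolding codes_string_def 1 2
  proof
    assume "(\<exists>\<tau>. length \<tau> = length \<sigma> \<and> s = str \<tau>) \<and> (\<forall>n<length \<sigma>. op (num n) (num (of_bool (\<sigma> ! n))) \<in> el s)"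
    then obtain \<tau> where t: "length \<tau> = length \<sigma>" "s = str \<tau>"
      "\<forall>n<length \<sigma>. op (num n) (num (of_bool (\<sigma> ! n))) \<in> el s" by blast
    then have "\<sigma> = \<tau>" by (intro nth_equalityI) (auto simp: mem_str)
    then show "s = str \<sigma>" using t by simp
  next
    assume "s = str \<sigma>"
    then show "(\<exists>\<tau>. length \<tau> = length \<sigma> \<and> s = str \<tau>) \<and> (\<forall>n<length \<sigma>. op (num n) (num (of_bool (\<sigma> ! n))) \<in> el s)"
      by (auto simp: mem_str)
  qed
qed

end

section \<open>The forcing poset of the model in terms of numerical codes\<close>

lemma finite_strings: "finite {\<sigma> :: bool list. length \<sigma> \<le> n}"
  using finite_lists_length_le[of "UNIV :: bool set" n] by simp

lemma hs_hcode_subset: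
  "hs (hcode n f) \<subseteq> hs (hcode n' f') \<longleftrightarrow> (\<forall>\<sigma>. length \<sigma> \<le> n \<longrightarrow> length \<sigma> \<le> n' \<and> f \<sigma> = f' \<sigma>)"
proof
  assume s: "hs (hcode n f) \<subseteq> hs (hcode n' f')"
  show "\<forall>\<sigma>. length \<sigma> \<le> n \<longrightarrow> length \<sigma> \<le> n' \<and> f \<sigma> = f' \<sigma>"
  proof (intro allI impI)
    fix \<sigma> :: "bool list" assume "length \<sigma> \<le> n"
    then have "pr (scode \<sigma>) (label_code (f \<sigma>)) \<in> hs (hcode n f)" unfolding hs_hcode by blast
    then have "pr (scode \<sigma>) (label_code (f \<sigma>)) \<in> hs (hcode n' f')" using s by blast
    then show "length \<sigma> \<le> n' \<and> f \<sigma> = f' \<sigma>" unfolding hs_hcode by auto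
  qed
next
  assume a: "\<forall>\<sigma>. length \<sigma> \<le> n \<longrightarrow> length \<sigma> \<le> n' \<and> f \<sigma> = f' \<sigma>"
  show "hs (hcode n f) \<subseteq> hs (hcode n' f')"
  proof
    fix q assume "q \<in> hs (hcode n f)"
    then obtain \<sigma> where "q = pr (scode \<sigma>) (label_code (f \<sigma>))" "length \<sigma> \<le> n" unfolding hs_hcode by blast
    then have "q = pr (scode \<sigma>) (label_code (f' \<sigma>))" "length \<sigma> \<le> n'" using a by auto
    then show "q \<in> hs (hcode n' f')" unfolding hs_hcode by blast
  qed
qed

lemma le_hcode:
  "le X (hcode n' f') (hcode n f) \<longleftrightarrow> (\<forall>\<sigma>. length \<sigma> \<le> n \<longrightarrow> length \<sigma> \<le> n' \<and> f \<sigma> = f' \<sigma>) \<and>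
     (\<forall>y\<in>X. \<forall>\<sigma>. pref (scode \<sigma>) y \<and> n < length \<sigma> \<and> length \<sigma> \<le> n' \<longrightarrow> f' \<sigma> = LBot)"
proof (cases "\<forall>\<sigma>. length \<sigma> \<le> n \<longrightarrow> length \<sigma> \<le> n' \<and> f \<sigma> = f' \<sigma>")
  case True
  \<comment> \<open>A string of length \<open>n\<close> witnesses that inclusion of the domains
    bounds the heights.\<close>
  have nn: "n \<le> n'" using True[rule_format, of "replicate n True"] by simp
  have lb: "label_code l = 2 \<longleftrightarrow> l = LBot" for l by (cases l) auto
  have diff: "q \<in> hs (hcode n' f') - hs (hcode n f) \<longleftrightarrow>
      (\<exists>\<sigma>. q = pr (scode \<sigma>) (label_code (f' \<sigma>)) \<and> n < length \<sigma> \<and> length \<sigma> \<le> n')" for q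
  proof
    assume "q \<in> hs (hcode n' f') - hs (hcode n f)"
    then obtain \<sigma> where s: "q = pr (scode \<sigma>) (label_code (f' \<sigma>))" "length \<sigma> \<le> n'"
      and q: "q \<notin> hs (hcode n f)" unfolding hs_hcode[of n' f'] by blast
    have "\<not> length \<sigma> \<le> n"
    proof
      assume l: "length \<sigma> \<le> n"
      then have "q = pr (scode \<sigma>) (label_code (f \<sigma>))" using True s by simp
      then show False using q l unfolding hs_hcode by blast
    qed
    then show "\<exists>\<sigma>. q = pr (scode \<sigma>) (label_code (f' \<sigma>)) \<and> n < length \<sigma> \<and> length \<sigma> \<le> n'"
      using s by (intro exI[of _ \<sigma>]) simp
  next
    assume "\<exists>\<sigma>. q = pr (scode \<sigma>) (label_code (f' \<sigma>)) \<and> n < length \<sigma> \<and> length \<sigma> \<le> n'"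
    then show "q \<in> hs (hcode n' f') - hs (hcode n f)" unfolding hs_hcode by auto
  qed
  have "(\<forall>q\<in>hs (hcode n' f') - hs (hcode n f). sn q = 2 \<or> (\<forall>y\<in>X. \<not> pref (fs q) y)) \<longleftrightarrow>
      (\<forall>y\<in>X. \<forall>\<sigma>. pref (scode \<sigma>) y \<and> n < length \<sigma> \<and> length \<sigma> \<le> n' \<longrightarrow> f' \<sigma> = LBot)"
  proof
    assume a: "\<forall>q\<in>hs (hcode n' f') - hs (hcode n f). sn q = 2 \<or> (\<forall>y\<in>X. \<not> pref (fs q) y)"
    show "\<forall>y\<in>X. \<forall>\<sigma>. pref (scode \<sigma>) y \<and> n < length \<sigma> \<and> length \<sigma> \<le> n' \<longrightarrow> f' \<sigma> = LBot"
    proof (intro ballI allI impI)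
      fix y \<sigma> assume y: "y \<in> X" "pref (scode \<sigma>) y \<and> n < length \<sigma> \<and> length \<sigma> \<le> n'"
      then have "pr (scode \<sigma>) (label_code (f' \<sigma>)) \<in> hs (hcode n' f') - hs (hcode n f)"
        unfolding diff by blast
      from bspec[OF a this] y show "f' \<sigma> = LBot" by (auto simp: lb)
    qed
  next
    assume a: "\<forall>y\<in>X. \<forall>\<sigma>. pref (scode \<sigma>) y \<and> n < length \<sigma> \<and> length \<sigma> \<le> n' \<longrightarrow> f' \<sigma> = LBot"
    show "\<forall>q\<in>hs (hcode n' f') - hs (hcode n f). sn q = 2 \<or> (\<forall>y\<in>X. \<not> pref (fs q) y)"
    proof
      fix q assume "q \<in> hs (hcode n' f') - hs (hcode n f)"
      then obtain \<sigma> where "q = pr (scode \<sigma>) (label_code (f' \<sigma>))" "n < length \<sigma> \<and> length \<sigma> \<le> n'"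
        unfolding diff by blast
      then show "sn q = 2 \<or> (\<forall>y\<in>X. \<not> pref (fs q) y)" using a by (auto simp: lb)
    qed
  qed
  then show ?thesis unfolding le_def hs_hcode_subset using True nn by simp
next
  case False
  then show ?thesis unfolding le_def hs_hcode_subset by blast
qed

context zfm
begin

lemma subset_iff_el: "a \<in> M \<Longrightarrow> b \<in> M \<Longrightarrow> subset_in M E a b \<longleftrightarrow> el a \<subseteq> el b"
  unfolding subset_in_def el_def by auto

lemma app_iff_el: "f \<in> M \<Longrightarrow> a \<in> M \<Longrightarrow> b \<in> M \<Longrightarrow> app_in M E f a b \<longleftrightarrow> op a b \<in> el f"
  by (simp add: app_iff el_def op_in)

definition lg :: "nat \<Rightarrow> (bool list \<Rightarrow> label) \<Rightarrow> 'a set" where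
  "lg n f = (\<lambda>\<sigma>. op (str \<sigma>) (num (label_code (f \<sigma>)))) ` {\<sigma>. length \<sigma> \<le> n}"

definition lab :: "nat \<Rightarrow> (bool list \<Rightarrow> label) \<Rightarrow> 'a" where "lab n f = mk (lg n f)"

lemma lab: "lab n f \<in> M \<and> el (lab n f) = lg n f"
  unfolding lab_def by (rule mk) (auto simp: lg_def finite_strings intro: op_in)

lemma lab_in[simp]: "lab n f \<in> M" and el_lab: "el (lab n f) = lg n f"
  using lab by blast+

lemma mem_lg: "s \<in> M \<Longrightarrow> l \<in> M \<Longrightarrow>
    op s l \<in> lg n f \<longleftrightarrow> (\<exists>\<sigma>. s = str \<sigma> \<and> length \<sigma> \<le> n \<and> l = num (label_code (f \<sigma>)))"
  unfolding lg_def by (auto simp: op_inject)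

lemma app_lab: "s \<in> M \<Longrightarrow> l \<in> M \<Longrightarrow>
    app_in M E (lab n f) s l \<longleftrightarrow> (\<exists>\<sigma>. s = str \<sigma> \<and> length \<sigma> \<le> n \<and> l = num (label_code (f \<sigma>)))"
proof -
  assume a: "s \<in> M" "l \<in> M"
  have "app_in M E (lab n f) s l \<longleftrightarrow> op s l \<in> el (lab n f)"
    using a by (intro app_iff_el) simp_all
  then show ?thesis unfolding el_lab using mem_lg a by simp
qed

lemma lab_subset: "subset_in M E (lab n f) (lab n' f') \<longleftrightarrow>
    (\<forall>\<sigma>. length \<sigma> \<le> n \<longrightarrow> length \<sigma> \<le> n' \<and> f \<sigma> = f' \<sigma>)"
proof -
  have "subset_in M E (lab n f) (lab n' f') \<longleftrightarrow> el (lab n f) \<subseteq> el (lab n' f')"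
    by (intro subset_iff_el) simp_all
  also have "\<dots> \<longleftrightarrow> (\<forall>\<sigma>. length \<sigma> \<le> n \<longrightarrow> op (str \<sigma>) (num (label_code (f \<sigma>))) \<in> lg n' f')"
    unfolding el_lab lg_def[of n f] by auto
  also have "\<dots> \<longleftrightarrow> (\<forall>\<sigma>. length \<sigma> \<le> n \<longrightarrow> length \<sigma> \<le> n' \<and> f \<sigma> = f' \<sigma>)"
    by (simp add: mem_lg)
  finally show ?thesis .
qed

lemma lab_eq: "lab n f = lab n' f' \<longleftrightarrow> hcode n f = hcode n' f'"
proof
  assume eq: "lab n f = lab n' f'"
  have s: "subset_in M E (lab n f) (lab n f)" unfolding subset_in_def by simp
  have 1: "\<forall>\<sigma>. length \<sigma> \<le> n \<longrightarrow> length \<sigma> \<le> n' \<and> f \<sigma> = f' \<sigma>" using s eq lab_subset[of n f n' f'] by simp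
  have 2: "\<forall>\<sigma>. length \<sigma> \<le> n' \<longrightarrow> length \<sigma> \<le> n \<and> f' \<sigma> = f \<sigma>" using s eq lab_subset[of n' f' n f] by simp
  have n: "n = n'"
    using 1[rule_format, of "replicate n True"] 2[rule_format, of "replicate n' True"] by simp
  have "{pr (scode \<sigma>) (label_code (f \<sigma>)) |\<sigma>. length \<sigma> \<le> n} = {pr (scode \<sigma>) (label_code (f' \<sigma>)) |\<sigma>. length \<sigma> \<le> n'}"
    using hs_hcode_subset[of n f n' f'] hs_hcode_subset[of n' f' n f] 1 2 unfolding hs_hcode by blast
  then show "hcode n f = hcode n' f'" unfolding hcode_def n by simp
next
  assume eq: "hcode n f = hcode n' f'"
  then have "hs (hcode n f) \<subseteq> hs (hcode n' f')" "hs (hcode n' f') \<subseteq> hs (hcode n f)" by simp_all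
  then have "subset_in M E (lab n f) (lab n' f')" "subset_in M E (lab n' f') (lab n f)"
    unfolding hs_hcode_subset lab_subset by blast+
  then show "lab n f = lab n' f'"
    using extensionality[of "lab n f" "lab n' f'"] unfolding subset_in_def by blast
qed

lemma strings_upto_iff: "strings_upto_in M E (num n) d \<longleftrightarrow> d \<in> M \<and> el d = str ` {\<sigma>. length \<sigma> \<le> n}"
proof -
  have *: "(\<exists>k\<in>M. (E k (num n) \<or> k = num n) \<and> string_of_length_in M E k s) \<longleftrightarrow>
      s \<in> str ` {\<sigma>. length \<sigma> \<le> n}" for s
  proof
    assume "\<exists>k\<in>M. (E k (num n) \<or> k = num n) \<and> string_of_length_in M E k s"
    then obtain k where k: "E k (num n) \<or> k = num n" "string_of_length_in M E k s" by blast
    from string_num[OF k(2)] obtain m where m: "k = num m" by blast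
    then obtain \<sigma> where "length \<sigma> = m" "s = str \<sigma>" using k(2) string_iff by blast
    then show "s \<in> str ` {\<sigma>. length \<sigma> \<le> n}" using k(1) m by auto
  next
    assume "s \<in> str ` {\<sigma>. length \<sigma> \<le> n}"
    then obtain \<sigma> where s: "s = str \<sigma>" "length \<sigma> \<le> n" by blast
    then have "string_of_length_in M E (num (length \<sigma>)) s" unfolding string_iff by blast
    then show "\<exists>k\<in>M. (E k (num n) \<or> k = num n) \<and> string_of_length_in M E k s"
      using s(2) by (intro bexI[of _ "num (length \<sigma>)"]) auto
  qed
  show ?thesis unfolding strings_upto_in_def * el_def by auto
qed

lemma el_three: "el (num 3) = range (\<lambda>l. num (label_code l))"
proof -
  have "{..<3} = range label_code"
  proof
    show "{..<3} \<subseteq> range label_code" using ex_label_code by (metis lessThan_iff rangeI subsetI)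
    show "range label_code \<subseteq> {..<3}" using label_code_less by auto
  qed
  then show ?thesis unfolding el_num by (metis image_image)
qed

lemma labelling_iff:
  "g \<in> M \<Longrightarrow> (\<exists>w\<in>M. \<exists>n\<in>M. \<exists>d\<in>M. \<exists>l\<in>M. omega_in M E w \<and> E n w \<and> strings_upto_in M E n d \<and>
     numeral_in M E 3 l \<and> function_in M E g d l) \<longleftrightarrow> (\<exists>n f. g = lab n f)"
proof
  assume gM: "g \<in> M" and "\<exists>w\<in>M. \<exists>n\<in>M. \<exists>d\<in>M. \<exists>l\<in>M. omega_in M E w \<and> E n w \<and> strings_upto_in M E n d \<and>
     numeral_in M E 3 l \<and> function_in M E g d l"
  then obtain n d where n: "n \<in> M" "E n om" "strings_upto_in M E n d" "function_in M E g d (num 3)"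
    unfolding omega_iff numeral_iff by blast
  then obtain k where k: "n = num k" using el_om by (auto simp: el_def)
  have d: "d \<in> M" "el d = str ` {\<sigma>. length \<sigma> \<le> k}" using n(3) unfolding k strings_upto_iff by blast+
  obtain F where F: "\<And>u. u \<in> el d \<Longrightarrow> F u \<in> el (num 3)" "el g = (\<lambda>u. op u (F u)) ` el d"
    using n(4) unfolding function_iff[OF gM d(1) num_in] by blast
  define f where "f \<sigma> = (SOME l. F (str \<sigma>) = num (label_code l))" for \<sigma>
  have f: "F (str \<sigma>) = num (label_code (f \<sigma>))" if "length \<sigma> \<le> k" for \<sigma>
  proof -
    have "str \<sigma> \<in> el d" unfolding d(2) using that by blast
    then have "\<exists>l. F (str \<sigma>) = num (label_code l)" using F(1) unfolding el_three by blast
    then show ?thesis unfolding f_def by (rule someI_ex)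
  qed
  have "el g = (\<lambda>\<sigma>. op (str \<sigma>) (F (str \<sigma>))) ` {\<sigma>. length \<sigma> \<le> k}"
    unfolding F(2) d(2) by (simp add: image_image)
  also have "\<dots> = lg k f" unfolding lg_def using f by (intro image_cong) simp_all
  finally have "g = lab k f" using el_inject[OF gM lab_in, of k f] el_lab[of k f] by simp
  then show "\<exists>n f. g = lab n f" by blast
next
  assume "\<exists>n f. g = lab n f"
  then obtain n f where g: "g = lab n f" by blast
  define d where "d = mk (str ` {\<sigma>. length \<sigma> \<le> n})"
  have d: "d \<in> M \<and> el d = str ` {\<sigma>. length \<sigma> \<le> n}"
    unfolding d_def by (rule mk) (auto simp: finite_strings)
  have "inj str" by (rule injI) simp
  have "function_in M E g d (num 3)"
    unfolding g function_iff[OF lab_in conjunct1[OF d] num_in]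
  proof (intro exI[of _ "\<lambda>u. num (label_code (f (inv str u)))"] conjI ballI)
    show "num (label_code (f (inv str u))) \<in> el (num 3)" for u unfolding el_three by blast
    show "el (lab n f) = (\<lambda>u. op u (num (label_code (f (inv str u))))) ` el d"
      unfolding el_lab lg_def conjunct2[OF d] by (simp add: image_image inv_f_f[OF \<open>inj str\<close>])
  qed
  moreover have "strings_upto_in M E (num n) d" using d unfolding strings_upto_iff .
  moreover have "E (num n) om" using el_om by (auto simp: el_def)
  ultimately show "\<exists>w\<in>M. \<exists>n\<in>M. \<exists>d\<in>M. \<exists>l\<in>M. omega_in M E w \<and> E n w \<and> strings_upto_in M E n d \<and>
     numeral_in M E 3 l \<and> function_in M E g d l"
    unfolding omega_iff numeral_iff using om(1) num_in[of n] num_in[of 3] d by blast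
qed

definition rs :: "cantor set \<Rightarrow> 'a" where "rs Y = mk (fr ` Y)"

definition okr :: "cantor set \<Rightarrow> bool" where "okr Y \<longleftrightarrow> finite Y \<and> Y \<subseteq> RR"

lemma rs: "okr Y \<Longrightarrow> rs Y \<in> M \<and> el (rs Y) = fr ` Y"
  unfolding rs_def okr_def by (rule mk) (use fr in auto)

lemma rs_subset: "okr Y \<Longrightarrow> okr Y' \<Longrightarrow> subset_in M E (rs Y) (rs Y') \<longleftrightarrow> Y \<subseteq> Y'"
proof -
  assume Y: "okr Y" "okr Y'"
  have "subset_in M E (rs Y) (rs Y') \<longleftrightarrow> el (rs Y) \<subseteq> el (rs Y')"
    using rs[OF Y(1)] rs[OF Y(2)] by (intro subset_iff_el) simp_all
  also have "\<dots> \<longleftrightarrow> fr ` Y \<subseteq> fr ` Y'" using rs[OF Y(1)] rs[OF Y(2)] by simp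
  also have "\<dots> \<longleftrightarrow> Y \<subseteq> Y'"
  proof
    assume *: "fr ` Y \<subseteq> fr ` Y'"
    show "Y \<subseteq> Y'"
    proof
      fix z assume z: "z \<in> Y"
      then obtain z' where "z' \<in> Y'" "fr z = fr z'" using * by blast
      then show "z \<in> Y'" using z Y fr_inject[of z z'] unfolding okr_def by blast
    qed
  qed blast
  finally show ?thesis .
qed

lemma rs_eq: "okr Y \<Longrightarrow> okr Y' \<Longrightarrow> rs Y = rs Y' \<longleftrightarrow> Y = Y'"
proof
  assume Y: "okr Y" "okr Y'" and eq: "rs Y = rs Y'"
  have "subset_in M E (rs Y) (rs Y)" using rs[OF Y(1)] by (simp add: subset_in_def)
  then have "subset_in M E (rs Y) (rs Y')" "subset_in M E (rs Y') (rs Y)" using eq by simp_all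
  then show "Y = Y'" using rs_subset Y by blast
qed simp

text \<open>A set finite in the model is in bijection with a true number, so it is truly finite;
  conversely every finite subset of \<open>M\<close>, and every finite bijection, is represented by
  an element of the model.\<close>

lemma finite_reals_iff:
  "X \<in> M \<and> finite_in M E X \<and> (\<forall>a\<in>M. E a X \<longrightarrow> real_in M E a) \<longleftrightarrow> (\<exists>Y. okr Y \<and> X = rs Y)"
proof
  assume X: "X \<in> M \<and> finite_in M E X \<and> (\<forall>a\<in>M. E a X \<longrightarrow> real_in M E a)"
  then obtain n f where n: "n \<in> M" "E n om" "bijection_in M E f n X"
    unfolding finite_in_def omega_iff by blast
  then obtain k where k: "n = num k" using el_om by (auto simp: el_def)
  have fn: "function_in M E f (num k) X" using n(3) unfolding bijection_in_def k by blast
  then have fM: "f \<in> M" unfolding function_in_def by blast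
  obtain F where F: "el f = (\<lambda>u. op u (F u)) ` el (num k)" "\<And>u. u \<in> el (num k) \<Longrightarrow> F u \<in> el X"
    using fn X unfolding function_iff[OF fM num_in conjunct1[OF X]] by blast
  have "el X \<subseteq> F ` el (num k)"
  proof
    fix v assume v: "v \<in> el X"
    then obtain u where u: "u \<in> M" "app_in M E f u v"
      using n(3) unfolding bijection_in_def el_def by blast
    have vM: "v \<in> M" using v by (simp add: el_def)
    have "op u v \<in> el f" using u(2) app_iff_el[OF fM u(1) vM] by simp
    then obtain u' where u': "u' \<in> el (num k)" "op u v = op u' (F u')" unfolding F(1) by blast
    then have "v = F u'" using op_inject[OF u(1) vM, of u' "F u'"] F(2)[OF u'(1)] by (auto simp: el_def)
    then show "v \<in> F ` el (num k)" using u'(1) by blast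
  qed
  then have fin: "finite (el X)" by (rule finite_subset) (simp add: el_num)
  define Y where "Y = {z \<in> RR. fr z \<in> el X}"
  have img: "fr ` Y = el X"
  proof
    show "fr ` Y \<subseteq> el X" unfolding Y_def by blast
    show "el X \<subseteq> fr ` Y"
    proof
      fix a assume a: "a \<in> el X"
      then have "a \<in> M" "real_in M E a" using X by (auto simp: el_def)
      then obtain z where "el a = gr z" unfolding real_iff by blast
      then have "z \<in> RR \<and> a = fr z" using fr_eq[OF \<open>a \<in> M\<close>] by blast
      then show "a \<in> fr ` Y" using a unfolding Y_def by blast
    qed
  qed
  have "inj_on fr Y" by (rule inj_onI) (auto simp: fr_inject Y_def)
  then have "finite Y" using fin unfolding img[symmetric] by (rule finite_imageD[rotated])
  then have "okr Y" unfolding okr_def Y_def by blast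
  moreover have "X = rs Y" unfolding rs_def img using mk_eqI[OF _ fin] X by blast
  ultimately show "\<exists>Y. okr Y \<and> X = rs Y" by blast
next
  assume "\<exists>Y. okr Y \<and> X = rs Y"
  then obtain Y where Y: "okr Y" "X = rs Y" by blast
  have X: "X \<in> M" "el X = fr ` Y" using rs[OF Y(1)] Y(2) by auto
  have "real_in M E a" if "a \<in> M" "E a X" for a
  proof -
    have "a \<in> fr ` Y" using that X(2) by (auto simp: el_def)
    then show ?thesis unfolding real_iff using that fr Y(1) unfolding okr_def by blast
  qed
  moreover have "finite_in M E X"
  proof -
    have fY: "finite (el X)" using X(2) Y(1) by (simp add: okr_def)
    then obtain h where h: "bij_betw h {..<card (el X)} (el X)"
      using ex_bij_betw_nat_finite[of "el X"] by (auto simp: atLeast0LessThan)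
    let ?n = "card (el X)"
    have hM: "h i \<in> M" if "i < ?n" for i using h that by (auto simp: bij_betw_def el_def)
    define f where "f = mk ((\<lambda>i. op (num i) (h i)) ` {..<?n})"
    have f: "f \<in> M \<and> el f = (\<lambda>i. op (num i) (h i)) ` {..<?n}"
      unfolding f_def by (rule mk) (auto intro!: op_in hM)
    have "function_in M E f (num ?n) X"
      unfolding function_iff[OF conjunct1[OF f] num_in X(1)]
    proof (intro exI[of _ "\<lambda>u. h (N u)"] conjI ballI)
      show "h (N u) \<in> el X" if "u \<in> el (num ?n)" for u
        using that h unfolding el_num by (auto simp: bij_betw_def)
      show "el f = (\<lambda>u. op u (h (N u))) ` el (num ?n)"
        using f unfolding el_num by (simp add: image_image)
    qed
    moreover have "\<exists>!u. u \<in> M \<and> app_in M E f u v" if v: "v \<in> M" "E v X" for v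
    proof -
      have "v \<in> el X" using v by (simp add: el_def)
      then obtain i where i: "i < ?n" "v = h i" using h by (auto simp: bij_betw_def)
      have app: "app_in M E f u v \<longleftrightarrow> op u v \<in> el f" if "u \<in> M" for u
        using f that v(1) by (intro app_iff_el) simp_all
      show ?thesis
      proof (rule ex1I[of _ "num i"])
        show "num i \<in> M \<and> app_in M E f (num i) v" using app[of "num i"] f i by auto
        fix u assume u: "u \<in> M \<and> app_in M E f u v"
        then have "op u v \<in> (\<lambda>i. op (num i) (h i)) ` {..<?n}" using app f by blast
        then obtain j where j: "j < ?n" "op u v = op (num j) (h j)" by blast
        then have "u = num j" "v = h j" using op_inject[of u v "num j" "h j"] u v(1) hM by auto
        moreover have "i = j" using h i j(1) \<open>v = h j\<close> by (auto simp: bij_betw_def inj_on_def)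
        ultimately show "u = num i" by simp
      qed
    qed
    ultimately have "bijection_in M E f (num ?n) X" unfolding bijection_in_def by blast
    moreover have "E (num ?n) om" using el_om by (auto simp: el_def)
    ultimately show ?thesis
      unfolding finite_in_def omega_iff using om(1) f num_in[of ?n] by blast
  qed
  ultimately show "X \<in> M \<and> finite_in M E X \<and> (\<forall>a\<in>M. E a X \<longrightarrow> real_in M E a)" using X by blast
qed

definition cnd :: "nat \<Rightarrow> (bool list \<Rightarrow> label) \<Rightarrow> cantor set \<Rightarrow> 'a" where
  "cnd n f Y = op (lab n f) (rs Y)"

lemma cnd_in: "okr Y \<Longrightarrow> cnd n f Y \<in> M"
  unfolding cnd_def using rs by (intro op_in) auto

lemma cnd_eq: "okr Y \<Longrightarrow> okr Y' \<Longrightarrow> cnd n f Y = cnd n' f' Y' \<longleftrightarrow> hcode n f = hcode n' f' \<and> Y = Y'"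
proof -
  assume Y: "okr Y" "okr Y'"
  then have "rs Y \<in> M" "rs Y' \<in> M" using rs by blast+
  then show ?thesis unfolding cnd_def by (simp add: op_inject lab_eq rs_eq[OF Y])
qed

lemma KS_pair_iff:
  "KS_pair M E p g X \<longleftrightarrow> (\<exists>n f Y. okr Y \<and> g = lab n f \<and> X = rs Y \<and> p = cnd n f Y)"
proof
  assume a: "KS_pair M E p g X"
  then have M: "p \<in> M" "g \<in> M" "X \<in> M" and op: "opair_in M E g X p" unfolding KS_pair_def by blast+
  have "\<exists>n f. g = lab n f" using a labelling_iff[OF M(2)] unfolding KS_pair_def by blast
  moreover have "\<exists>Y. okr Y \<and> X = rs Y" using a finite_reals_iff[of X] unfolding KS_pair_def by blast
  moreover have "p = op g X" using op opair_iff[OF M(2,3,1)] by blast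
  ultimately show "\<exists>n f Y. okr Y \<and> g = lab n f \<and> X = rs Y \<and> p = cnd n f Y"
    unfolding cnd_def by blast
next
  assume "\<exists>n f Y. okr Y \<and> g = lab n f \<and> X = rs Y \<and> p = cnd n f Y"
  then obtain n f Y where a: "okr Y" "g = lab n f" "X = rs Y" "p = cnd n f Y" by blast
  have M: "p \<in> M" "g \<in> M" "X \<in> M" using a cnd_in rs by auto
  have "\<exists>n f. g = lab n f" using a by blast
  moreover have "\<exists>Y. okr Y \<and> X = rs Y" using a by blast
  moreover have "opair_in M E g X p" using opair_iff[OF M(2,3,1)] a by (simp add: cnd_def)
  ultimately show "KS_pair M E p g X"
    unfolding KS_pair_def using M labelling_iff[OF M(2)] finite_reals_iff[of X] by blast
qed

lemma KS_cond_iff: "KS_cond M E p \<longleftrightarrow> (\<exists>n f Y. okr Y \<and> p = cnd n f Y)"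
  unfolding KS_cond_def KS_pair_iff by blast

lemma initial_segment_iff: "z \<in> RR \<Longrightarrow> s \<in> M \<Longrightarrow>
    initial_segment_in M E s (fr z) \<longleftrightarrow> (\<exists>\<sigma>. s = str \<sigma> \<and> pref (scode \<sigma>) z)"
proof -
  assume z: "z \<in> RR" and s: "s \<in> M"
  have 1: "(\<exists>k\<in>M. string_of_length_in M E k s) \<longleftrightarrow> (\<exists>\<sigma>. s = str \<sigma>)"
  proof
    assume "\<exists>k\<in>M. string_of_length_in M E k s"
    then obtain k where k: "string_of_length_in M E k s" by blast
    then obtain n where "k = num n" using string_num by blast
    then show "\<exists>\<sigma>. s = str \<sigma>" using k string_iff by blast
  next
    assume "\<exists>\<sigma>. s = str \<sigma>"
    then show "\<exists>k\<in>M. string_of_length_in M E k s" using string_iff num_in by blast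
  qed
  have 2: "subset_in M E (str \<sigma>) (fr z) \<longleftrightarrow> pref (scode \<sigma>) z" for \<sigma>
  proof -
    have "subset_in M E (str \<sigma>) (fr z) \<longleftrightarrow> el (str \<sigma>) \<subseteq> el (fr z)"
      using fr[OF z] by (intro subset_iff_el) simp_all
    also have "\<dots> \<longleftrightarrow> (\<forall>i<length \<sigma>. op (num i) (num (of_bool (\<sigma> ! i))) \<in> gr z)"
      using str[of \<sigma>] fr[OF z] by auto
    also have "\<dots> \<longleftrightarrow> pref (scode \<sigma>) z" unfolding mem_gr pref_scode by simp
    finally show ?thesis .
  qed
  show ?thesis unfolding initial_segment_in_def 1 using 2 by blast
qed

text \<open>Conditions decompose uniquely into labelling and reals, which resolves the existential
  quantifiers in \<open>KS_le\<close>.\<close>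

lemma KS_le_cnd:
  assumes Y: "okr Y" "okr Y'"
  shows "KS_le M E (cnd n' f' Y') (cnd n f Y) \<longleftrightarrow> le Y (hcode n' f') (hcode n f) \<and> Y \<subseteq> Y'"
proof -
  let ?C = "\<forall>a\<in>M. E a (rs Y) \<longrightarrow> (\<forall>s\<in>M. initial_segment_in M E s a \<and> \<not> (\<exists>l\<in>M. app_in M E (lab n f) s l) \<longrightarrow>
         (\<forall>l\<in>M. app_in M E (lab n' f') s l \<longrightarrow> numeral_in M E 2 l))"
  have "KS_le M E (cnd n' f' Y') (cnd n f Y) \<longleftrightarrow>
      subset_in M E (lab n f) (lab n' f') \<and> subset_in M E (rs Y) (rs Y') \<and> ?C"
  proof
    assume "KS_le M E (cnd n' f' Y') (cnd n f Y)"
    then obtain gq Xq gp Xp where q: "KS_pair M E (cnd n' f' Y') gq Xq" and p: "KS_pair M E (cnd n f Y) gp Xp"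
      and *: "subset_in M E gp gq \<and> subset_in M E Xp Xq \<and> (\<forall>a\<in>M. E a Xp \<longrightarrow>
       (\<forall>s\<in>M. initial_segment_in M E s a \<and> \<not> (\<exists>l\<in>M. app_in M E gp s l) \<longrightarrow>
         (\<forall>l\<in>M. app_in M E gq s l \<longrightarrow> numeral_in M E 2 l)))" unfolding KS_le_def by blast
    have "gq = lab n' f' \<and> Xq = rs Y'"
      using q unfolding KS_pair_iff using cnd_eq[OF Y(2)] lab_eq by metis
    moreover have "gp = lab n f \<and> Xp = rs Y"
      using p unfolding KS_pair_iff using cnd_eq[OF Y(1)] lab_eq by metis
    ultimately show "subset_in M E (lab n f) (lab n' f') \<and> subset_in M E (rs Y) (rs Y') \<and> ?C"
      using * by simp
  next
    assume *: "subset_in M E (lab n f) (lab n' f') \<and> subset_in M E (rs Y) (rs Y') \<and> ?C"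
    have "KS_pair M E (cnd n' f' Y') (lab n' f') (rs Y')" "KS_pair M E (cnd n f Y) (lab n f) (rs Y)"
      unfolding KS_pair_iff using Y by blast+
    then show "KS_le M E (cnd n' f' Y') (cnd n f Y)" unfolding KS_le_def using * by blast
  qed
  moreover have "?C \<longleftrightarrow> (\<forall>y\<in>Y. \<forall>\<sigma>. pref (scode \<sigma>) y \<and> n < length \<sigma> \<and> length \<sigma> \<le> n' \<longrightarrow> f' \<sigma> = LBot)"
  proof -
    have el: "a \<in> M \<and> E a (rs Y) \<longleftrightarrow> a \<in> fr ` Y" for a using rs[OF Y(1)] by (auto simp: el_def)
    have lb: "label_code l = 2 \<longleftrightarrow> l = LBot" for l by (cases l) auto
    have ex: "(\<exists>l\<in>M. app_in M E (lab n f) (str \<sigma>) l) \<longleftrightarrow> length \<sigma> \<le> n" for \<sigma>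
      using app_lab[OF str_in, of _ n f \<sigma>] by auto
    have al: "(\<forall>l\<in>M. app_in M E (lab n' f') (str \<sigma>) l \<longrightarrow> numeral_in M E 2 l) \<longleftrightarrow>
        (length \<sigma> \<le> n' \<longrightarrow> f' \<sigma> = LBot)" for \<sigma>
      unfolding numeral_iff using app_lab[OF str_in, of _ n' f' \<sigma>] lb by auto
    have one: "(\<forall>s\<in>M. initial_segment_in M E s (fr y) \<and> \<not> (\<exists>l\<in>M. app_in M E (lab n f) s l) \<longrightarrow>
         (\<forall>l\<in>M. app_in M E (lab n' f') s l \<longrightarrow> numeral_in M E 2 l)) \<longleftrightarrow>
       (\<forall>\<sigma>. pref (scode \<sigma>) y \<and> n < length \<sigma> \<and> length \<sigma> \<le> n' \<longrightarrow> f' \<sigma> = LBot)" (is "?L \<longleftrightarrow> ?R")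
      if y: "y \<in> Y" for y
    proof -
      have yR: "y \<in> RR" using y Y(1) by (auto simp: okr_def)
      show ?thesis
      proof
        assume L: ?L
        show ?R
        proof (intro allI impI)
          fix \<sigma> assume s: "pref (scode \<sigma>) y \<and> n < length \<sigma> \<and> length \<sigma> \<le> n'"
          then have "initial_segment_in M E (str \<sigma>) (fr y)" using initial_segment_iff[OF yR str_in] by blast
          with L s have "\<forall>l\<in>M. app_in M E (lab n' f') (str \<sigma>) l \<longrightarrow> numeral_in M E 2 l"
            using ex[of \<sigma>] str_in[of \<sigma>] by (meson not_le)
          then show "f' \<sigma> = LBot" using al s by blast
        qed
      next
        assume R: ?R
        show ?L
        proof (intro ballI impI, elim conjE)
          fix s l assume s: "s \<in> M" "initial_segment_in M E s (fr y)" "\<not> (\<exists>l\<in>M. app_in M E (lab n f) s l)"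
            and l: "l \<in> M" "app_in M E (lab n' f') s l"
          obtain \<sigma> where \<sigma>: "s = str \<sigma>" "pref (scode \<sigma>) y" using s initial_segment_iff[OF yR s(1)] by blast
          have "\<not> length \<sigma> \<le> n" using s(3) ex \<sigma> by simp
          then have "length \<sigma> \<le> n' \<longrightarrow> f' \<sigma> = LBot" using R \<sigma>(2) by simp
          then show "numeral_in M E 2 l" using al l \<sigma>(1) by blast
        qed
      qed
    qed
    have "?C \<longleftrightarrow> (\<forall>a. a \<in> fr ` Y \<longrightarrow> (\<forall>s\<in>M. initial_segment_in M E s a \<and> \<not> (\<exists>l\<in>M. app_in M E (lab n f) s l) \<longrightarrow>
         (\<forall>l\<in>M. app_in M E (lab n' f') s l \<longrightarrow> numeral_in M E 2 l)))"
      unfolding el[symmetric] by (simp only: Ball_def imp_conjL)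
    also have "\<dots> \<longleftrightarrow> (\<forall>y\<in>Y. \<forall>s\<in>M. initial_segment_in M E s (fr y) \<and> \<not> (\<exists>l\<in>M. app_in M E (lab n f) s l) \<longrightarrow>
         (\<forall>l\<in>M. app_in M E (lab n' f') s l \<longrightarrow> numeral_in M E 2 l))" by (simp only: image_iff) blast
    also have "\<dots> \<longleftrightarrow> (\<forall>y\<in>Y. \<forall>\<sigma>. pref (scode \<sigma>) y \<and> n < length \<sigma> \<and> length \<sigma> \<le> n' \<longrightarrow> f' \<sigma> = LBot)"
      by (rule ball_cong[OF refl one])
    finally show ?thesis .
  qed
  ultimately show ?thesis
    unfolding le_hcode lab_subset rs_subset[OF Y] by blast
qed

lemma KS_labelling_cnd: "okr Y \<Longrightarrow> (\<sigma>, l) \<in> KS_labelling M E (cnd n f Y) \<longleftrightarrow> length \<sigma> \<le> n \<and> l = f \<sigma>"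
proof -
  assume Y: "okr Y"
  have "(\<sigma>, l) \<in> KS_labelling M E (cnd n f Y) \<longleftrightarrow>
      (\<exists>g\<in>M. \<exists>X\<in>M. KS_pair M E (cnd n f Y) g X \<and> app_in M E g (str \<sigma>) (num (label_code l)))"
    unfolding KS_labelling_def numeral_iff using codes_string_iff str_in num_in by auto
  also have "\<dots> \<longleftrightarrow> app_in M E (lab n f) (str \<sigma>) (num (label_code l))"
  proof -
    have "KS_pair M E (cnd n f Y) g X \<longleftrightarrow> g = lab n f \<and> X = rs Y" for g X
      unfolding KS_pair_iff using cnd_eq[OF Y] lab_eq Y by metis
    then show ?thesis using rs[OF Y] by auto
  qed
  also have "\<dots> \<longleftrightarrow> length \<sigma> \<le> n \<and> l = f \<sigma>" using app_lab[OF str_in num_in] by simp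
  finally show ?thesis .
qed

end

section \<open>Dense sets of the model, and the assembly of the proof\<close>

context zfm
begin

subsection \<open>Dense sets of the model\<close>

text \<open>The next three predicates are the formulas defining, in terms of codes, the strings, the
  sections of a real and the conditions of the model.\<close>

definition strc :: "'a \<Rightarrow> nat \<Rightarrow> bool" where
  "strc s a \<longleftrightarrow> (\<forall>t\<in>M. E t s \<longleftrightarrow>
     (\<exists>i v. (i < lenc a \<and> v = nthc a i) \<and> opair_in M E (num i) (num v) t))"

definition realc :: "'a \<Rightarrow> 'a \<Rightarrow> nat \<Rightarrow> bool" where
  "realc b c i \<longleftrightarrow> (\<forall>t\<in>M. E t b \<longleftrightarrow>
     (\<exists>j v w. w = pr i j \<and> (Rl c w \<and> v = 1 \<or> \<not> Rl c w \<and> v = 0) \<and> opair_in M E (num j) (num v) t))"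

definition cndc :: "'a \<Rightarrow> nat \<Rightarrow> nat \<Rightarrow> 'a \<Rightarrow> bool" where
  "cndc p h k c \<longleftrightarrow> valid h \<and> (\<exists>g\<in>M. \<exists>X\<in>M. opair_in M E g X p \<and>
     (\<forall>t\<in>M. E t g \<longleftrightarrow> (\<exists>s\<in>M. \<exists>q a l. (q \<in> set_decode (sn h) \<and> a = fs q \<and> l = sn q) \<and> strc s a \<and>
        opair_in M E s (num l) t)) \<and>
     (\<forall>b\<in>M. E b X \<longleftrightarrow> (\<exists>i. i < k \<and> realc b c i)))"

lemma el_eqI: "S \<subseteq> M \<Longrightarrow> el a = S \<longleftrightarrow> (\<forall>t\<in>M. E t a \<longleftrightarrow> t \<in> S)"
  unfolding el_def by blast

lemma strc_iff: "s \<in> M \<Longrightarrow> strc s (scode \<sigma>) \<longleftrightarrow> s = str \<sigma>"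
proof -
  assume s: "s \<in> M"
  have "(\<exists>i v. (i < lenc (scode \<sigma>) \<and> v = nthc (scode \<sigma>) i) \<and> opair_in M E (num i) (num v) t) \<longleftrightarrow>
      t \<in> el (str \<sigma>)" if "t \<in> M" for t
    unfolding conjunct2[OF str] using that by (auto simp: opair_iff nthc_scode)
  then have "strc s (scode \<sigma>) \<longleftrightarrow> (\<forall>t\<in>M. E t s \<longleftrightarrow> t \<in> el (str \<sigma>))"
    unfolding strc_def by simp
  also have "\<dots> \<longleftrightarrow> el s = el (str \<sigma>)" by (rule el_eqI[symmetric]) (simp add: el_def)
  finally show ?thesis using el_inject[OF s str_in] by simp
qed

lemma realc_iff: "b \<in> M \<Longrightarrow> realc b c i \<longleftrightarrow> el b = gr (sec (Rl c) i)"
proof -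
  assume b: "b \<in> M"
  have "(\<exists>j v w. w = pr i j \<and> (Rl c w \<and> v = 1 \<or> \<not> Rl c w \<and> v = 0) \<and> opair_in M E (num j) (num v) t) \<longleftrightarrow>
      t \<in> gr (sec (Rl c) i)" if t: "t \<in> M" for t
  proof -
    have one: "(\<exists>v w. w = pr i j \<and> (Rl c w \<and> v = 1 \<or> \<not> Rl c w \<and> v = 0) \<and> opair_in M E (num j) (num v) t) \<longleftrightarrow>
        t = op (num j) (num (of_bool (sec (Rl c) i j)))" for j
      using t by (cases "Rl c (pr i j)") (auto simp: opair_iff sec_def)
    show ?thesis unfolding one gr_def by blast
  qed
  then have "realc b c i \<longleftrightarrow> (\<forall>t\<in>M. E t b \<longleftrightarrow> t \<in> gr (sec (Rl c) i))"
    unfolding realc_def by simp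
  also have "\<dots> \<longleftrightarrow> el b = gr (sec (Rl c) i)" by (rule el_eqI[symmetric]) (rule gr_subset)
  finally show ?thesis .
qed

lemma cndc_iff:
  assumes p: "p \<in> M" and Y: "okr (secs k (Rl c))"
  shows "cndc p (hcode n f) k c \<longleftrightarrow> p = cnd n f (secs k (Rl c))"
proof -
  have v: "valid (hcode n f)" unfolding valid_def by blast
  have 1: "(\<forall>t\<in>M. E t g \<longleftrightarrow> (\<exists>s\<in>M. \<exists>q a l. (q \<in> hs (hcode n f) \<and> a = fs q \<and> l = sn q) \<and> strc s a \<and>
        opair_in M E s (num l) t)) \<longleftrightarrow> g = lab n f" if g: "g \<in> M" for g
  proof -
    have "(\<exists>s\<in>M. \<exists>q a l. (q \<in> hs (hcode n f) \<and> a = fs q \<and> l = sn q) \<and> strc s a \<and> opair_in M E s (num l) t) \<longleftrightarrow>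
        t \<in> lg n f" if t: "t \<in> M" for t
    proof -
      have "(\<exists>s\<in>M. \<exists>q a l. (q \<in> hs (hcode n f) \<and> a = fs q \<and> l = sn q) \<and> strc s a \<and> opair_in M E s (num l) t) \<longleftrightarrow>
          (\<exists>s\<in>M. \<exists>\<sigma>. length \<sigma> \<le> n \<and> strc s (scode \<sigma>) \<and> opair_in M E s (num (label_code (f \<sigma>))) t)"
      proof (rule bex_cong[OF refl], rule iffI)
        fix s assume "\<exists>q a l. (q \<in> hs (hcode n f) \<and> a = fs q \<and> l = sn q) \<and> strc s a \<and> opair_in M E s (num l) t"
        then obtain q where q: "q \<in> hs (hcode n f)" "strc s (fs q)" "opair_in M E s (num (sn q)) t" by blast
        from q(1) obtain \<sigma> where "q = pr (scode \<sigma>) (label_code (f \<sigma>))" "length \<sigma> \<le> n"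
          unfolding hs_hcode by blast
        then show "\<exists>\<sigma>. length \<sigma> \<le> n \<and> strc s (scode \<sigma>) \<and> opair_in M E s (num (label_code (f \<sigma>))) t"
          using q by auto
      next
        fix s assume "\<exists>\<sigma>. length \<sigma> \<le> n \<and> strc s (scode \<sigma>) \<and> opair_in M E s (num (label_code (f \<sigma>))) t"
        then obtain \<sigma> where \<sigma>: "length \<sigma> \<le> n" "strc s (scode \<sigma>)" "opair_in M E s (num (label_code (f \<sigma>))) t"
          by blast
        then have "pr (scode \<sigma>) (label_code (f \<sigma>)) \<in> hs (hcode n f)" unfolding hs_hcode by blast
        then show "\<exists>q a l. (q \<in> hs (hcode n f) \<and> a = fs q \<and> l = sn q) \<and> strc s a \<and> opair_in M E s (num l) t"
          using \<sigma>(2,3) by (intro exI[of _ "pr (scode \<sigma>) (label_code (f \<sigma>))"] exI[of _ "scode \<sigma>"]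
              exI[of _ "label_code (f \<sigma>)"]) simp
      qed
      also have "\<dots> \<longleftrightarrow> (\<exists>\<sigma>. length \<sigma> \<le> n \<and> t = op (str \<sigma>) (num (label_code (f \<sigma>))))"
      proof -
        have "(\<exists>s\<in>M. strc s (scode \<sigma>) \<and> opair_in M E s (num l) t) \<longleftrightarrow> t = op (str \<sigma>) (num l)" for \<sigma> l
          using strc_iff str_in t opair_iff[OF str_in num_in t] by auto
        then show ?thesis by blast
      qed
      also have "\<dots> \<longleftrightarrow> t \<in> lg n f" unfolding lg_def by blast
      finally show ?thesis .
    qed
    then have "(\<forall>t\<in>M. E t g \<longleftrightarrow> (\<exists>s\<in>M. \<exists>q a l. (q \<in> hs (hcode n f) \<and> a = fs q \<and> l = sn q) \<and> strc s a \<and>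
        opair_in M E s (num l) t)) \<longleftrightarrow> (\<forall>t\<in>M. E t g \<longleftrightarrow> t \<in> lg n f)" by simp
    also have "\<dots> \<longleftrightarrow> el g = lg n f"
      by (rule el_eqI[symmetric]) (auto simp: lg_def intro: op_in)
    also have "\<dots> \<longleftrightarrow> g = lab n f" using el_inject[OF g lab_in, of n f] el_lab[of n f] by simp
    finally show ?thesis .
  qed
  have 2: "(\<forall>b\<in>M. E b X \<longleftrightarrow> (\<exists>i. i < k \<and> realc b c i)) \<longleftrightarrow> X = rs (secs k (Rl c))" if X: "X \<in> M" for X
  proof -
    have "(\<exists>i. i < k \<and> realc b c i) \<longleftrightarrow> b \<in> fr ` secs k (Rl c)" if b: "b \<in> M" for b
    proof -
      have "el b = gr (sec (Rl c) i) \<longleftrightarrow> b = fr (sec (Rl c) i)" if "i < k" for i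
      proof -
        have "sec (Rl c) i \<in> RR" using Y that unfolding okr_def secs_def by blast
        then show ?thesis using fr[of "sec (Rl c) i"] fr_eq[OF b] by blast
      qed
      then show ?thesis unfolding realc_iff[OF b] secs_def by auto
    qed
    then have "(\<forall>b\<in>M. E b X \<longleftrightarrow> (\<exists>i. i < k \<and> realc b c i)) \<longleftrightarrow> (\<forall>b\<in>M. E b X \<longleftrightarrow> b \<in> fr ` secs k (Rl c))"
      by simp
    also have "\<dots> \<longleftrightarrow> el X = fr ` secs k (Rl c)"
      by (rule el_eqI[symmetric]) (use fr Y in \<open>auto simp: okr_def\<close>)
    also have "\<dots> \<longleftrightarrow> X = rs (secs k (Rl c))" using rs[OF Y] el_inject[OF X, of "rs (secs k (Rl c))"] by simp
    finally show ?thesis .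
  qed
  have "cndc p (hcode n f) k c \<longleftrightarrow> (\<exists>g\<in>M. \<exists>X\<in>M. opair_in M E g X p \<and> g = lab n f \<and> X = rs (secs k (Rl c)))"
    unfolding cndc_def using v 1 2 by simp
  also have "\<dots> \<longleftrightarrow> opair_in M E (lab n f) (rs (secs k (Rl c))) p" using rs[OF Y] lab_in by blast
  also have "\<dots> \<longleftrightarrow> p = cnd n f (secs k (Rl c))"
    unfolding cnd_def using opair_iff[OF lab_in _ p] rs[OF Y] by blast
  finally show ?thesis .
qed

context
  fixes c0 assumes c0: "c0 \<in> M"
begin

interpretation w: world "Rl c0" RR Df
  by (rule world[OF c0])

lemma dfn_strc: "dfn (\<lambda>e. strc (e s) (N (e a)))"
  unfolding strc_def
proof (intro dfn_all dfn_iff dfn_mem dfn_exN, rule dfn_conj)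
  show "dfn (\<lambda>e. N (e (Suc 0)) < lenc (N (e (Suc (Suc (Suc a))))) \<and>
      N (e 0) = nthc (N (e (Suc (Suc (Suc a))))) (N (e (Suc 0))))"
    by (rule dfn_cb[OF c0 refl, of "\<lambda>e. e (Suc 0) < lenc (e (Suc (Suc (Suc a)))) \<and>
      e 0 = nthc (e (Suc (Suc (Suc a)))) (e (Suc 0))"]) (intro cb_conj cb_less cb_eq cf_lenc cf_nthc cf_var)
  show "dfn (\<lambda>e. opair_in M E (num (N (e (Suc 0)))) (num (N (e 0))) (e (Suc (Suc 0))))"
    by (rule dfn_opair_nn)
qed

lemma dfn_pr: "dfn (\<lambda>e. N (e i) = pr (N (e j)) (N (e k)))"
  by (rule dfn_cb[OF c0 refl, of "\<lambda>e. e i = pr (e j) (e k)"]) (intro cb_eq cf_pr cf_var)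

lemma dfn_pr_const: "dfn (\<lambda>e. N (e i) = pr m (N (e k)))"
  by (rule dfn_cb[OF c0 refl, of "\<lambda>e. e i = pr m (e k)"]) (intro cb_eq cf_pr cf_var cf_const)

lemma dfn_realc: "dfn (\<lambda>e. realc (e b) (e c) (N (e i)))"
  unfolding realc_def
  by (intro dfn_all dfn_iff dfn_mem dfn_exN dfn_conj dfn_disj dfn_not dfn_pr dfn_Rl dfn_N_const dfn_opair_nn)

lemma dfn_cndc: "dfn (\<lambda>e. cndc (e p) (N (e h)) (N (e k)) (e c))"
  unfolding cndc_def
proof (intro dfn_conj[of "\<lambda>e. valid (N (e h))"] dfn_ex)
  show "dfn (\<lambda>e. valid (N (e h)))"
    by (rule dfn_cb[OF c0 refl, of "\<lambda>e. valid (e h)"]) (intro cb_valid cf_var)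
  let ?h = "Suc (Suc (Suc (Suc (Suc (Suc (Suc h))))))"
  have "dfn (\<lambda>e. N (e (Suc (Suc 0))) \<in> set_decode (sn (N (e ?h))) \<and> N (e (Suc 0)) = fs (N (e (Suc (Suc 0)))) \<and>
      N (e 0) = sn (N (e (Suc (Suc 0)))))"
    by (rule dfn_cb[OF c0 refl, of "\<lambda>e. e (Suc (Suc 0)) \<in> set_decode (sn (e ?h)) \<and>
      e (Suc 0) = fs (e (Suc (Suc 0))) \<and> e 0 = sn (e (Suc (Suc 0)))"])
      (intro cb_conj cb_mem cb_eq cf_sn cf_fs cf_var)
  then show "dfn (\<lambda>e. opair_in M E (e (Suc 0)) (e 0) (e (Suc (Suc p))) \<and>
     (\<forall>t\<in>M. E t (e (Suc 0)) \<longleftrightarrow> (\<exists>s\<in>M. \<exists>q a l. (q \<in> set_decode (sn (N (e (Suc (Suc h))))) \<and> a = fs q \<and> l = sn q) \<and>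
        strc s a \<and> opair_in M E s (num l) t)) \<and>
     (\<forall>b\<in>M. E b (e 0) \<longleftrightarrow> (\<exists>i. i < N (e (Suc (Suc k))) \<and> realc b (e (Suc (Suc c))) i)))"
    by (intro dfn_conj[of "\<lambda>e. opair_in M E (e (Suc 0)) (e 0) (e (Suc (Suc p)))"]
        dfn_conj[of "\<lambda>e. \<forall>t\<in>M. E t (e (Suc 0)) \<longleftrightarrow> (\<exists>s\<in>M. \<exists>q a l. (q \<in> set_decode (sn (N (e (Suc (Suc h))))) \<and>
          a = fs q \<and> l = sn q) \<and> strc s a \<and> opair_in M E s (num l) t)"]
        dfn_opair_in dfn_all dfn_iff dfn_mem dfn_ex dfn_exN
        dfn_conj[OF _ dfn_conj[OF dfn_strc dfn_opair_n]] dfn_conj[OF dfn_N_less dfn_realc])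
qed

text \<open>An element that codes a real by \<open>Rl\<close> may have further members; intersecting
  it with omega brings it into the power set of omega.\<close>

lemma RR_subset_om: "z \<in> RR \<Longrightarrow> \<exists>u\<in>M. subset_in M E u om \<and> Rl u = z"
proof -
  assume "z \<in> RR"
  then obtain a where a: "a \<in> M" "Rl a = z" unfolding RR_iff by blast
  from dfn_separation[OF dfn_mem_const[OF a(1)] om(1)] obtain u where
    u: "u \<in> M" "\<forall>v\<in>M. E v u \<longleftrightarrow> E v om \<and> E v a" by blast
  have "E (num n) om" for n using el_om by (auto simp: el_def)
  then have "Rl u = z" using u a(2) unfolding Rl_def by (auto simp: fun_eq_iff)
  moreover have "subset_in M E u om" unfolding subset_in_def using u om(1) by blast
  ultimately show ?thesis using u(1) by blast
qed

lemma okr_secs: "c \<in> M \<Longrightarrow> okr (secs k (Rl c))"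
  using w.fin_secs[of "Rl c" k] RR_iff unfolding okr_def w.fin_def by blast

text \<open>With no set of all conditions at hand to separate from, the set is obtained by
  replacement from the power set of omega: a subset \<open>u\<close> codes a labelling, a number of
  reals, and a real holding them as columns.\<close>

lemma ex_dense_set:
  assumes P: "Df (\<lambda>z e. P (e 0) (secs (e 1) z))"
  shows "\<exists>D\<in>M. \<forall>p\<in>M. E p D \<longleftrightarrow> (\<exists>n f Y. okr Y \<and> p = cnd n f Y \<and> P (hcode n f) Y)"
proof -
  \<comment> \<open>Columns \<open>0\<close> and \<open>1\<close> of \<open>u\<close> are singletons
    holding \<open>h\<close> and \<open>k\<close>, and column \<open>2\<close> is the real; so
    \<open>u\<close> determines the condition, as replacement demands.\<close>
  define Q where "Q u p \<longleftrightarrow> (\<exists>h k. \<exists>c\<in>M.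
      (\<forall>j v. v = pr 0 j \<longrightarrow> (Rl u v \<longleftrightarrow> j = h)) \<and> (\<forall>j v. v = pr 1 j \<longrightarrow> (Rl u v \<longleftrightarrow> j = k)) \<and>
      (\<forall>j v. v = pr 2 j \<longrightarrow> (Rl u v \<longleftrightarrow> Rl c j)) \<and> cndc p h k c \<and> P h (secs k (Rl c)))" for u p
  have Pd: "dfn (\<lambda>e. P (N (e (Suc (Suc 0)))) (secs (N (e (Suc 0))) (Rl (e 0))))"
    using dfn_ren[OF P[unfolded Df_def], of "\<lambda>i. if i = 0 then 0 else if i = 1 then 2 else 1"]
    by (simp add: numeral_2_eq_2)
  have Qd: "dfn (\<lambda>e. Q (e 0) (e 1))"
    unfolding Q_def
    by (intro dfn_exN dfn_ex dfn_conj dfn_allN dfn_imp dfn_iff dfn_Rl dfn_N_eq dfn_pr_const dfn_cndc Pd)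
  obtain pw where pw: "pw \<in> M" "\<And>u. u \<in> M \<Longrightarrow> E u pw \<longleftrightarrow> subset_in M E u om" using powerset[OF om(1)] by blast
  have Qchar: "\<exists>n f k c. c \<in> M \<and> p = cnd n f (secs k (Rl c)) \<and> P (hcode n f) (secs k (Rl c)) \<and>
      (\<forall>j. Rl u (pr 0 j) \<longleftrightarrow> j = hcode n f) \<and> (\<forall>j. Rl u (pr 1 j) \<longleftrightarrow> j = k) \<and>
      (\<forall>j. Rl u (pr 2 j) \<longleftrightarrow> Rl c j)" if Q: "Q u p" and p: "p \<in> M" for u p
  proof -
    obtain h k c where c: "c \<in> M" and a: "\<forall>j v. v = pr 0 j \<longrightarrow> (Rl u v \<longleftrightarrow> j = h)"
      "\<forall>j v. v = pr 1 j \<longrightarrow> (Rl u v \<longleftrightarrow> j = k)" "\<forall>j v. v = pr 2 j \<longrightarrow> (Rl u v \<longleftrightarrow> Rl c j)"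
      "cndc p h k c" "P h (secs k (Rl c))"
      using Q unfolding Q_def by (elim exE bexE conjE) (rule that; assumption)
    have "valid h" using a(4) unfolding cndc_def by (rule conjunct1)
    then obtain n f where h: "h = hcode n f" unfolding valid_def by blast
    have "p = cnd n f (secs k (Rl c))" using a(4) cndc_iff[OF p okr_secs[OF c]] unfolding h by blast
    moreover have "\<forall>j. Rl u (pr 0 j) \<longleftrightarrow> j = hcode n f" "\<forall>j. Rl u (pr 1 j) \<longleftrightarrow> j = k"
      "\<forall>j. Rl u (pr 2 j) \<longleftrightarrow> Rl c j" "P (hcode n f) (secs k (Rl c))" using a unfolding h by simp_all
    ultimately show ?thesis
      using c by (intro exI[of _ n] exI[of _ f] exI[of _ k] exI[of _ c] conjI)
  qed
  have "\<exists>D\<in>M. \<forall>p\<in>M. E p D \<longleftrightarrow> (\<exists>u\<in>M. E u pw \<and> Q u p)"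
  proof (rule dfn_replacement[OF Qd pw(1)])
    fix u p p' assume pM: "p \<in> M" "p' \<in> M" and Q: "Q u p" "Q u p'"
    obtain n f k c where 1: "c \<in> M" "p = cnd n f (secs k (Rl c))"
      "\<forall>j. Rl u (pr 0 j) \<longleftrightarrow> j = hcode n f" "\<forall>j. Rl u (pr 1 j) \<longleftrightarrow> j = k" "\<forall>j. Rl u (pr 2 j) \<longleftrightarrow> Rl c j"
      using Qchar[OF Q(1) pM(1)] by blast
    obtain n' f' k' c' where 2: "c' \<in> M" "p' = cnd n' f' (secs k' (Rl c'))"
      "\<forall>j. Rl u (pr 0 j) \<longleftrightarrow> j = hcode n' f'" "\<forall>j. Rl u (pr 1 j) \<longleftrightarrow> j = k'" "\<forall>j. Rl u (pr 2 j) \<longleftrightarrow> Rl c' j"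
      using Qchar[OF Q(2) pM(2)] by blast
    have "hcode n f = hcode n' f'" using 1(3) 2(3) by blast
    moreover have "k = k'" using 1(4) 2(4) by blast
    moreover have "Rl c = Rl c'" using 1(5) 2(5) by blast
    ultimately show "p = p'" using cnd_eq[OF okr_secs[OF 1(1)] okr_secs[OF 2(1)]] 1(2) 2(2) by simp
  qed
  then obtain D where D: "D \<in> M" "\<And>p. p \<in> M \<Longrightarrow> E p D \<longleftrightarrow> (\<exists>u\<in>M. E u pw \<and> Q u p)" by blast
  have "E p D \<longleftrightarrow> (\<exists>n f Y. okr Y \<and> p = cnd n f Y \<and> P (hcode n f) Y)" if p: "p \<in> M" for p
  proof
    assume "E p D"
    then obtain u where "Q u p" using D(2)[OF p] by blast
    from Qchar[OF this p] okr_secs show "\<exists>n f Y. okr Y \<and> p = cnd n f Y \<and> P (hcode n f) Y" by blast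
  next
    assume "\<exists>n f Y. okr Y \<and> p = cnd n f Y \<and> P (hcode n f) Y"
    then obtain n f Y where Y: "okr Y" "p = cnd n f Y" "P (hcode n f) Y" by blast
    have "w.fin Y" using Y(1) unfolding okr_def w.fin_def .
    from w.ex_secs[OF this] obtain k z where z: "z \<in> RR" "Y = secs k z" by blast
    obtain c where c: "c \<in> M" "Rl c = z" using z(1) unfolding RR_iff by blast
    define y where "y v \<longleftrightarrow> fs v = 0 \<and> sn v = hcode n f \<or> fs v = 1 \<and> sn v = k \<or> fs v = 2 \<and> z (sn v)" for v
    have "y \<in> RR"
      unfolding y_def
      by (intro w.Df_compr w.Df_disj w.Df_conj w.Df_mem[OF z(1)] w.Df_comp[OF cb_eq] cf_fs cf_sn cf_var cf_const)
    from RR_subset_om[OF this] obtain u where u: "u \<in> M" "subset_in M E u om" "Rl u = y" by blast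
    have "cndc p (hcode n f) k c" using cndc_iff[OF p okr_secs[OF c(1)]] Y(2) z(2) c(2) by simp
    then have "Q u p"
      unfolding Q_def u(3) using c Y(3) z(2)
      by (intro exI[of _ "hcode n f"] exI[of _ k] bexI[of _ c]) (simp_all add: y_def)
    then show "E p D" using D(2)[OF p] u pw(2) by blast
  qed
  then show ?thesis using D(1) by blast
qed

end

theorem presentable_if_generic:
  assumes G: "KS_generic M E g" and x: "contains_real M E x"
    and \<alpha>: "presentable (x \<squnion>\<^sub>T labelling_real g) \<alpha>"
  shows "presentable x \<alpha>"
proof -
  obtain G where KG: "KS_generic_filter M E G" and g: "g = (\<Union>p\<in>G. KS_labelling M E p)"
    using G unfolding KS_generic_def by blast
  have GF: "KS_filter M E G" and Gd: "\<And>D. D \<in> M \<Longrightarrow> KS_dense_in M E D \<Longrightarrow> \<exists>p\<in>G. E p D"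
    using KG unfolding KS_generic_filter_def by blast+
  have Gc: "\<And>p. p \<in> G \<Longrightarrow> KS_cond M E p"
    and Gdir: "\<And>p q. p \<in> G \<Longrightarrow> q \<in> G \<Longrightarrow> \<exists>r\<in>G. KS_le M E r p \<and> KS_le M E r q"
    using GF unfolding KS_filter_def by blast+
  obtain c0 where c0: "c0 \<in> M" "Rl c0 = x" using x RR_iff unfolding RR_def by blast
  interpret w: world x RR Df using world[OF c0(1)] unfolding c0(2) .
  have fin: "w.fin Y \<longleftrightarrow> okr Y" for Y unfolding w.fin_def okr_def ..
  define H where "H = {(h, Y). \<exists>n f. h = hcode n f \<and> okr Y \<and> cnd n f Y \<in> G}"
  have dir: "\<exists>n'' f'' Y''. okr Y'' \<and> cnd n'' f'' Y'' \<in> G \<and>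
      le Y (hcode n'' f'') (hcode n f) \<and> Y \<subseteq> Y'' \<and> le Y' (hcode n'' f'') (hcode n' f') \<and> Y' \<subseteq> Y''"
    if Y: "okr Y" "cnd n f Y \<in> G" "okr Y'" "cnd n' f' Y' \<in> G" for n f Y n' f' Y'
  proof -
    obtain q where q: "q \<in> G" "KS_le M E q (cnd n f Y)" "KS_le M E q (cnd n' f' Y')"
      using Gdir[OF Y(2,4)] by blast
    obtain n'' f'' Y'' where "okr Y''" "q = cnd n'' f'' Y''" using Gc[OF q(1)] unfolding KS_cond_iff by blast
    then show ?thesis using q KS_le_cnd Y(1,3) by blast
  qed
  obtain r where r: "Well_order r" "computable_rel (x \<squnion>\<^sub>T labelling_real g) r" "has_type r \<alpha>"
    using \<alpha> unfolding presentable_def by blast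
  obtain p where p: "\<And>m n. computes (x \<squnion>\<^sub>T labelling_real g) p [m, n] (of_bool ((m, n) \<in> r))"
    using r(2) unfolding computable_rel_def by blast
  have "kgen x RR Df H (labelling_real g) p r"
  proof
    fix h X assume "(h, X) \<in> H"
    then show "valid h \<and> w.fin X" unfolding H_def fin valid_def by blast
  next
    fix h X h' X' assume a: "(h, X) \<in> H" "(h', X') \<in> H"
    from a(1) obtain n f where 1: "h = hcode n f" "okr X" "cnd n f X \<in> G" unfolding H_def by blast
    from a(2) obtain n' f' where 2: "h' = hcode n' f'" "okr X'" "cnd n' f' X' \<in> G" unfolding H_def by blast
    obtain n'' f'' Y'' where 3: "okr Y''" "cnd n'' f'' Y'' \<in> G" "le X (hcode n'' f'') (hcode n f)" "X \<subseteq> Y''"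
      "le X' (hcode n'' f'') (hcode n' f')" "X' \<subseteq> Y''" using dir[OF 1(2,3) 2(2,3)] by blast
    have "(hcode n'' f'', Y'') \<in> H" unfolding H_def using 3(1,2) by blast
    then show "\<exists>h'' X''. (h'', X'') \<in> H \<and> le X h'' h \<and> X \<subseteq> X'' \<and> le X' h'' h' \<and> X' \<subseteq> X''"
      unfolding 1(1) 2(1) using 3(3-6) by (intro exI conjI)
  next
    fix Z B U
    assume Z: "Df (\<lambda>_ e. Z (e 0))" and B: "Df (\<lambda>_ e. B (e 0) (e 1))" and U: "Df (\<lambda>_ e. U (e 0) (e 1))"
      and dense: "\<And>h X. valid h \<Longrightarrow> w.fin X \<Longrightarrow> \<exists>h' X'. valid h' \<and> w.fin X' \<and> X \<subseteq> X' \<and> le X h' h \<and>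
         (w.noext X' h' Z \<or> (\<exists>m. B h' m \<and> w.noext X' h' (\<lambda>h''. U h'' m)))"
    define P where "P h X \<longleftrightarrow> w.noext X h Z \<or> (\<exists>m. B h m \<and> w.noext X h (\<lambda>h''. U h'' m))" for h X
    have dense': "\<exists>h' X'. valid h' \<and> okr X' \<and> X \<subseteq> X' \<and> le X h' h \<and> P h' X'" if "valid h" "okr X" for h X
      using dense[of h X] that unfolding P_def fin by blast
    have "Df (\<lambda>z e. P (e 0) (secs (e 1) z))"
      unfolding P_def w.noext_def
      by (intro w.Df_disj w.Df_ex w.Df_all w.Df_imp w.Df_not w.Df_conj w.Df_comp[OF cb_valid] w.Df_le
          w.Df_app1[OF Z] w.Df_app2[of "\<lambda>_. B", OF B] w.Df_app2[of "\<lambda>_. U", OF U] cf_var)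
    from ex_dense_set[OF c0(1), of P, OF this] obtain D where D: "D \<in> M"
      "\<And>p. p \<in> M \<Longrightarrow> E p D \<longleftrightarrow> (\<exists>n f Y. okr Y \<and> p = cnd n f Y \<and> P (hcode n f) Y)" by blast
    have "KS_dense_in M E D"
      unfolding KS_dense_in_def
    proof (intro conjI ballI impI)
      show "D \<in> M" by fact
      show "KS_cond M E q" if "q \<in> M" "E q D" for q
        using D(2)[OF that(1)] that(2) unfolding KS_cond_iff by blast
      fix q assume "q \<in> M" "KS_cond M E q"
      then obtain n f Y where q: "okr Y" "q = cnd n f Y" unfolding KS_cond_iff by blast
      have "valid (hcode n f)" unfolding valid_def by blast
      from dense'[OF this q(1)] obtain h' Y' where h': "valid h'" "okr Y'" "Y \<subseteq> Y'"
        "le Y h' (hcode n f)" "P h' Y'" by blast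
      obtain n' f' where h'': "h' = hcode n' f'" using h'(1) unfolding valid_def by blast
      have "cnd n' f' Y' \<in> M" by (rule cnd_in[OF h'(2)])
      moreover have "E (cnd n' f' Y') D" using D(2)[OF calculation] h' unfolding h'' by blast
      moreover have "KS_le M E (cnd n' f' Y') q" using KS_le_cnd[OF q(1) h'(2)] h' unfolding q(2) h'' by blast
      ultimately show "\<exists>q'\<in>M. E q' D \<and> KS_le M E q' q" by blast
    qed
    from Gd[OF D(1) this] obtain q where q: "q \<in> G" "E q D" by blast
    then obtain n f Y where Y: "okr Y" "q = cnd n f Y" using Gc unfolding KS_cond_iff by blast
    have "q \<in> M" using Y cnd_in by simp
    from D(2)[OF this] q(2) obtain n' f' Y' where "okr Y'" "q = cnd n' f' Y'" "P (hcode n' f') Y'" by blast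
    then have "\<exists>h X. (h, X) \<in> H \<and> P h X" using q(1) unfolding H_def by blast
    then show "\<exists>h X. (h, X) \<in> H \<and> (w.noext X h Z \<or> (\<exists>m. B h m \<and> w.noext X h (\<lambda>h''. U h'' m)))"
      unfolding P_def .
  next
    fix h X assume "(h, X) \<in> H"
    then obtain n f where h: "h = hcode n f" "okr X" "cnd n f X \<in> G" unfolding H_def by blast
    show "apx (labelling_real g) h"
      unfolding apx_def h(1) hn_hcode
    proof (intro allI impI)
      fix q assume q: "q \<le> n"
      show "q \<in> hs (hcode n f) \<longleftrightarrow> labelling_real g q"
      proof
        assume "q \<in> hs (hcode n f)"
        then obtain \<sigma> where \<sigma>: "q = pr (scode \<sigma>) (label_code (f \<sigma>))" "length \<sigma> \<le> n" unfolding hs_hcode by blast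
        have "(\<sigma>, f \<sigma>) \<in> g" unfolding g using h(3) KS_labelling_cnd[OF h(2)] \<sigma>(2) by blast
        then show "labelling_real g q" unfolding labelling_real_def using \<sigma>(1) by (auto simp: scode_def)
      next
        assume "labelling_real g q"
        then obtain \<sigma> l where l: "(\<sigma>, l) \<in> g" "q = pr (scode \<sigma>) (label_code l)"
          unfolding labelling_real_def scode_def by blast
        \<comment> \<open>The label may come from another condition of the filter; a common
          extension shows that it agrees with \<open>f\<close>.\<close>
        obtain q' where q': "q' \<in> G" "(\<sigma>, l) \<in> KS_labelling M E q'" using l(1) unfolding g by blast
        obtain n' f' Y' where Y': "okr Y'" "q' = cnd n' f' Y'" using Gc[OF q'(1)] unfolding KS_cond_iff by blast
        have \<sigma>: "length \<sigma> \<le> n'" "l = f' \<sigma>" using q'(2) KS_labelling_cnd[OF Y'(1)] unfolding Y'(2) by blast+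
        obtain n'' f'' Y'' where "le X (hcode n'' f'') (hcode n f)" "le Y' (hcode n'' f'') (hcode n' f')"
          using dir[OF h(2,3) Y'(1)] q'(1) unfolding Y'(2) by blast
        then have "f \<sigma> = f'' \<sigma>" if "length \<sigma> \<le> n" using that unfolding le_hcode by blast
        moreover have "f' \<sigma> = f'' \<sigma>"
          using \<open>le Y' (hcode n'' f'') (hcode n' f')\<close> \<sigma>(1) unfolding le_hcode by blast
        \<comment> \<open>The code of the pair is at least the length of the string, so
          \<open>q \<le> n\<close> keeps the string in the domain of the labelling.\<close>
        moreover have "length \<sigma> \<le> n"
          using lenc_le[of "scode \<sigma>"] le_prod_encode_1[of "scode \<sigma>" "label_code l"] l(2) q by simp
        ultimately have "q = pr (scode \<sigma>) (label_code (f \<sigma>))" "length \<sigma> \<le> n" using l(2) \<sigma>(2) by simp_all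
        then show "q \<in> hs (hcode n f)" unfolding hs_hcode by blast
      qed
    qed
  qed (rule r(1), rule p)
  from kgen.presentable_generic[OF this r(3)] show ?thesis .
qed

end

theorem theoremA4:
  fixes M :: "'a set" and E :: "'a \<Rightarrow> 'a \<Rightarrow> bool" and g :: "(bool list \<times> label) set"
  assumes "ZF_model M E" and "omega_model M E"
    and "KS_generic M E g"
  shows "\<forall>x. contains_real M E x \<longrightarrow> omega1 (x \<squnion>\<^sub>T labelling_real g) = omega1 x"
proof (intro allI impI)
  fix x assume x: "contains_real M E x"
  interpret zfm M E using assms(1,2) by (rule zfm.intro)
  \<comment> \<open>If both oracles present the same ordinals, the least ordinals they do not
    present coincide.\<close>
  have "presentable (x \<squnion>\<^sub>T labelling_real g) \<alpha> \<longleftrightarrow> presentable x \<alpha>" for \<alpha>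
  proof
    show "presentable (x \<squnion>\<^sub>T labelling_real g) \<alpha> \<Longrightarrow> presentable x \<alpha>"
      by (rule presentable_if_generic[OF assms(3) x])
    show "presentable x \<alpha> \<Longrightarrow> presentable (x \<squnion>\<^sub>T labelling_real g) \<alpha>"
      unfolding presentable_def using computable_rel_join by blast
  qed
  then show "omega1 (x \<squnion>\<^sub>T labelling_real g) = omega1 x" unfolding omega1_def by simp
qed

end
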